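(* For every integer $N\ge1$ there is a constant $C_N>0$, independent of $c$ and $h$, such that for all real $c,h$ $$\det{}_N(c,h)=C_N\prod_{1\le rs\le N}\bigl(h-h_{r,s}(c)\bigr)^{P(N-rs)},$$ where the product is over all ordered pairs of positive integers $(r,s)$ with $rs\le N$.
   Context: The Virasoro algebra has generators $L_n$ ($n\in\mathbb{Z}$) with $[L_m,L_n]=(m-n)L_{m+n}+\frac{c}{12}(m^3-m)\delta_{m+n,0}$ on representations of central charge $c$. The Verma module $V(c,h)$ is the universal representation of central charge $c$ generated by a vector $\xi_0$ with $L_n\xi_0=0$ for $n>0$ and $L_0\xi_0=h\xi_0$. For real $c,h$ it carries a unique hermitian form with $(\xi_0,\xi_0)=1$ and $(L_n\xi,\eta)=(\xi,L_{-n}\eta)$. $\det_N(c,h)$ is the determinant of the $P(N)\times P(N)$ matrix with entries $$(L_{-i_p}\cdots L_{-i_1}\xi_0,\;L_{-j_q}\cdots L_{-j_1}\xi_0),$$ indexed by the partitions $1\le i_1\le\cdots\le i_p$, $1\le j_1\le\cdots\le j_q$ of $N=\sum i_s=\sum j_t$ (the same ordering of partitions for rows and columns). $P(n)$ is the number of partitions of $n$, with $P(0)=1$. For positive integers $p,q$, $$h_{p,q}(c)=\tfrac1{48}\Bigl[(13-c)(p^2+q^2)+\sqrt{(c-1)(c-25)}\,(p^2-q^2)-24pq-2+2c\Bigr],$$ with one fixed choice of square root (possibly complex) for each $c$; the product in the formula does not depend on this choice since changing it exchanges $h_{p,q}(c)$ and $h_{q,p}(c)$. *)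

theory Defs
  imports Complex_Main "HOL-Library.Poly_Mapping" "Jordan_Normal_Form.Determinant"
begin

section \<open>The Verma module of the Virasoro algebra\<close>

text \<open>
  The free complex vector space on words over the integers; the word
  \<open>[n\<^sub>1, \<dots>, n\<^sub>k]\<close> stands for the formal vector \<open>L\<^bsub>n\<^sub>1\<^esub> \<cdots> L\<^bsub>n\<^sub>k\<^esub> \<xi>\<^sub>0\<close>.
\<close>

type_synonym words = "int list \<Rightarrow>\<^sub>0 complex"

definition words_scale :: "complex \<Rightarrow> words \<Rightarrow> words" where
  "words_scale a x = Poly_Mapping.map ((*) a) x"

definition words_L :: "int \<Rightarrow> words \<Rightarrow> words" where
  "words_L n x = (\<Sum>w\<in>Poly_Mapping.keys x. Poly_Mapping.single (n # w) (Poly_Mapping.lookup x w))"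

definition words_vac :: words where
  "words_vac = Poly_Mapping.single [] 1"

definition central_term :: "complex \<Rightarrow> int \<Rightarrow> int \<Rightarrow> complex" where
  "central_term c m n = (if m + n = 0 then c / 12 * of_int (m ^ 3 - m) else 0)"

text \<open>
  The smallest subspace stable under all \<open>L\<^sub>n\<close> that has to be divided out in order to obtain a
  representation of central charge \<open>c\<close> in which \<open>\<xi>\<^sub>0\<close> is a highest weight vector of weight \<open>h\<close>.
  The quotient is therefore the universal such representation (lemma \<open>verma_universal\<close> below).
\<close>

inductive_set verma_rel :: "complex \<Rightarrow> complex \<Rightarrow> words set" for c h :: complex where
  zero: "0 \<in> verma_rel c h"
| add: "x \<in> verma_rel c h \<Longrightarrow> y \<in> verma_rel c h \<Longrightarrow> x + y \<in> verma_rel c h"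
| scale: "x \<in> verma_rel c h \<Longrightarrow> words_scale a x \<in> verma_rel c h"
| L: "x \<in> verma_rel c h \<Longrightarrow> words_L n x \<in> verma_rel c h"
| bracket: "words_L m (words_L n x) - words_L n (words_L m x)
      - (words_scale (of_int (m - n)) (words_L (m + n) x) + words_scale (central_term c m n) x)
      \<in> verma_rel c h"
| annihilation: "n > 0 \<Longrightarrow> words_L n words_vac \<in> verma_rel c h"
| weight: "words_L 0 words_vac - words_scale h words_vac \<in> verma_rel c h"

definition verma_class :: "complex \<Rightarrow> complex \<Rightarrow> words \<Rightarrow> words set" where
  "verma_class c h x = {y. y - x \<in> verma_rel c h}"

definition verma_space :: "complex \<Rightarrow> complex \<Rightarrow> words set set" where
  "verma_space c h = {verma_class c h x | x. True}"

definition verma_add :: "complex \<Rightarrow> complex \<Rightarrow> words set \<Rightarrow> words set \<Rightarrow> words set" where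
  "verma_add c h \<xi> \<eta> = (\<Union>x\<in>\<xi>. \<Union>y\<in>\<eta>. verma_class c h (x + y))"

definition verma_scale :: "complex \<Rightarrow> complex \<Rightarrow> complex \<Rightarrow> words set \<Rightarrow> words set" where
  "verma_scale c h a \<xi> = (\<Union>x\<in>\<xi>. verma_class c h (words_scale a x))"

definition verma_L :: "complex \<Rightarrow> complex \<Rightarrow> int \<Rightarrow> words set \<Rightarrow> words set" where
  "verma_L c h n \<xi> = (\<Union>x\<in>\<xi>. verma_class c h (words_L n x))"

definition verma_vac :: "complex \<Rightarrow> complex \<Rightarrow> words set" where
  "verma_vac c h = verma_class c h words_vac"

subsection \<open>The operations on the quotient and its universal property\<close>

lemma lookup_words_scale [simp]:
  "Poly_Mapping.lookup (words_scale a x) w = a * Poly_Mapping.lookup x w"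
  by (simp add: words_scale_def map.rep_eq "when_def")

lemma words_scale_add: "words_scale a (x + y) = words_scale a x + words_scale a y"
  by (rule poly_mapping_eqI) (simp add: lookup_add algebra_simps)

lemma words_scale_diff: "words_scale a (x - y) = words_scale a x - words_scale a y"
  by (rule poly_mapping_eqI) (simp add: lookup_minus algebra_simps)

lemma words_scale_minus_one: "words_scale (- 1) x = - x"
  by (rule poly_mapping_eqI) simp

lemma words_L_add: "words_L n (x + y) = words_L n x + words_L n y"
  unfolding words_L_def
  by (rule setsum_keys_plus_distrib) (simp_all add: single_add)

lemma words_L_diff: "words_L n (x - y) = words_L n x - words_L n y"
  by (metis add_diff_cancel diff_add_cancel words_L_add)

lemma words_L_scale: "words_L n (words_scale a x) = words_scale a (words_L n x)"
proof -
  have "words_L n (words_scale a x)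
      = (\<Sum>w\<in>Poly_Mapping.keys x. Poly_Mapping.single (n # w) (a * Poly_Mapping.lookup x w))"
    unfolding words_L_def
    by (rule sum.mono_neutral_cong_left) (auto simp: in_keys_iff)
  also have "\<dots> = words_scale a (words_L n x)"
    by (rule poly_mapping_eqI)
      (simp add: words_L_def lookup_sum lookup_single sum_distrib_left "when_def" if_distrib cong: if_cong)
  finally show ?thesis .
qed

lemma verma_rel_uminus: "x \<in> verma_rel c h \<Longrightarrow> - x \<in> verma_rel c h"
  using verma_rel.scale[of x c h "- 1"] by (simp add: words_scale_minus_one)

lemma verma_rel_diff: "x \<in> verma_rel c h \<Longrightarrow> y \<in> verma_rel c h \<Longrightarrow> x - y \<in> verma_rel c h"
  using verma_rel.add[of x c h "- y"] by (simp add: verma_rel_uminus)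

lemma verma_class_eq_iff: "verma_class c h x = verma_class c h y \<longleftrightarrow> x - y \<in> verma_rel c h"
proof
  assume "verma_class c h x = verma_class c h y"
  moreover have "x \<in> verma_class c h x" by (simp add: verma_class_def verma_rel.zero)
  ultimately show "x - y \<in> verma_rel c h" by (simp add: verma_class_def)
next
  assume xy: "x - y \<in> verma_rel c h"
  have "z - x \<in> verma_rel c h \<longleftrightarrow> z - y \<in> verma_rel c h" for z
    using verma_rel.add[OF _ xy, of "z - x"] verma_rel_diff[OF _ xy, of "z - y"] by auto
  then show "verma_class c h x = verma_class c h y" by (simp add: verma_class_def)
qed

lemma verma_class_UN:
  assumes "\<And>y. y - x \<in> verma_rel c h \<Longrightarrow> F y = F x"
  shows "(\<Union>y\<in>verma_class c h x. F y) = F x"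
proof -
  have "x \<in> verma_class c h x" by (simp add: verma_class_def verma_rel.zero)
  moreover have "\<And>y. y \<in> verma_class c h x \<Longrightarrow> F y = F x"
    by (auto simp: verma_class_def assms)
  ultimately show ?thesis by blast
qed

lemma verma_add_class:
  "verma_add c h (verma_class c h x) (verma_class c h y) = verma_class c h (x + y)"
proof -
  have "(\<Union>y'\<in>verma_class c h y. verma_class c h (x' + y')) = verma_class c h (x' + y)" for x'
    by (rule verma_class_UN) (simp add: verma_class_eq_iff)
  then show ?thesis
    unfolding verma_add_def
    by simp (rule verma_class_UN, simp add: verma_class_eq_iff)
qed

lemma verma_scale_class:
  "verma_scale c h a (verma_class c h x) = verma_class c h (words_scale a x)"
  unfolding verma_scale_def
  by (rule verma_class_UN)
    (simp add: verma_class_eq_iff words_scale_diff[symmetric] verma_rel.scale)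

lemma verma_L_class: "verma_L c h n (verma_class c h x) = verma_class c h (words_L n x)"
  unfolding verma_L_def
  by (rule verma_class_UN) (simp add: verma_class_eq_iff words_L_diff[symmetric] verma_rel.L)

lemma verma_bracket:
  assumes "\<xi> \<in> verma_space c h"
  shows "verma_add c h (verma_L c h m (verma_L c h n \<xi>))
            (verma_scale c h (- 1) (verma_L c h n (verma_L c h m \<xi>)))
       = verma_add c h (verma_scale c h (of_int (m - n)) (verma_L c h (m + n) \<xi>))
            (verma_scale c h (central_term c m n) \<xi>)"
proof -
  obtain x where "\<xi> = verma_class c h x"
    using assms by (auto simp: verma_space_def)
  then show ?thesis
    using verma_rel.bracket[of m n x c h]
    by (simp add: verma_add_class verma_scale_class verma_L_class verma_class_eq_iff
        words_scale_minus_one)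
qed

lemma verma_annihilation:
  "n > 0 \<Longrightarrow> verma_L c h n (verma_vac c h) = verma_class c h 0"
  by (simp add: verma_vac_def verma_L_class verma_class_eq_iff verma_rel.annihilation)

lemma verma_weight: "verma_L c h 0 (verma_vac c h) = verma_scale c h h (verma_vac c h)"
  by (simp add: verma_vac_def verma_L_class verma_scale_class verma_class_eq_iff verma_rel.weight)

lemma verma_universal:
  fixes smul :: "complex \<Rightarrow> 'w::ab_group_add \<Rightarrow> 'w" and M :: "int \<Rightarrow> 'w \<Rightarrow> 'w" and v :: 'w
  assumes vs: "vector_space smul"
    and M_add: "\<And>n x y. M n (x + y) = M n x + M n y"
    and M_scale: "\<And>n a x. M n (smul a x) = smul a (M n x)"
    and M_bracket: "\<And>m n x. M m (M n x) - M n (M m x)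
        = smul (of_int (m - n)) (M (m + n) x) + smul (central_term c m n) x"
    and v_ann: "\<And>n. n > 0 \<Longrightarrow> M n v = 0"
    and v_weight: "M 0 v = smul h v"
  shows "\<exists>f. f (verma_vac c h) = v
      \<and> (\<forall>\<xi>\<in>verma_space c h. \<forall>\<eta>\<in>verma_space c h. f (verma_add c h \<xi> \<eta>) = f \<xi> + f \<eta>)
      \<and> (\<forall>a. \<forall>\<xi>\<in>verma_space c h. f (verma_scale c h a \<xi>) = smul a (f \<xi>))
      \<and> (\<forall>n. \<forall>\<xi>\<in>verma_space c h. f (verma_L c h n \<xi>) = M n (f \<xi>))"
proof -
  interpret V: vector_space smul by (rule vs)
  have M0: "M n 0 = 0" for n
    using M_add[of n 0 0] by simp
  have M_sum: "M n (sum g A) = (\<Sum>i\<in>A. M n (g i))" for n A and g :: "int list \<Rightarrow> 'w"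
    by (induction A rule: infinite_finite_induct) (simp_all add: M0 M_add)
  define e where "e x = (\<Sum>w\<in>Poly_Mapping.keys x. smul (Poly_Mapping.lookup x w) (foldr M w v))"
    for x :: words
  have e_add: "e (x + y) = e x + e y" for x y
    unfolding e_def by (rule setsum_keys_plus_distrib) (simp_all add: V.scale_left_distrib)
  have e_0: "e 0 = 0" by (simp add: e_def)
  have e_diff: "e (x - y) = e x - e y" for x y
    by (metis add_diff_cancel diff_add_cancel e_add)
  have e_sum: "e (sum g A) = (\<Sum>i\<in>A. e (g i))" for A and g :: "int list \<Rightarrow> words"
    by (induction A rule: infinite_finite_induct) (simp_all add: e_0 e_add)
  have e_scale: "e (words_scale a x) = smul a (e x)" for a x
  proof -
    have "e (words_scale a x)
        = (\<Sum>w\<in>Poly_Mapping.keys x. smul (a * Poly_Mapping.lookup x w) (foldr M w v))"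
      unfolding e_def by (rule sum.mono_neutral_cong_left) (auto simp: in_keys_iff)
    then show ?thesis by (simp add: e_def V.scale_sum_right)
  qed
  have e_single: "e (Poly_Mapping.single w a) = smul a (foldr M w v)" for w a
    by (simp add: e_def)
  have e_L: "e (words_L n x) = M n (e x)" for n x
    by (simp add: words_L_def e_sum e_single) (simp add: e_def M_sum M_scale)
  have e_vac: "e words_vac = v"
    by (simp add: words_vac_def e_single)
  have e_rel: "e x = 0" if "x \<in> verma_rel c h" for x
    using that
    by induction (simp_all add: e_0 e_add e_diff e_scale e_L e_vac M0 M_bracket v_ann v_weight)
  define f where "f \<xi> = e (SOME x. x \<in> \<xi>)" for \<xi>
  have f_class: "f (verma_class c h x) = e x" for x
  proof -
    have "x \<in> verma_class c h x" by (simp add: verma_class_def verma_rel.zero)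
    then have "(SOME y. y \<in> verma_class c h x) \<in> verma_class c h x" by (rule someI)
    then have "e ((SOME y. y \<in> verma_class c h x) - x) = 0"
      by (intro e_rel) (simp add: verma_class_def)
    then show ?thesis by (simp add: f_def e_diff)
  qed
  show ?thesis
    by (rule exI[of _ f])
      (auto simp: verma_vac_def verma_space_def verma_add_class verma_scale_class verma_L_class
        f_class e_vac e_add e_scale e_L)
qed

section \<open>The contravariant form\<close>

text \<open>
  Linear in the first argument. The last condition fixes the values outside the Verma module, so that
  the form is unique as a function.
\<close>

definition contravariant_form ::
    "complex \<Rightarrow> complex \<Rightarrow> (words set \<Rightarrow> words set \<Rightarrow> complex) \<Rightarrow> bool" where
  "contravariant_form c h B \<longleftrightarrow>
     (\<forall>\<xi>\<in>verma_space c h. \<forall>\<eta>\<in>verma_space c h. \<forall>\<zeta>\<in>verma_space c h.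
        B (verma_add c h \<xi> \<eta>) \<zeta> = B \<xi> \<zeta> + B \<eta> \<zeta>) \<and>
     (\<forall>a. \<forall>\<xi>\<in>verma_space c h. \<forall>\<eta>\<in>verma_space c h.
        B (verma_scale c h a \<xi>) \<eta> = a * B \<xi> \<eta>) \<and>
     (\<forall>\<xi>\<in>verma_space c h. \<forall>\<eta>\<in>verma_space c h. B \<eta> \<xi> = cnj (B \<xi> \<eta>)) \<and>
     B (verma_vac c h) (verma_vac c h) = 1 \<and>
     (\<forall>n. \<forall>\<xi>\<in>verma_space c h. \<forall>\<eta>\<in>verma_space c h.
        B (verma_L c h n \<xi>) \<eta> = B \<xi> (verma_L c h (- n) \<eta>)) \<and>
     (\<forall>\<xi> \<eta>. \<xi> \<notin> verma_space c h \<or> \<eta> \<notin> verma_space c h \<longrightarrow> B \<xi> \<eta> = 0)"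

text \<open>Meaningful for real \<open>c\<close> and \<open>h\<close>; only these are used below.\<close>

definition verma_form :: "complex \<Rightarrow> complex \<Rightarrow> words set \<Rightarrow> words set \<Rightarrow> complex" where
  "verma_form c h = (THE B. contravariant_form c h B)"

section \<open>The Kac determinant\<close>

definition partitions :: "nat \<Rightarrow> nat list set" where
  "partitions N = {is. sorted is \<and> (\<forall>i\<in>set is. 1 \<le> i) \<and> sum_list is = N}"

definition num_partitions :: "nat \<Rightarrow> nat" where
  "num_partitions N = card (partitions N)"

lemma num_partitions_0: "num_partitions 0 = 1"
proof -
  have "is = []" if "is \<in> partitions 0" for "is"
    using that by (cases "is") (simp_all add: partitions_def)
  then have "partitions 0 = {[]}"
    by (auto simp: partitions_def)
  then show ?thesis by (simp add: num_partitions_def)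
qed

text \<open>
  The list \<open>[i\<^sub>1, \<dots>, i\<^sub>p]\<close> gives \<open>L\<^bsub>-i\<^sub>p\<^esub> \<cdots> L\<^bsub>-i\<^sub>1\<^esub> \<xi>\<^sub>0\<close>: the head acts first.
\<close>

definition verma_monomial :: "complex \<Rightarrow> complex \<Rightarrow> nat list \<Rightarrow> words set" where
  "verma_monomial c h is = fold (\<lambda>i. verma_L c h (- int i)) is (verma_vac c h)"

text \<open>
  An arbitrary enumeration of the partitions, used for both rows and columns; the determinant does
  not depend on it.
\<close>

definition partition_list :: "nat \<Rightarrow> nat list list" where
  "partition_list N = (SOME ps. distinct ps \<and> set ps = partitions N)"

definition gram_matrix :: "nat \<Rightarrow> complex \<Rightarrow> complex \<Rightarrow> complex mat" where
  "gram_matrix N c h = mat (num_partitions N) (num_partitions N)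
     (\<lambda>(i, j). verma_form c h (verma_monomial c h (partition_list N ! i))
                              (verma_monomial c h (partition_list N ! j)))"

definition kac_det :: "nat \<Rightarrow> real \<Rightarrow> real \<Rightarrow> complex" where
  "kac_det N c h = Determinant.det (gram_matrix N (complex_of_real c) (complex_of_real h))"

text \<open>
  The number \<open>h\<^bsub>p,q\<^esub>(c)\<close>, where \<open>s\<close> is the chosen square root of \<open>(c - 1) (c - 25)\<close>.
\<close>

definition h_pq :: "complex \<Rightarrow> real \<Rightarrow> nat \<Rightarrow> nat \<Rightarrow> complex" where
  "h_pq s c p q = 1 / 48 * ((13 - of_real c) * (of_nat p ^ 2 + of_nat q ^ 2)
     + s * (of_nat p ^ 2 - of_nat q ^ 2) - 24 * of_nat p * of_nat q - 2 + 2 * of_real c)"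

end

theory Submission
  imports Defs "HOL-Computational_Algebra.Formal_Power_Series"
    "HOL-Computational_Algebra.Fundamental_Theorem_Algebra"
begin

text \<open>
  The Gram matrix at level \<open>N\<close> is realised in a Fock space with background charge \<open>\<rho>\<close> and
  momentum \<open>\<mu>\<close>, where \<open>c = 1 - 12 \<rho>\<^sup>2\<close> and \<open>h = (\<mu>\<^sup>2 - \<rho>\<^sup>2) / 2\<close>. It factors there as \<open>A B\<close>, with
  \<open>A\<close> expanding \<open>L\<^bsub>-i\<^sub>p\<^esub> \<cdots> L\<^bsub>-i\<^sub>1\<^esub> \<xi>\<^sub>0\<close> in the Fock basis and \<open>B\<close> lowering back to the vacuum. As
  \<open>\<mu> \<rightarrow> \<infinity>\<close> both factors become diagonal, which gives the degree of the determinant in \<open>h\<close> and its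
  leading coefficient, independently of \<open>c\<close>.

  Write \<open>c = 13 - 6 t - 6 / t\<close>. For a positive integer \<open>t\<close> and \<open>h = h\<^bsub>r,s\<^esub>\<close>, integrating a product
  of \<open>r\<close> screening currents produces a vector of level \<open>r s\<close> killed by all \<open>L\<^sub>k\<close> with \<open>k > 0\<close>. All
  contour integrals are constant terms of Laurent polynomials, and the vector is nonzero because the
  constant term of \<open>\<Prod>\<^bsub>i \<noteq> j\<^esub> (1 - z\<^sub>i / z\<^sub>j)\<^sup>t\<close> is a sum of squares. If \<open>t\<close> is large compared to \<open>N\<close>, the
  formula at level \<open>N - r s\<close> shows that the representation generated by this vector has full
  dimension \<open>P(N - r s)\<close> at level \<open>N\<close>. It lies in the left kernel of \<open>B\<close>, so \<open>h\<^bsub>r,s\<^esub>\<close> is a root of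
  multiplicity at least \<open>P(N - r s)\<close>; for large \<open>t\<close> these roots are distinct and exhaust the degree.
  Both sides are Laurent polynomials in \<open>t\<close>, hence the formula holds for all \<open>t \<noteq> 0\<close>.
\<close>

subsection \<open>Vacuum functionals on words\<close>

text \<open>Two obstacles shape the proof. A module given by generators and relations comes without
  a basis, and it might collapse. So every Gram entry is written as a value of a functional on
  words, the coefficient of L_w xi_0 along xi_0: the relations determine it uniquely, and the Fock
  space provides it. The second obstacle is multiplicity. A singular vector of weight h_{r,s} + rs
  yields P(N - rs) kernel vectors only if its descendants are independent, and that is decided by
  the determinant of level N - rs at this shifted weight, which must avoid the roots there. A large
  t ensures this, because a coincidence would be an integer relation in t with small coefficients.
  Integrality of t makes the integrand a Laurent polynomial, so integrating means reading off a
  coefficient, and total derivatives have constant term zero. The sum of squares appears on the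
  torus |z_i| = 1, where z_i/z_j - 1 and z_j/z_i - 1 are conjugate. Multiplicities are found in the
  momentum \<mu> and pass to h because \<mu> is nonzero at the roots in question, so that h is a
  local coordinate there.\<close>

definition vac_fun :: "complex \<Rightarrow> complex \<Rightarrow> (int list \<Rightarrow> complex) \<Rightarrow> bool" where
  "vac_fun c h \<psi> \<longleftrightarrow> \<psi> [] = 1 \<and>
     (\<forall>n w. n < 0 \<longrightarrow> \<psi> (n # w) = 0) \<and>
     (\<forall>n w. n > 0 \<longrightarrow> \<psi> (w @ [n]) = 0) \<and>
     (\<forall>w. \<psi> (w @ [0]) = h * \<psi> w) \<and>
     (\<forall>u m n v. \<psi> (u @ m # n # v) = \<psi> (u @ n # m # v)
        + of_int (m - n) * \<psi> (u @ (m + n) # v) + central_term c m n * \<psi> (u @ v))"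

lemma
  assumes "vac_fun c h \<psi>"
  shows vac_fun_Nil: "\<psi> [] = 1"
    and vac_fun_neg: "n < 0 \<Longrightarrow> \<psi> (n # w) = 0"
    and vac_fun_pos: "n > 0 \<Longrightarrow> \<psi> (w @ [n]) = 0"
    and vac_fun_zero: "\<psi> (w @ [0]) = h * \<psi> w"
    and vac_fun_swap: "\<psi> (u @ m # n # v) = \<psi> (u @ n # m # v)
        + of_int (m - n) * \<psi> (u @ (m + n) # v) + central_term c m n * \<psi> (u @ v)"
  using assms unfolding vac_fun_def by blast+

text \<open>Normal ordering as an induction rule. A word ending in a positive letter is a base case
  and a final 0 is stripped. A negative final letter is moved to the front by swaps, whose
  correction words are shorter and fall under the induction on length.\<close>

lemma word_induct [case_names Nil pos zero neg swap]:
  fixes P :: "int list \<Rightarrow> bool"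
  assumes Nil: "P []"
    and pos: "\<And>n w. n > 0 \<Longrightarrow> P (w @ [n])"
    and zero: "\<And>w. P w \<Longrightarrow> P (w @ [0])"
    and neg: "\<And>n w. n < 0 \<Longrightarrow> P w \<Longrightarrow> P (n # w)"
    and swap: "\<And>u m n v. P (u @ n # m # v) \<Longrightarrow> P (u @ (m + n) # v) \<Longrightarrow> P (u @ v) \<Longrightarrow> P (u @ m # n # v)"
  shows "P w"
proof (induction w rule: length_induct)
  case (1 w)
  show ?case
  proof (cases w rule: rev_cases)
    case Nil
    then show ?thesis using assms(1) by simp
  next
    case (snoc u n)
    consider "n > 0" | "n = 0" | "n < 0" by linarith
    then show ?thesis
    proof cases
      case 1
      then show ?thesis using pos snoc by simp
    next
      case 2
      then show ?thesis using zero snoc 1 by simp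
    next
      case 3
      have "P (x @ n # v)" if "length (x @ n # v) = length w" for x v
        using that
      proof (induction x arbitrary: v rule: rev_induct)
        case Nil
        then show ?case using neg[OF 3] 1 by simp
      next
        case (snoc m x)
        have "P (x @ m # n # v)"
          by (rule swap) (use snoc 1 in auto)
        then show ?case by simp
      qed
      from this[of u "[]"] show ?thesis using snoc by simp
    qed
  qed
qed

text \<open>
  Used for polynomial and Laurent polynomial functions, and with \<open>F f \<longleftrightarrow> f True = f False\<close> for the
  uniqueness of vacuum functionals.
\<close>

locale function_algebra =
  fixes F :: "('t \<Rightarrow> complex) \<Rightarrow> bool"
  assumes const: "F (\<lambda>_. a)"
    and add: "F f \<Longrightarrow> F g \<Longrightarrow> F (\<lambda>x. f x + g x)"
    and mult: "F f \<Longrightarrow> F g \<Longrightarrow> F (\<lambda>x. f x * g x)"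
begin

lemma sum: "(\<And>i. i \<in> A \<Longrightarrow> F (f i)) \<Longrightarrow> F (\<lambda>x. \<Sum>i\<in>A. f i x)"
  by (induction A rule: infinite_finite_induct) (simp_all add: add const)

lemma prod: "(\<And>i. i \<in> A \<Longrightarrow> F (f i)) \<Longrightarrow> F (\<lambda>x. \<Prod>i\<in>A. f i x)"
  by (induction A rule: infinite_finite_induct) (simp_all add: mult const)

lemma power: "F f \<Longrightarrow> F (\<lambda>x. f x ^ n)"
  by (induction n) (simp_all add: mult const)

lemma diff: "F f \<Longrightarrow> F g \<Longrightarrow> F (\<lambda>x. f x - g x)"
  using add[of f "\<lambda>x. -1 * g x"] mult[OF const[of "-1"], of g] by simp

lemma det:
  assumes "\<And>i j. i < n \<Longrightarrow> j < n \<Longrightarrow> F (\<lambda>x. A x i j)"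
  shows "F (\<lambda>x. Determinant.det (mat n n (\<lambda>(i, j). A x i j)))"
proof -
  have "Determinant.det (mat n n (\<lambda>(i, j). A x i j)) =
      (\<Sum>p | p permutes {0..<n}. signof p * (\<Prod>i = 0..<n. A x i (p i)))" for x
    unfolding Determinant.det_def
    by (auto intro!: sum.cong prod.cong dest: permutes_in_image)
  moreover have "F (\<lambda>x. \<Sum>p | p permutes {0..<n}. signof p * (\<Prod>i = 0..<n. A x i (p i)))"
    by (intro sum mult prod const assms) (auto dest: permutes_in_image)
  ultimately show ?thesis by simp
qed

text \<open>Each reduction in \<open>word_induct\<close> expresses a value through earlier ones with
  coefficients built from constants, \<open>c\<close> and \<open>h\<close>, so the values never
  leave the algebra.\<close>

lemma vac_fun:
  assumes vf: "\<And>x. vac_fun (c x) (h x) (\<psi> x)" and c: "F c" and h: "F h"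
  shows "F (\<lambda>x. \<psi> x w)"
proof (induction w rule: word_induct)
  case Nil
  then show ?case
    by (simp add: vac_fun_Nil[OF vf] vac_fun_neg[OF vf] vac_fun_pos[OF vf] vac_fun_zero[OF vf] const)
next
  case (pos n w)
  then show ?case
    by (simp add: vac_fun_Nil[OF vf] vac_fun_neg[OF vf] vac_fun_pos[OF vf] vac_fun_zero[OF vf] const)
next
  case (zero w)
  then have "F (\<lambda>x. h x * \<psi> x w)" by (rule mult[OF h])
  then show ?case
    by (simp add: vac_fun_Nil[OF vf] vac_fun_neg[OF vf] vac_fun_pos[OF vf] vac_fun_zero[OF vf] const)
next
  case (neg n w)
  then show ?case
    by (simp add: vac_fun_Nil[OF vf] vac_fun_neg[OF vf] vac_fun_pos[OF vf] vac_fun_zero[OF vf] const)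
next
  case (swap u m n v)
  have eq: "\<psi> x (u @ m # n # v) = \<psi> x (u @ n # m # v)
        + of_int (m - n) * \<psi> x (u @ (m + n) # v) + central_term (c x) m n * \<psi> x (u @ v)" for x
    by (rule vac_fun_swap[OF vf])
  have "F (\<lambda>x. c x * (of_int (m ^ 3 - m) / 12))"
    by (rule mult[OF c const])
  then have "F (\<lambda>x. central_term (c x) m n)"
    unfolding central_term_def by (cases "m + n = 0") (simp_all add: field_simps const)
  then show ?case unfolding eq by (intro add mult const swap)
qed

end

lemma vac_fun_unique:
  assumes "vac_fun c h \<psi>" "vac_fun c h \<psi>'"
  shows "\<psi> w = \<psi>' w"
proof -
  interpret function_algebra "\<lambda>f :: bool \<Rightarrow> complex. f True = f False"
    by unfold_locales auto
  show ?thesis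
    using vac_fun[of "\<lambda>_. c" "\<lambda>_. h" "\<lambda>b. if b then \<psi> else \<psi>'" w] assms by simp
qed

text \<open>All relations are homogeneous in the sum of the letters; the central term drops two
  letters, but only when they add up to 0.\<close>

lemma vac_fun_total:
  assumes "vac_fun c h \<psi>"
  shows "sum_list w \<noteq> 0 \<Longrightarrow> \<psi> w = 0"
proof (induction w rule: word_induct)
  case (swap u m n v)
  have eq: "\<psi> (u @ m # n # v) = \<psi> (u @ n # m # v)
        + of_int (m - n) * \<psi> (u @ (m + n) # v) + central_term c m n * \<psi> (u @ v)"
    by (rule vac_fun_swap[OF assms])
  show ?case
    unfolding eq using swap by (simp add: central_term_def add_ac)
qed (use assms in \<open>simp_all add: vac_fun_neg vac_fun_pos vac_fun_zero\<close>)

subsection \<open>The Fock representation\<close>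

type_synonym fock = "nat multiset \<Rightarrow> complex"

section \<open>Heisenberg modes, normal ordering and the operators \<open>L_n\<close>\<close>

text \<open>
  A vector is stored through its pairings with the monomials \<open>a\<^bsub>-m\<^sub>1\<^esub> \<cdots> a\<^bsub>-m\<^sub>k\<^esub>\<close>, for all multisets
  \<open>{#m\<^sub>1, \<dots>, m\<^sub>k#}\<close>. So the annihilation operators are shifts, and no finiteness of support is needed.
\<close>

definition wt :: "nat multiset \<Rightarrow> nat" where
  "wt M = sum_mset M"

lemma wt_empty [simp]: "wt {#} = 0"
  by (simp add: wt_def)

lemma wt_add [simp]: "wt (add_mset m M) = m + wt M"
  by (simp add: wt_def)

lemma wt_union [simp]: "wt (M + M') = wt M + wt M'"
  by (simp add: wt_def)

lemma wt_remove: "m \<in># M \<Longrightarrow> wt M = m + wt (M - {#m#})"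
  by (simp add: wt_def sum_mset.remove)

lemma wt_remove_le: "wt (M - {#m#}) \<le> wt M"
  by (cases "m \<in># M") (simp_all add: wt_remove diff_single_trivial)

lemma wt_member: "m \<in># M \<Longrightarrow> m \<le> wt M"
  by (simp add: wt_remove)

text \<open>In a pairing with a monomial, a mode acts through its adjoint on that monomial. For
  \<open>k < 0\<close> the adjoint is a derivation removing one part, whence the factor
  \<open>m * count M m\<close>.\<close>

definition heis :: "complex \<Rightarrow> int \<Rightarrow> fock \<Rightarrow> fock" where
  "heis \<mu> k f M = (if k > 0 then f (add_mset (nat k) M)
     else if k = 0 then \<mu> * f M
     else of_nat (nat (- k) * count M (nat (- k))) * f (M - {#nat (- k)#}))"

definition nord :: "complex \<Rightarrow> int \<Rightarrow> int \<Rightarrow> fock \<Rightarrow> fock" where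
  "nord \<mu> k l f = heis \<mu> (min k l) (heis \<mu> (max k l) f)"

text \<open>
  \<open>L\<^sub>n = 1/2 \<Sum>\<^sub>k :a\<^sub>k a\<^bsub>n-k\<^esub>: - \<rho> n a\<^sub>n - \<delta>\<^bsub>n,0\<^esub> \<rho>\<^sup>2/2\<close>; at \<open>M\<close> all terms outside the given range vanish.
\<close>

definition fockL :: "complex \<Rightarrow> complex \<Rightarrow> int \<Rightarrow> fock \<Rightarrow> fock" where
  "fockL \<rho> \<mu> n f M =
     1 / 2 * (\<Sum>k \<in> {- (\<bar>n\<bar> + int (wt M)) .. \<bar>n\<bar> + int (wt M)}. nord \<mu> k (n - k) f M)
     - \<rho> * of_int n * heis \<mu> n f M - (if n = 0 then \<rho>\<^sup>2 / 2 else 0) * f M"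

lemma heis_pos: "k > 0 \<Longrightarrow> heis \<mu> k f M = f (add_mset (nat k) M)"
  by (simp add: heis_def)

lemma heis_zero: "heis \<mu> 0 f M = \<mu> * f M"
  by (simp add: heis_def)

lemma heis_neg: "m > 0 \<Longrightarrow> heis \<mu> (- int m) f M = of_nat (m * count M m) * f (M - {#m#})"
  by (simp add: heis_def)

lemma heis_sum: "heis \<mu> k (\<lambda>M. \<Sum>i\<in>I. a i * f i M) M = (\<Sum>i\<in>I. a i * heis \<mu> k (f i) M)"
  by (simp add: heis_def sum_distrib_left mult_ac)

text \<open>The summation range in \<open>fockL\<close> depends on the multiset. This rule allows a
  common range to be substituted under a mode.\<close>

lemma heis_cong:
  assumes "\<And>M'. wt M' = wt M + nat \<bar>k\<bar> \<or> wt M' \<le> wt M \<Longrightarrow> f M' = g M'"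
  shows "heis \<mu> k f M = heis \<mu> k g M"
  using assms wt_remove_le by (auto simp: heis_def)

lemma heis_comm:
  "heis \<mu> k (heis \<mu> l f) M = heis \<mu> l (heis \<mu> k f) M + (if k + l = 0 then of_int k else 0) * f M"
proof -
  consider "k > 0" "l > 0" | "k > 0" "l < 0" | "k < 0" "l > 0" | "k < 0" "l < 0" | "k = 0" | "l = 0"
    by linarith
  then show ?thesis
  proof cases
    case 1
    then show ?thesis by (simp add: heis_def add_mset_commute)
  next
    case 2
    then obtain a b where "k = int a" "l = - int b" "a > 0" "b > 0"
      by (metis nonneg_int_cases neg_0_less_iff_less of_nat_0_less_iff order.strict_implies_order minus_minus)
    then show ?thesis by (cases "b \<in># M") (auto simp: heis_def algebra_simps not_in_iff)
  next
    case 3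
    then obtain a b where "l = int a" "k = - int b" "a > 0" "b > 0"
      by (metis nonneg_int_cases neg_0_less_iff_less of_nat_0_less_iff order.strict_implies_order minus_minus)
    then show ?thesis by (cases "b \<in># M") (auto simp: heis_def algebra_simps not_in_iff)
  next
    case 4
    then obtain a b where ab: "l = - int a" "k = - int b" "a > 0" "b > 0"
      by (metis nonneg_int_cases neg_0_less_iff_less of_nat_0_less_iff order.strict_implies_order minus_minus)
    have "M - {#a#} - {#b#} = M - {#b#} - {#a#}"
      by (simp add: multiset_eq_iff)
    then show ?thesis using ab by (auto simp: heis_def algebra_simps)
  next
    case 5
    then show ?thesis by (auto simp: heis_def)
  next
    case 6
    then show ?thesis by (auto simp: heis_def)
  qed
qed

lemma heis_lin2:
  "heis \<mu> k (\<lambda>M. f M + a * g M) M = heis \<mu> k f M + a * heis \<mu> k g M"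
  by (simp add: heis_def algebra_simps)

lemma nord_heis:
  "nord \<mu> k l (heis \<mu> j f) M = heis \<mu> j (nord \<mu> k l f) M
     + (if k + j = 0 then of_int k else 0) * heis \<mu> l f M
     + (if l + j = 0 then of_int l else 0) * heis \<mu> k f M"
proof -
  have *: "heis \<mu> a (heis \<mu> b (heis \<mu> j f)) M = heis \<mu> j (heis \<mu> a (heis \<mu> b f)) M
     + (if a + j = 0 then of_int a else 0) * heis \<mu> b f M
     + (if b + j = 0 then of_int b else 0) * heis \<mu> a f M" for a b
  proof -
    have "heis \<mu> b (heis \<mu> j f) = (\<lambda>M. heis \<mu> j (heis \<mu> b f) M + (if b + j = 0 then of_int b else 0) * f M)"
      by (rule ext) (rule heis_comm)
    then have "heis \<mu> a (heis \<mu> b (heis \<mu> j f)) M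
        = heis \<mu> a (heis \<mu> j (heis \<mu> b f)) M + (if b + j = 0 then of_int b else 0) * heis \<mu> a f M"
      by (simp only: heis_lin2)
    then show ?thesis by (simp add: heis_comm[of \<mu> a j])
  qed
  show ?thesis
    unfolding nord_def * by (auto simp: min_def max_def)
qed

text \<open>The outer mode would remove from \<open>M\<close> a part larger than its weight. Hence
  the infinite sum defining \<open>L_n\<close> is finite at each multiset.\<close>

lemma nord_eq_0:
  assumes "min k l < - int (wt M)"
  shows "nord \<mu> k l f M = 0"
proof -
  have "count M (nat (- min k l)) = 0"
  proof (rule ccontr)
    assume "count M (nat (- min k l)) \<noteq> 0"
    then have "nat (- min k l) \<le> wt M"
      by (intro wt_member) (simp add: count_inI)
    then show False using assms by linarith
  qed
  then show ?thesis
    using assms by (simp add: nord_def heis_def[of _ "min k l"] del: min_less_iff_conj)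
qed

lemma nord_sum:
  assumes "finite A" "{- (\<bar>n\<bar> + int (wt M)) .. \<bar>n\<bar> + int (wt M)} \<subseteq> A"
  shows "(\<Sum>k \<in> {- (\<bar>n\<bar> + int (wt M)) .. \<bar>n\<bar> + int (wt M)}. nord \<mu> k (n - k) f M)
     = (\<Sum>k\<in>A. nord \<mu> k (n - k) f M)"
  by (rule sum.mono_neutral_left[OF assms]) (auto intro!: nord_eq_0)

lemma fockL_eq:
  assumes "finite A" "{- (\<bar>n\<bar> + int (wt M)) .. \<bar>n\<bar> + int (wt M)} \<subseteq> A"
  shows "fockL \<rho> \<mu> n f M = 1 / 2 * (\<Sum>k\<in>A. nord \<mu> k (n - k) f M)
     - \<rho> * of_int n * heis \<mu> n f M - (if n = 0 then \<rho>\<^sup>2 / 2 else 0) * f M"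
  unfolding fockL_def nord_sum[OF assms] by simp

lemma fockL_sum: "fockL \<rho> \<mu> n (\<lambda>M. \<Sum>i\<in>I. a i * f i M) M = (\<Sum>i\<in>I. a i * fockL \<rho> \<mu> n (f i) M)"
proof -
  have "nord \<mu> k l (\<lambda>M. \<Sum>i\<in>I. a i * f i M) M = (\<Sum>i\<in>I. a i * nord \<mu> k l (f i) M)" for k l M
    unfolding nord_def heis_sum[abs_def] by (rule refl)
  then show ?thesis
    unfolding fockL_def heis_sum[abs_def]
    by (simp add: sum_subtractf sum_distrib_left algebra_simps sum.swap[where B = I] cong: if_cong)
qed

lemma fockL_lin3:
  "fockL \<rho> \<mu> n (\<lambda>M. f M - a * g M - b * k M) M
     = fockL \<rho> \<mu> n f M - a * fockL \<rho> \<mu> n g M - b * fockL \<rho> \<mu> n k M"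
proof -
  let ?a = "\<lambda>i. if i = 0 then 1 else if i = 1 then - a else - b"
  let ?f = "\<lambda>i. if i = 0 then f else if i = 1 then g else k"
  have "(\<lambda>M. f M - a * g M - b * k M) = (\<lambda>M. \<Sum>i\<in>{0, 1, 2::nat}. ?a i * ?f i M)"
    by (rule ext) simp
  then show ?thesis by (simp only: fockL_sum) simp
qed

text \<open>In the quadratic part only \<open>k = - j\<close> and \<open>k = n + j\<close> fail to
  commute with \<open>a_j\<close>. They contribute equally, which cancels the factor 1/2; the last
  term comes from the background charge.\<close>

lemma fockL_heis:
  "fockL \<rho> \<mu> n (heis \<mu> j f) M = heis \<mu> j (fockL \<rho> \<mu> n f) M - of_int j * heis \<mu> (n + j) f M
     - (if n + j = 0 then \<rho> * of_int (n\<^sup>2) else 0) * f M"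
proof -
  \<comment> \<open>The extra \<bar>j\<bar> makes one range serve at every multiset reached by
    \<open>heis \<mu> j\<close> and puts both exceptional indices inside it.\<close>
  define K where "K = \<bar>n\<bar> + int (wt M) + \<bar>j\<bar>"
  define A where "A = {- K .. K}"
  have A: "finite A" "- j \<in> A" "n + j \<in> A" by (auto simp: A_def K_def)
  have sub: "{- (\<bar>n\<bar> + int (wt M')) .. \<bar>n\<bar> + int (wt M')} \<subseteq> A"
    if "wt M' = wt M + nat \<bar>j\<bar> \<or> wt M' \<le> wt M" for M' :: "nat multiset"
    using that by (auto simp: A_def K_def)
  define g where "g = (\<lambda>M. 1 / 2 * (\<Sum>k\<in>A. nord \<mu> k (n - k) f M)
     - \<rho> * of_int n * heis \<mu> n f M - (if n = 0 then \<rho>\<^sup>2 / 2 else 0) * f M)"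
  have "heis \<mu> j (fockL \<rho> \<mu> n f) M = heis \<mu> j g M"
    by (rule heis_cong) (simp add: fockL_eq[OF A(1) sub] g_def)
  also have "\<dots> = 1 / 2 * (\<Sum>k\<in>A. heis \<mu> j (nord \<mu> k (n - k) f) M)
      - \<rho> * of_int n * heis \<mu> j (heis \<mu> n f) M - (if n = 0 then \<rho>\<^sup>2 / 2 else 0) * heis \<mu> j f M"
    by (simp add: g_def heis_def[of \<mu> j] sum_distrib_left algebra_simps)
  finally have 1: "heis \<mu> j (fockL \<rho> \<mu> n f) M = \<dots>" .
  have "(\<Sum>k\<in>A. nord \<mu> k (n - k) (heis \<mu> j f) M)
     = (\<Sum>k\<in>A. heis \<mu> j (nord \<mu> k (n - k) f) M)
       + (\<Sum>k\<in>A. if k = - j then - of_int j * heis \<mu> (n + j) f M else 0)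
       + (\<Sum>k\<in>A. if k = n + j then - of_int j * heis \<mu> (n + j) f M else 0)"
    unfolding nord_heis sum.distrib by (intro arg_cong2[where f = "(+)"] sum.cong refl) auto
  then have 2: "(\<Sum>k\<in>A. nord \<mu> k (n - k) (heis \<mu> j f) M)
     = (\<Sum>k\<in>A. heis \<mu> j (nord \<mu> k (n - k) f) M) - 2 * of_int j * heis \<mu> (n + j) f M"
    using A by simp
  have "fockL \<rho> \<mu> n (heis \<mu> j f) M = 1 / 2 * (\<Sum>k\<in>A. nord \<mu> k (n - k) (heis \<mu> j f) M)
     - \<rho> * of_int n * heis \<mu> n (heis \<mu> j f) M - (if n = 0 then \<rho>\<^sup>2 / 2 else 0) * heis \<mu> j f M"
    by (rule fockL_eq[OF A(1) sub]) simp
  then show ?thesis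
    unfolding 1 2 heis_comm[of \<mu> n j]
    by (cases "n + j = 0") (simp_all add: field_simps power2_eq_square)
qed

lemma fockL_nonneg:
  assumes "n \<ge> 0" "K \<ge> n + int (wt M)"
  shows "fockL \<rho> \<mu> n f M = 1 / 2 * (\<Sum>i = 0..n. heis \<mu> i (heis \<mu> (n - i) f) M)
     + (\<Sum>m = 1..K. heis \<mu> (- m) (heis \<mu> (n + m) f) M)
     - \<rho> * of_int n * heis \<mu> n f M - (if n = 0 then \<rho>\<^sup>2 / 2 else 0) * f M"
proof -
  have K: "K \<ge> 0" using assms by (simp add: order_trans[rotated])
  have "(\<Sum>k = - K..n + K. nord \<mu> k (n - k) f M)
      = (\<Sum>k \<in> {- K..-1} \<union> {0..n} \<union> {n + 1..n + K}. nord \<mu> k (n - k) f M)"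
    by (rule sum.cong) (use assms K in auto)
  also have "\<dots> = (\<Sum>k = - K..-1. nord \<mu> k (n - k) f M) + (\<Sum>k = 0..n. nord \<mu> k (n - k) f M)
      + (\<Sum>k = n + 1..n + K. nord \<mu> k (n - k) f M)"
    using assms(1) K by (subst sum.union_disjoint; force?)+
  also have "(\<Sum>k = - K..-1. nord \<mu> k (n - k) f M) = (\<Sum>m = 1..K. heis \<mu> (- m) (heis \<mu> (n + m) f) M)"
    by (rule sum.reindex_bij_witness[of _ "\<lambda>m. - m" "\<lambda>k. - k"]) (use assms in \<open>auto simp: nord_def\<close>)
  also have "(\<Sum>k = n + 1..n + K. nord \<mu> k (n - k) f M) = (\<Sum>m = 1..K. heis \<mu> (- m) (heis \<mu> (n + m) f) M)"
    by (rule sum.reindex_bij_witness[of _ "\<lambda>m. n + m" "\<lambda>k. k - n"]) (use assms in \<open>auto simp: nord_def\<close>)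
  also have "(\<Sum>k = 0..n. nord \<mu> k (n - k) f M) = (\<Sum>i = 0..n. heis \<mu> i (heis \<mu> (n - i) f) M)"
  proof (rule sum.cong)
    fix k assume "k \<in> {0..n}"
    then show "nord \<mu> k (n - k) f M = heis \<mu> k (heis \<mu> (n - k) f) M"
      by (auto simp: nord_def min_def max_def heis_comm[of \<mu> "n - k" k])
  qed simp
  finally show ?thesis
    using assms by (subst fockL_eq[of "{- K..n + K}"]) (auto simp: field_simps)
qed

lemma sum_count: "wt M \<le> K \<Longrightarrow> (\<Sum>m = 1..K. m * count M m) = wt M"
proof (induction M)
  case (add x M)
  have "(\<Sum>m = 1..K. m * count (add_mset x M) m)
      = (\<Sum>m = 1..K. m * count M m) + (\<Sum>m = 1..K. if m = x then x else 0)"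
    unfolding sum.distrib[symmetric] by (rule sum.cong) auto
  then show ?case using add by (cases "x = 0") auto
qed simp

text \<open>The creation part of \<open>L_0\<close> counts the total weight of \<open>M\<close>, so
  \<open>L_0\<close> is diagonal on stored vectors.\<close>

lemma fockL_zero: "fockL \<rho> \<mu> 0 f M = ((\<mu>\<^sup>2 - \<rho>\<^sup>2) / 2 + of_nat (wt M)) * f M"
proof -
  have "(\<Sum>m = 1..int (wt M). heis \<mu> (- m) (heis \<mu> m f) M)
      = (\<Sum>m = 1..wt M. of_nat (m * count M m) * f M)"
  proof (rule sum.reindex_bij_witness[of _ int nat])
    fix a assume a: "a \<in> {1..int (wt M)}"
    show "of_nat (nat a * count M (nat a)) * f M = heis \<mu> (- a) (heis \<mu> a f) M"
      using a by (cases "nat a \<in># M") (auto simp: heis_def not_in_iff)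
  qed auto
  also have "\<dots> = of_nat (\<Sum>m = 1..wt M. m * count M m) * f M"
    by (simp add: sum_distrib_right)
  also have "(\<Sum>m = 1..wt M. m * count M m) = wt M"
    by (rule sum_count) simp
  finally show ?thesis
    by (subst fockL_nonneg[where K = "int (wt M)"]) (auto simp: heis_zero power2_eq_square field_simps)
qed

lemma fockL_neg_vac:
  assumes "n < 0"
  shows "fockL \<rho> \<mu> n f {#} = 0"
proof -
  have "nord \<mu> k (n - k) f {#} = 0" for k
    by (rule nord_eq_0) (use assms in auto)
  then show ?thesis using assms by (simp add: fockL_def heis_def)
qed

section \<open>The Virasoro relation in Fock space\<close>

text \<open>
  The defect of the Virasoro relation commutes with the annihilation operators, which are shifts, so
  it vanishes as soon as it vanishes at the empty multiset.
\<close>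

definition vir_defect :: "complex \<Rightarrow> complex \<Rightarrow> int \<Rightarrow> int \<Rightarrow> fock \<Rightarrow> fock" where
  "vir_defect \<rho> \<mu> m n f M = fockL \<rho> \<mu> m (fockL \<rho> \<mu> n f) M - fockL \<rho> \<mu> n (fockL \<rho> \<mu> m f) M
     - of_int (m - n) * fockL \<rho> \<mu> (m + n) f M - central_term (1 - 12 * \<rho>\<^sup>2) m n * f M"

text \<open>The modes are pulled to the outside so that every correction except the last bracket is
  symmetric in \<open>m\<close> and \<open>n\<close> and cancels in the commutator.\<close>

lemma fockL_fockL_heis:
  "fockL \<rho> \<mu> m (fockL \<rho> \<mu> n (heis \<mu> j f)) M = heis \<mu> j (fockL \<rho> \<mu> m (fockL \<rho> \<mu> n f)) M
     - of_int j * (heis \<mu> (m + j) (fockL \<rho> \<mu> n f) M + heis \<mu> (n + j) (fockL \<rho> \<mu> m f) M)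
     - (if m + j = 0 then \<rho> * of_int (m\<^sup>2) else 0) * fockL \<rho> \<mu> n f M
     - (if n + j = 0 then \<rho> * of_int (n\<^sup>2) else 0) * fockL \<rho> \<mu> m f M
     + of_int j * (of_int (n + j) * heis \<mu> (m + n + j) f M
         + (if m + n + j = 0 then \<rho> * of_int (m\<^sup>2) else 0) * f M)"
proof -
  have "fockL \<rho> \<mu> n (heis \<mu> j f) = (\<lambda>M. heis \<mu> j (fockL \<rho> \<mu> n f) M - of_int j * heis \<mu> (n + j) f M
     - (if n + j = 0 then \<rho> * of_int (n\<^sup>2) else 0) * f M)"
    by (rule ext) (rule fockL_heis)
  then have "fockL \<rho> \<mu> m (fockL \<rho> \<mu> n (heis \<mu> j f)) M = fockL \<rho> \<mu> m (heis \<mu> j (fockL \<rho> \<mu> n f)) M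
     - of_int j * fockL \<rho> \<mu> m (heis \<mu> (n + j) f) M
     - (if n + j = 0 then \<rho> * of_int (n\<^sup>2) else 0) * fockL \<rho> \<mu> m f M"
    by (simp only: fockL_lin3)
  then show ?thesis
    unfolding fockL_heis by (simp only: add.assoc[symmetric]) (simp add: algebra_simps)
qed

lemma vir_defect_heis:
  assumes "j > 0"
  shows "vir_defect \<rho> \<mu> m n (heis \<mu> j f) M = heis \<mu> j (vir_defect \<rho> \<mu> m n f) M"
proof -
  have h: "heis \<mu> j (vir_defect \<rho> \<mu> m n f) M = heis \<mu> j (fockL \<rho> \<mu> m (fockL \<rho> \<mu> n f)) M
     - heis \<mu> j (fockL \<rho> \<mu> n (fockL \<rho> \<mu> m f)) M
     - of_int (m - n) * heis \<mu> j (fockL \<rho> \<mu> (m + n) f) M - central_term (1 - 12 * \<rho>\<^sup>2) m n * heis \<mu> j f M"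
    using assms by (simp add: heis_pos vir_defect_def)
  \<comment> \<open>A leftover term in \<rho> exists only for \<open>m + n + j = 0\<close>; it
    cancels because then \<open>m\<^sup>2 - n\<^sup>2 = - j * (m - n)\<close>.\<close>
  show ?thesis
  proof (cases "m + n + j = 0")
    case True
    then have j: "j = - m - n" by simp
    show ?thesis
      unfolding h unfolding vir_defect_def fockL_fockL_heis unfolding fockL_heis
      unfolding j by (simp add: algebra_simps power2_eq_square)
  next
    case False
    then have False': "n + m + j \<noteq> 0" by simp
    show ?thesis
      unfolding h unfolding vir_defect_def fockL_fockL_heis unfolding fockL_heis
      using False False' by (simp add: algebra_simps power2_eq_square)
  qed
qed

text \<open>The part of \<open>L_m\<close> without creation modes. It agrees with \<open>L_m\<close>
  at the empty multiset, and for nonnegative indices these operators all commute.\<close>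

definition vacQ :: "complex \<Rightarrow> complex \<Rightarrow> int \<Rightarrow> fock \<Rightarrow> fock" where
  "vacQ \<rho> \<mu> m f M = 1 / 2 * (\<Sum>i = 0..m. heis \<mu> i (heis \<mu> (m - i) f) M)
     - \<rho> * of_int m * heis \<mu> m f M - (if m = 0 then \<rho>\<^sup>2 / 2 else 0) * f M"

lemma fockL_vac:
  assumes "m \<ge> 0"
  shows "fockL \<rho> \<mu> m f {#} = vacQ \<rho> \<mu> m f {#}"
proof -
  have "(\<Sum>k = 1..m. heis \<mu> (- k) (heis \<mu> (m + k) f) {#}) = 0"
    by (rule sum.neutral) (auto simp: heis_def[of _ "- _"])
  then show ?thesis
    using assms by (simp add: fockL_nonneg[where K = m] vacQ_def)
qed

lemma vacQ_sum: "vacQ \<rho> \<mu> m (\<lambda>M. \<Sum>i\<in>I. a i * f i M) M = (\<Sum>i\<in>I. a i * vacQ \<rho> \<mu> m (f i) M)"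
  unfolding vacQ_def heis_sum[abs_def]
  by (simp add: sum_subtractf sum_distrib_left algebra_simps sum.swap[where B = I] cong: if_cong)

lemma vacQ_lin3:
  "vacQ \<rho> \<mu> n (\<lambda>M. a * f M - b * g M - c * k M) M
     = a * vacQ \<rho> \<mu> n f M - b * vacQ \<rho> \<mu> n g M - c * vacQ \<rho> \<mu> n k M"
proof -
  let ?a = "\<lambda>i. if i = 0 then a else if i = 1 then - b else - c"
  let ?f = "\<lambda>i. if i = 0 then f else if i = 1 then g else k"
  have "(\<lambda>M. a * f M - b * g M - c * k M) = (\<lambda>M. \<Sum>i\<in>{0, 1, 2::nat}. ?a i * ?f i M)"
    by (rule ext) simp
  then show ?thesis by (simp only: vacQ_sum) simp
qed

lemma fockL_lin:
  "fockL \<rho> \<mu> n (\<lambda>M. a * f M - b * g M - c * k M) M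
     = a * fockL \<rho> \<mu> n f M - b * fockL \<rho> \<mu> n g M - c * fockL \<rho> \<mu> n k M"
proof -
  let ?a = "\<lambda>i. if i = 0 then a else if i = 1 then - b else - c"
  let ?f = "\<lambda>i. if i = 0 then f else if i = 1 then g else k"
  have "(\<lambda>M. a * f M - b * g M - c * k M) = (\<lambda>M. \<Sum>i\<in>{0, 1, 2::nat}. ?a i * ?f i M)"
    by (rule ext) simp
  then show ?thesis by (simp only: fockL_sum) simp
qed

lemma heis_lin:
  "heis \<mu> n (\<lambda>M. a * f M - b * g M - c * k M) M
     = a * heis \<mu> n f M - b * heis \<mu> n g M - c * heis \<mu> n k M"
  by (simp add: heis_def algebra_simps)

lemma heis_vacQ:
  assumes "k \<ge> 0" "m \<ge> 0"
  shows "heis \<mu> k (vacQ \<rho> \<mu> m f) = vacQ \<rho> \<mu> m (heis \<mu> k f)"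
proof (rule ext)
  fix M
  have c: "heis \<mu> i (heis \<mu> k g) = heis \<mu> k (heis \<mu> i g)" if "i \<ge> 0" for i g
    using that assms by (intro ext) (simp add: heis_comm[of \<mu> i k])
  have "vacQ \<rho> \<mu> m (heis \<mu> k f) M = 1 / 2 * (\<Sum>i = 0..m. heis \<mu> k (heis \<mu> i (heis \<mu> (m - i) f)) M)
     - \<rho> * of_int m * heis \<mu> k (heis \<mu> m f) M - (if m = 0 then \<rho>\<^sup>2 / 2 else 0) * heis \<mu> k f M"
    unfolding vacQ_def using assms by (simp add: c cong: sum.cong_simp)
  moreover have "heis \<mu> k (\<lambda>M. \<Sum>i = 0..m. heis \<mu> i (heis \<mu> (m - i) f) M) M
      = (\<Sum>i = 0..m. heis \<mu> k (heis \<mu> i (heis \<mu> (m - i) f)) M)"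
    using heis_sum[of \<mu> k "\<lambda>i. 1"] by simp
  ultimately show "heis \<mu> k (vacQ \<rho> \<mu> m f) M = vacQ \<rho> \<mu> m (heis \<mu> k f) M"
    unfolding vacQ_def[abs_def] by (simp only: heis_lin)
qed

lemma vacQ_comm:
  assumes "m \<ge> 0" "n \<ge> 0"
  shows "vacQ \<rho> \<mu> n (vacQ \<rho> \<mu> m f) M = vacQ \<rho> \<mu> m (vacQ \<rho> \<mu> n f) M"
proof -
  have "vacQ \<rho> \<mu> n (vacQ \<rho> \<mu> m f) M = 1 / 2 * (\<Sum>i = 0..n. vacQ \<rho> \<mu> m (heis \<mu> i (heis \<mu> (n - i) f)) M)
     - \<rho> * of_int n * vacQ \<rho> \<mu> m (heis \<mu> n f) M - (if n = 0 then \<rho>\<^sup>2 / 2 else 0) * vacQ \<rho> \<mu> m f M"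
    unfolding vacQ_def[of \<rho> \<mu> n] using assms by (simp add: heis_vacQ cong: sum.cong_simp)
  also have "(\<Sum>i = 0..n. vacQ \<rho> \<mu> m (heis \<mu> i (heis \<mu> (n - i) f)) M)
      = vacQ \<rho> \<mu> m (\<lambda>M. \<Sum>i = 0..n. heis \<mu> i (heis \<mu> (n - i) f) M) M"
    using vacQ_sum[where a = "\<lambda>i. 1" and f = "\<lambda>i. heis \<mu> i (heis \<mu> (n - i) f)" and I = "{0..n}"] by simp
  finally show ?thesis
    unfolding vacQ_def[of \<rho> \<mu> n f, abs_def] by (simp only: vacQ_lin3)
qed

text \<open>Evaluates \<open>L_m L_n\<close> at the empty multiset: once \<open>L_n\<close> is
  outermost it can be replaced by \<open>vacQ\<close> or, for negative \<open>n\<close>, by 0. The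
  sums are the commutators collected on the way.\<close>

lemma vacQ_fockL:
  assumes "m \<ge> 0"
  shows "vacQ \<rho> \<mu> m (fockL \<rho> \<mu> n f) M = fockL \<rho> \<mu> n (vacQ \<rho> \<mu> m f) M
    + 1 / 2 * (\<Sum>i = 0..m. of_int i * heis \<mu> (n + i) (heis \<mu> (m - i) f) M)
    + 1 / 2 * (\<Sum>i = 0..m. of_int (m - i) * heis \<mu> i (heis \<mu> (n + m - i) f) M)
    + 1 / 2 * (\<Sum>i = 0..m. (if i = - n then \<rho> * of_int (n\<^sup>2) else 0) * heis \<mu> (m - i) f M)
    + 1 / 2 * (\<Sum>i = 0..m. (if n + m = i then \<rho> * of_int (n\<^sup>2) else 0) * heis \<mu> i f M)
    - \<rho> * of_int m * (of_int m * heis \<mu> (n + m) f M + (if n + m = 0 then \<rho> * of_int (n\<^sup>2) else 0) * f M)"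
proof -
  have h1: "heis \<mu> j (fockL \<rho> \<mu> n f) M = fockL \<rho> \<mu> n (heis \<mu> j f) M + of_int j * heis \<mu> (n + j) f M
     + (if n + j = 0 then \<rho> * of_int (n\<^sup>2) else 0) * f M" for j f M
    by (simp add: fockL_heis)
  have h2: "heis \<mu> i (heis \<mu> j (fockL \<rho> \<mu> n f)) M = fockL \<rho> \<mu> n (heis \<mu> i (heis \<mu> j f)) M
      + of_int i * heis \<mu> (n + i) (heis \<mu> j f) M
      + of_int j * heis \<mu> i (heis \<mu> (n + j) f) M
      + (if n + i = 0 then \<rho> * of_int (n\<^sup>2) else 0) * heis \<mu> j f M
      + (if n + j = 0 then \<rho> * of_int (n\<^sup>2) else 0) * heis \<mu> i f M" for i j
  proof -
    have "heis \<mu> i (heis \<mu> j (fockL \<rho> \<mu> n f)) M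
      = heis \<mu> i (\<lambda>M. 1 * fockL \<rho> \<mu> n (heis \<mu> j f) M - (- of_int j) * heis \<mu> (n + j) f M
     - (- (if n + j = 0 then \<rho> * of_int (n\<^sup>2) else 0)) * f M) M"
      unfolding h1[of j f, abs_def] by simp
    then show ?thesis
      unfolding heis_lin h1[of i] by simp
  qed
  have s: "fockL \<rho> \<mu> n (\<lambda>M. \<Sum>i = 0..m. heis \<mu> i (heis \<mu> (m - i) f) M) M
      = (\<Sum>i = 0..m. fockL \<rho> \<mu> n (heis \<mu> i (heis \<mu> (m - i) f)) M)"
    using fockL_sum[of \<rho> \<mu> n "\<lambda>i. 1"] by simp
  have e: "n + i = 0 \<longleftrightarrow> i = - n" "n + (m - i) = 0 \<longleftrightarrow> n + m = i" for i
    by auto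
  show ?thesis
    unfolding vacQ_def[of \<rho> \<mu> m f, abs_def] fockL_lin s
    unfolding vacQ_def[of \<rho> \<mu> m] h2 h1 sum.distrib e
    by (simp add: algebra_simps )
qed

text \<open>By \<open>vacQ_comm\<close> the leading terms of both orders agree, leaving
  \<open>Y m n - Y n m\<close>. The values \<open>x\<close> are invariant under \<open>i\<close> to
  \<open>m + n - i\<close>, and this reflection turns the difference into the full sum occurring in
  \<open>L_(m+n)\<close>.\<close>

lemma vir_vac_nonneg:
  assumes "m \<ge> 0" "n \<ge> 0"
  shows "vir_defect \<rho> \<mu> m n f {#} = 0"
proof -
  define x where "x N i = heis \<mu> i (heis \<mu> (N - i) f) {#}" for N i
  have sym: "x N (N - i) = x N i" if "0 \<le> i" "i \<le> N" for N i
    using that by (auto simp: x_def heis_comm[of \<mu> "N - i" i])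
  define Y where "Y m n = (\<Sum>i = 0..m. of_int (m - i) * x (n + m) i)" for m n :: int
  have A: "fockL \<rho> \<mu> m (fockL \<rho> \<mu> n f) {#} = vacQ \<rho> \<mu> n (vacQ \<rho> \<mu> m f) {#}
      + Y m n - \<rho> * of_int (m\<^sup>2) * heis \<mu> (n + m) f {#}"
    if mn: "m \<ge> 0" "n \<ge> 0" for m n
  proof -
    have 1: "(\<Sum>i = 0..m. of_int i * heis \<mu> (n + i) (heis \<mu> (m - i) f) {#}) = Y m n"
      unfolding Y_def
    proof (rule sum.reindex_bij_witness[of _ "\<lambda>i. m - i" "\<lambda>i. m - i"])
      fix i assume i: "i \<in> {0..m}"
      have "heis \<mu> (n + i) (heis \<mu> (m - i) f) {#} = x (n + m) (n + m - (m - i))"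
        by (simp add: x_def add_ac)
      also have "\<dots> = x (n + m) (m - i)" by (rule sym) (use i mn in auto)
      finally show "of_int (m - (m - i)) * x (n + m) (m - i) = of_int i * heis \<mu> (n + i) (heis \<mu> (m - i) f) {#}"
        by simp
    qed auto
    have 2: "(\<Sum>i = 0..m. of_int (m - i) * heis \<mu> i (heis \<mu> (n + m - i) f) {#}) = Y m n"
      by (simp add: Y_def x_def)
    have 3: "(\<Sum>i = 0..m. (if i = - n then \<rho> * of_int (n\<^sup>2) else 0) * heis \<mu> (m - i) f {#}) = 0"
      by (rule sum.neutral) (use mn in auto)
    have 4: "(\<Sum>i = 0..m. (if n + m = i then \<rho> * of_int (n\<^sup>2) else 0) * heis \<mu> i f {#}) = 0"
      by (rule sum.neutral) (use mn in auto)
    have 5: "m = 0 \<or> n + m \<noteq> 0"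
      using mn by auto
    show ?thesis
      unfolding fockL_vac[OF mn(1)] vacQ_fockL[OF mn(1)] 1 2 3 4 fockL_vac[OF mn(2)]
      using 5 by (auto simp: algebra_simps power2_eq_square)
  qed
  have refl: "(\<Sum>i = 0..m + n. of_int (m - i) * x (n + m) i)
      = (\<Sum>i = 0..m + n. of_int (i - n) * x (n + m) i)"
  proof (rule sum.reindex_bij_witness[of _ "\<lambda>i. m + n - i" "\<lambda>i. m + n - i"])
    fix i assume i: "i \<in> {0..m + n}"
    have "x (n + m) (m + n - i) = x (n + m) i" using sym[of i "n + m"] i by (simp add: add_ac)
    then show "of_int (m + n - i - n) * x (n + m) (m + n - i) = of_int (m - i) * x (n + m) i"
      by simp
  qed auto
  have 1: "2 * (\<Sum>i = 0..m + n. of_int (m - i) * x (n + m) i) = of_int (m - n) * (\<Sum>i = 0..m + n. x (n + m) i)"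
    unfolding mult_2 by (subst (2) refl) (simp add: sum.distrib[symmetric] sum_distrib_left algebra_simps)
  have "(\<Sum>i = 0..m + n. of_int (m - i) * x (n + m) i)
     = (\<Sum>i \<in> {0..m} \<union> {m + 1..m + n}. of_int (m - i) * x (n + m) i)"
    by (rule sum.cong) (use assms in auto)
  also have "\<dots> = Y m n + (\<Sum>i = m + 1..m + n. of_int (m - i) * x (n + m) i)"
    unfolding Y_def by (subst sum.union_disjoint) auto
  also have "(\<Sum>i = m + 1..m + n. of_int (m - i) * x (n + m) i)
      = (\<Sum>i = 0..n - 1. - (of_int (n - i) * x (m + n) i))"
  proof (rule sum.reindex_bij_witness[of _ "\<lambda>i. m + n - i" "\<lambda>i. m + n - i"])
    fix i assume i: "i \<in> {m + 1..m + n}"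
    have "x (n + m) (m + n - i) = x (n + m) i" using sym[of i "n + m"] i assms by (simp add: add_ac)
    then show "- (of_int (n - (m + n - i)) * x (m + n) (m + n - i)) = of_int (m - i) * x (n + m) i"
      by (simp add: add_ac algebra_simps)
  qed auto
  also have "\<dots> = - (\<Sum>i = 0..n - 1. of_int (n - i) * x (m + n) i)"
    by (rule sum_negf)
  also have "(\<Sum>i = 0..n - 1. of_int (n - i) * x (m + n) i) = Y n m"
    unfolding Y_def by (rule sum.mono_neutral_left) auto
  finally have Y: "2 * (Y m n - Y n m) = of_int (m - n) * (\<Sum>i = 0..m + n. x (m + n) i)"
    using 1 by (simp add: add_ac)
  have L: "fockL \<rho> \<mu> (m + n) f {#} = 1 / 2 * (\<Sum>i = 0..m + n. x (m + n) i)
      - \<rho> * of_int (m + n) * heis \<mu> (m + n) f {#} - (if m + n = 0 then \<rho>\<^sup>2 / 2 else 0) * f {#}"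
    using fockL_vac[of "m + n"] assms by (simp add: vacQ_def x_def)
  have "of_int (m - n) * fockL \<rho> \<mu> (m + n) f {#}
      = Y m n - Y n m - \<rho> * (of_int (m\<^sup>2) - of_int (n\<^sup>2)) * heis \<mu> (m + n) f {#}"
  proof -
    have "m = n \<or> m + n \<noteq> 0"
      using assms by auto
    then have "2 * (of_int (m - n) * fockL \<rho> \<mu> (m + n) f {#})
      = of_int (m - n) * (\<Sum>i = 0..m + n. x (m + n) i)
       - 2 * \<rho> * (of_int (m\<^sup>2) - of_int (n\<^sup>2)) * heis \<mu> (m + n) f {#}"
      unfolding L by (auto simp: field_simps power2_eq_square)
    then have "2 * (of_int (m - n) * fockL \<rho> \<mu> (m + n) f {#})
      = 2 * (Y m n - Y n m - \<rho> * (of_int (m\<^sup>2) - of_int (n\<^sup>2)) * heis \<mu> (m + n) f {#})"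
      unfolding Y[symmetric] by (simp add: algebra_simps)
    then show ?thesis by (simp only: mult_cancel_left) simp
  qed
  moreover have "m + n = 0 \<Longrightarrow> m = 0"
    using assms by linarith
  then have "central_term c m n = 0" for c
    by (auto simp: central_term_def)
  ultimately show ?thesis
    unfolding vir_defect_def A[OF assms] A[OF assms(2) assms(1)]
    by (simp add: vacQ_comm[OF assms] add_ac algebra_simps)
qed

lemma heis_neg_vac: "k < 0 \<Longrightarrow> heis \<mu> k f {#} = 0"
  by (simp add: heis_def)

lemma sum_int_mult_rev:
  assumes "m \<ge> 0"
  shows "(\<Sum>i = 0..m. of_int ((m - i) * i)) = (of_int (m ^ 3 - m) / 6 :: complex)"
proof -
  \<comment> \<open>The upper limit is decoupled from the factor \<open>l - i\<close>, since
    otherwise the summand would change in the induction.\<close>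
  have "(\<Sum>i = 0..int k. of_int ((l - i) * i)) = (of_int ((int k + 1) * int k * (3 * l - 2 * int k - 1)) / 6 :: complex)"
    for k and l :: int
  proof (induction k)
    case (Suc k)
    have "{0..int (Suc k)} = insert (int (Suc k)) {0..int k}" by auto
    then show ?case using Suc by (simp add: field_simps)
  qed simp
  from this[where k = "nat m" and l = m] show ?thesis
    using assms by (simp add: algebra_simps power3_eq_cube)
qed

text \<open>Here \<open>L_n L_m\<close> vanishes at the empty multiset. The cubic central term with
  coefficient 1/12 arises from reordering modes of opposite sign when \<open>m + n = 0\<close>; the
  background charge gives \<open>- \<rho>\<^sup>2 * m ^ 3\<close>, and the shift by
  \<open>\<rho>\<^sup>2 / 2\<close> in \<open>L_0\<close> supplies the matching linear term.\<close>

lemma vir_vac_mixed: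
  assumes "m \<ge> 0" "n < 0"
  shows "vir_defect \<rho> \<mu> m n f {#} = 0"
proof -
  define N where "N = m + n"
  define x where "x i = heis \<mu> i (heis \<mu> (N - i) f) {#}" for i
  have 1: "(\<Sum>i = 0..m. of_int i * heis \<mu> (n + i) (heis \<mu> (m - i) f) {#}) = (\<Sum>i = 0..N. of_int (i - n) * x i)"
  proof -
    have "(\<Sum>i = 0..m. of_int i * heis \<mu> (n + i) (heis \<mu> (m - i) f) {#})
        = (\<Sum>i = - n..m. of_int i * heis \<mu> (n + i) (heis \<mu> (m - i) f) {#})"
      by (rule sum.mono_neutral_right) (use assms in \<open>auto intro!: heis_neg_vac\<close>)
    also have "\<dots> = (\<Sum>i = 0..N. of_int (i - n) * x i)"
      by (rule sum.reindex_bij_witness[of _ "\<lambda>i. i - n" "\<lambda>i. n + i"]) (auto simp: x_def N_def algebra_simps)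
    finally show ?thesis .
  qed
  have 2: "(\<Sum>i = 0..m. of_int (m - i) * heis \<mu> i (heis \<mu> (n + m - i) f) {#})
      = (\<Sum>i = 0..N. of_int (m - i) * x i) + (if N = 0 then of_int (m ^ 3 - m) / 6 * f {#} else 0)"
  proof -
    have "(\<Sum>i = 0..m. of_int (m - i) * heis \<mu> i (heis \<mu> (n + m - i) f) {#})
      = (\<Sum>i = 0..m. (if i \<le> N then of_int (m - i) * x i else 0) + (if N = 0 then of_int ((m - i) * i) * f {#} else 0))"
    proof (rule sum.cong)
      fix i assume i: "i \<in> {0..m}"
      show "of_int (m - i) * heis \<mu> i (heis \<mu> (n + m - i) f) {#}
        = (if i \<le> N then of_int (m - i) * x i else 0) + (if N = 0 then of_int ((m - i) * i) * f {#} else 0)"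
      proof (cases "i \<le> N")
        case True
        then show ?thesis using i by (auto simp: x_def N_def add_ac)
      next
        case False
        then have "heis \<mu> i (heis \<mu> (n + m - i) f) {#} = (if N = 0 then of_int i * f {#} else 0)"
          by (subst heis_comm) (auto simp: heis_neg_vac N_def)
        then show ?thesis using False by simp
      qed
    qed simp
    also have "\<dots> = (\<Sum>i = 0..m. if i \<le> N then of_int (m - i) * x i else 0)
        + (\<Sum>i = 0..m. if N = 0 then of_int ((m - i) * i) * f {#} else 0)"
      by (rule sum.distrib)
    also have "(\<Sum>i = 0..m. if i \<le> N then of_int (m - i) * x i else 0) = (\<Sum>i = 0..N. of_int (m - i) * x i)"
      by (rule sum.mono_neutral_cong_right) (use assms in \<open>auto simp: N_def\<close>)
    also have "(\<Sum>i = 0..m. if N = 0 then of_int ((m - i) * i) * f {#} else 0)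
        = (if N = 0 then of_int (m ^ 3 - m) / 6 * f {#} else 0)"
      unfolding sum_int_mult_rev[OF assms(1), symmetric] sum_distrib_right by simp
    finally show ?thesis .
  qed
  have 3: "(\<Sum>i = 0..m. (if i = - n then \<rho> * of_int (n\<^sup>2) else 0) * heis \<mu> (m - i) f {#})
      = \<rho> * of_int (n\<^sup>2) * heis \<mu> N f {#}"
  proof -
    have "(\<Sum>i = 0..m. (if i = - n then \<rho> * of_int (n\<^sup>2) else 0) * heis \<mu> (m - i) f {#})
        = (\<Sum>i = 0..m. if i = - n then \<rho> * of_int (n\<^sup>2) * heis \<mu> N f {#} else 0)"
      by (rule sum.cong) (auto simp: N_def)
    then show ?thesis using assms by (auto simp: heis_neg_vac N_def)
  qed
  have 4: "(\<Sum>i = 0..m. (if n + m = i then \<rho> * of_int (n\<^sup>2) else 0) * heis \<mu> i f {#})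
      = \<rho> * of_int (n\<^sup>2) * heis \<mu> N f {#}"
  proof -
    have "(\<Sum>i = 0..m. (if n + m = i then \<rho> * of_int (n\<^sup>2) else 0) * heis \<mu> i f {#})
        = (\<Sum>i = 0..m. if N = i then \<rho> * of_int (n\<^sup>2) * heis \<mu> N f {#} else 0)"
      by (rule sum.cong) (auto simp: N_def)
    then show ?thesis using assms by (auto simp: heis_neg_vac N_def)
  qed
  have 5: "(\<Sum>i = 0..N. of_int (i - n) * x i) + (\<Sum>i = 0..N. of_int (m - i) * x i) = of_int (m - n) * (\<Sum>i = 0..N. x i)"
    by (simp add: sum.distrib[symmetric] sum_distrib_left algebra_simps)
  have A: "fockL \<rho> \<mu> m (fockL \<rho> \<mu> n f) {#} = 1 / 2 * (of_int (m - n) * (\<Sum>i = 0..N. x i))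
     + 1 / 2 * (if N = 0 then of_int (m ^ 3 - m) / 6 * f {#} else 0)
     + \<rho> * of_int (n\<^sup>2) * heis \<mu> N f {#}
     - \<rho> * of_int m * (of_int m * heis \<mu> N f {#} + (if N = 0 then \<rho> * of_int (n\<^sup>2) else 0) * f {#})"
    unfolding fockL_vac[OF assms(1)] vacQ_fockL[OF assms(1)] fockL_neg_vac[OF assms(2)] 1 2 3 4 5[symmetric]
    by (simp add: N_def add_ac algebra_simps)
  have B: "fockL \<rho> \<mu> n (fockL \<rho> \<mu> m f) {#} = 0"
    by (rule fockL_neg_vac[OF assms(2)])
  consider "N < 0" | "N = 0" | "N > 0" by linarith
  then show ?thesis
  proof cases
    case 1
    then show ?thesis
      unfolding vir_defect_def A B by (simp add: heis_neg_vac fockL_neg_vac N_def central_term_def)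
  next
    case 2
    then have n: "n = - m" by (simp add: N_def)
    have F1: "fockL \<rho> \<mu> (m + n) f {#} = 1 / 2 * (\<Sum>i = 0..N. x i) - \<rho>\<^sup>2 / 2 * f {#}"
      using 2 by (simp add: fockL_vac vacQ_def x_def N_def)
    have F2: "central_term (1 - 12 * \<rho>\<^sup>2) m n = (1 - 12 * \<rho>\<^sup>2) / 12 * of_int (m ^ 3 - m)"
      using 2 by (simp add: central_term_def N_def)
    show ?thesis
      unfolding vir_defect_def A B F1 F2 using 2 n by (simp add: field_simps power2_eq_square power3_eq_cube)
  next
    case 3
    then have F1: "fockL \<rho> \<mu> (m + n) f {#} = 1 / 2 * (\<Sum>i = 0..N. x i) - \<rho> * of_int N * heis \<mu> N f {#}"
      by (simp add: fockL_vac vacQ_def x_def N_def)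
    have F2: "central_term c m n = 0" for c
      using 3 by (simp add: central_term_def N_def)
    show ?thesis
      unfolding vir_defect_def A B F1 F2 using 3 by (simp add: field_simps power2_eq_square N_def)
  qed
qed

lemma vir_defect_swap: "vir_defect \<rho> \<mu> m n f M = - vir_defect \<rho> \<mu> n m f M"
proof -
  have "central_term c m n = - central_term c n m" for c
  proof (cases "m + n = 0")
    case True
    then have "n = - m" by simp
    then show ?thesis by (simp add: central_term_def field_simps)
  qed (simp add: central_term_def add_ac)
  then show ?thesis by (simp add: vir_defect_def add_ac algebra_simps)
qed

lemma vir_vac: "vir_defect \<rho> \<mu> m n f {#} = 0"
proof -
  consider "m \<ge> 0" "n \<ge> 0" | "m \<ge> 0" "n < 0" | "m < 0" "n \<ge> 0" | "m < 0" "n < 0" by linarith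
  then show ?thesis
  proof cases
    case 3
    then show ?thesis by (subst vir_defect_swap) (simp add: vir_vac_mixed)
  next
    case 4
    then show ?thesis by (simp add: vir_defect_def fockL_neg_vac central_term_def)
  qed (simp_all add: vir_vac_nonneg vir_vac_mixed)
qed

text \<open>Multisets with zeros carry no meaning, but the operators ignore the zeros.\<close>

lemma fockL_add_zero: "fockL \<rho> \<mu> n f (add_mset 0 M) = fockL \<rho> \<mu> n (\<lambda>M. f (add_mset 0 M)) M"
proof -
  have h: "heis \<mu> k f (add_mset 0 M) = heis \<mu> k (\<lambda>M. f (add_mset 0 M)) M" for k f M
  proof (cases "k < 0")
    case True
    then have "add_mset 0 M - {#nat (- k)#} = add_mset 0 (M - {#nat (- k)#})"
      by (simp add: multiset_eq_iff)
    then show ?thesis using True by (simp add: heis_def)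
  qed (auto simp: heis_def add_mset_commute)
  have "nord \<mu> k l f (add_mset 0 M) = nord \<mu> k l (\<lambda>M. f (add_mset 0 M)) M" for k l M
    unfolding nord_def h by (rule refl)
  then show ?thesis by (simp add: fockL_def h)
qed

theorem vir_defect_eq_0: "vir_defect \<rho> \<mu> m n f M = 0"
proof (induction M arbitrary: f)
  case empty
  show ?case by (rule vir_vac)
next
  case (add k M)
  show ?case
  proof (cases "k = 0")
    case True
    have "vir_defect \<rho> \<mu> m n f (add_mset 0 M) = vir_defect \<rho> \<mu> m n (\<lambda>M. f (add_mset 0 M)) M"
      unfolding vir_defect_def fockL_add_zero by (rule refl)
    then show ?thesis using add True by simp
  next
    case False
    have "vir_defect \<rho> \<mu> m n f (add_mset k M) = heis \<mu> (int k) (vir_defect \<rho> \<mu> m n f) M"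
      using False by (simp add: heis_pos)
    also have "\<dots> = vir_defect \<rho> \<mu> m n (heis \<mu> (int k) f) M"
      by (rule vir_defect_heis[symmetric]) (use False in simp)
    finally show ?thesis using add by simp
  qed
qed

section \<open>Words acting on Fock space, levels, and vacuum expectation values\<close>

definition fockW :: "complex \<Rightarrow> complex \<Rightarrow> int list \<Rightarrow> fock \<Rightarrow> fock" where
  "fockW \<rho> \<mu> w f = foldr (fockL \<rho> \<mu>) w f"

text \<open>As vectors are stored through pairings, this is the basis dual to the monomials;
  \<open>fock_delta {#}\<close> is the Fock vacuum.\<close>

definition fock_delta :: "nat multiset \<Rightarrow> fock" where
  "fock_delta M0 M = (if M = M0 then 1 else 0)"

text \<open>Integer levels let a lowering operator reach a negative level, where only 0 lives. The
  second conjunct discards the meaningless multisets containing 0.\<close>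

definition fock_lev :: "int \<Rightarrow> fock \<Rightarrow> bool" where
  "fock_lev l f \<longleftrightarrow> (\<forall>M. f M \<noteq> 0 \<longrightarrow> int (wt M) = l \<and> 0 \<notin># M)"

lemma fockW_Nil [simp]: "fockW \<rho> \<mu> [] f = f"
  by (simp add: fockW_def)

lemma fockW_Cons [simp]: "fockW \<rho> \<mu> (n # w) f = fockL \<rho> \<mu> n (fockW \<rho> \<mu> w f)"
  by (simp add: fockW_def)

lemma fockW_append [simp]: "fockW \<rho> \<mu> (u @ w) f = fockW \<rho> \<mu> u (fockW \<rho> \<mu> w f)"
  by (simp add: fockW_def)

lemma fockW_sum: "fockW \<rho> \<mu> w (\<lambda>M. \<Sum>i\<in>I. a i * f i M) = (\<lambda>M. \<Sum>i\<in>I. a i * fockW \<rho> \<mu> w (f i) M)"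
  by (induction w) (simp_all add: fockL_sum)

lemma fockW_scale: "fockW \<rho> \<mu> w (\<lambda>M. a * f M) = (\<lambda>M. a * fockW \<rho> \<mu> w f M)"
  using fockW_sum[of \<rho> \<mu> w "\<lambda>_. a" "\<lambda>_. f" "{()}"] by simp

lemma fockW_zero: "fockW \<rho> \<mu> w (\<lambda>M. 0) = (\<lambda>M. 0)"
  using fockW_sum[of \<rho> \<mu> w _ _ "{}"] by simp

lemma fockW_swap:
  "fockW \<rho> \<mu> (u @ m # n # v) f M = fockW \<rho> \<mu> (u @ n # m # v) f M
     + of_int (m - n) * fockW \<rho> \<mu> (u @ (m + n) # v) f M + central_term (1 - 12 * \<rho>\<^sup>2) m n * fockW \<rho> \<mu> (u @ v) f M"
proof -
  define g where "g = fockW \<rho> \<mu> v f"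
  let ?c = "central_term (1 - 12 * \<rho>\<^sup>2) m n"
  let ?a = "\<lambda>i. if i = 0 then 1 else if i = 1 then of_int (m - n) else ?c"
  let ?f = "\<lambda>i. if i = 0 then fockL \<rho> \<mu> n (fockL \<rho> \<mu> m g) else if i = 1 then fockL \<rho> \<mu> (m + n) g else g"
  have "fockL \<rho> \<mu> m (fockL \<rho> \<mu> n g) = (\<lambda>M. \<Sum>i\<in>{0, 1, 2::nat}. ?a i * ?f i M)"
    using vir_defect_eq_0[of \<rho> \<mu> m n g] by (intro ext) (simp add: vir_defect_def algebra_simps)
  then have "fockW \<rho> \<mu> u (fockL \<rho> \<mu> m (fockL \<rho> \<mu> n g)) M = (\<Sum>i\<in>{0, 1, 2::nat}. ?a i * fockW \<rho> \<mu> u (?f i) M)"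
    by (simp only: fockW_sum)
  then show ?thesis by (simp add: g_def)
qed

lemma heis_lev:
  assumes "fock_lev l f"
  shows "fock_lev (l - k) (heis \<mu> k f)"
  unfolding fock_lev_def
proof (intro allI impI)
  fix M assume nz: "heis \<mu> k f M \<noteq> 0"
  consider "k > 0" | "k = 0" | "k < 0" by linarith
  then show "int (wt M) = l - k \<and> 0 \<notin># M"
  proof cases
    case 1
    then show ?thesis using nz assms by (force simp: heis_def fock_lev_def)
  next
    case 2
    then show ?thesis using nz assms by (force simp: heis_def fock_lev_def)
  next
    case 3
    define m where "m = nat (- k)"
    have m: "m > 0" "k = - int m" using 3 by (auto simp: m_def)
    then have *: "m \<in># M" "f (M - {#m#}) \<noteq> 0" using nz by (auto simp: heis_neg not_in_iff)
    then have "int (wt (M - {#m#})) = l" "0 \<notin># M - {#m#}"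
      using assms by (auto simp: fock_lev_def)
    then show ?thesis using * m wt_remove[of m M] by (auto simp: not_in_iff)
  qed
qed

lemma fockL_lev:
  assumes "fock_lev l f"
  shows "fock_lev (l - n) (fockL \<rho> \<mu> n f)"
proof -
  have "fock_lev (l - n) (nord \<mu> k (n - k) f)" for k
  proof -
    have "fock_lev (l - max k (n - k) - min k (n - k)) (nord \<mu> k (n - k) f)"
      unfolding nord_def by (intro heis_lev assms)
    moreover have "l - max k (n - k) - min k (n - k) = l - n" by simp
    ultimately show ?thesis by (simp only:)
  qed
  moreover have "fock_lev (l - n) (heis \<mu> n f)"
    by (rule heis_lev[OF assms])
  moreover have "n = 0 \<longrightarrow> fock_lev (l - n) f"
    using assms by simp
  ultimately have z: "nord \<mu> k (n - k) f M = 0" "heis \<mu> n f M = 0" "n = 0 \<longrightarrow> f M = 0"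
    if "\<not> (int (wt M) = l - n \<and> 0 \<notin># M)" for M k
    using that unfolding fock_lev_def by blast+
  have "fockL \<rho> \<mu> n f M = 0" if "\<not> (int (wt M) = l - n \<and> 0 \<notin># M)" for M
    unfolding fockL_def using z[OF that] by simp
  then show ?thesis unfolding fock_lev_def by blast
qed

lemma fockW_lev: "fock_lev l f \<Longrightarrow> fock_lev (l - sum_list w) (fockW \<rho> \<mu> w f)"
proof (induction w)
  case (Cons n w)
  then show ?case using fockL_lev[of "l - sum_list w" "fockW \<rho> \<mu> w f" n] by (simp add: algebra_simps)
qed simp

lemma fock_lev_delta: "0 \<notin># M \<Longrightarrow> fock_lev (int (wt M)) (fock_delta M)"
  by (auto simp: fock_lev_def fock_delta_def)

lemma fock_lev_neg: "fock_lev l f \<Longrightarrow> l < 0 \<Longrightarrow> f = (\<lambda>M. 0)"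
  by (force simp: fock_lev_def)

lemma fockL_pos_vac: "n > 0 \<Longrightarrow> fockL \<rho> \<mu> n (fock_delta {#}) = (\<lambda>M. 0)"
  by (rule fock_lev_neg[OF fockL_lev[OF fock_lev_delta]]) auto

lemma fockL_zero_lev:
  assumes "fock_lev (int l) f"
  shows "fockL \<rho> \<mu> 0 f = (\<lambda>M. ((\<mu>\<^sup>2 - \<rho>\<^sup>2) / 2 + of_nat l) * f M)"
proof
  fix M
  show "fockL \<rho> \<mu> 0 f M = ((\<mu>\<^sup>2 - \<rho>\<^sup>2) / 2 + of_nat l) * f M"
    using assms by (cases "f M = 0") (auto simp: fockL_zero fock_lev_def)
qed

lemma vac_fun_fock:
  "vac_fun (1 - 12 * \<rho>\<^sup>2) ((\<mu>\<^sup>2 - \<rho>\<^sup>2) / 2) (\<lambda>w. fockW \<rho> \<mu> w (fock_delta {#}) {#})"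
  unfolding vac_fun_def
proof (intro conjI allI impI)
  fix n :: int and w assume "n > 0"
  then show "fockW \<rho> \<mu> (w @ [n]) (fock_delta {#}) {#} = 0"
    by (simp add: fockL_pos_vac fockW_zero)
next
  fix w
  have "fockL \<rho> \<mu> 0 (fock_delta {#}) = (\<lambda>M. ((\<mu>\<^sup>2 - \<rho>\<^sup>2) / 2) * fock_delta {#} M)"
    using fockL_zero_lev[of 0 "fock_delta {#}"] fock_lev_delta[of "{#}"] by simp
  then show "fockW \<rho> \<mu> (w @ [0]) (fock_delta {#}) {#} = (\<mu>\<^sup>2 - \<rho>\<^sup>2) / 2 * fockW \<rho> \<mu> w (fock_delta {#}) {#}"
    by (simp only: fockW_append fockW_Cons fockW_Nil fockW_scale)
next
  fix u m n v
  show "fockW \<rho> \<mu> (u @ m # n # v) (fock_delta {#}) {#} = fockW \<rho> \<mu> (u @ n # m # v) (fock_delta {#}) {#}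
     + of_int (m - n) * fockW \<rho> \<mu> (u @ (m + n) # v) (fock_delta {#}) {#}
     + central_term (1 - 12 * \<rho>\<^sup>2) m n * fockW \<rho> \<mu> (u @ v) (fock_delta {#}) {#}"
    by (rule fockW_swap)
qed (simp_all add: fock_delta_def fockL_neg_vac)

definition vev :: "complex \<Rightarrow> complex \<Rightarrow> int list \<Rightarrow> complex" where
  "vev c h = (SOME \<psi>. vac_fun c h \<psi>)"

text \<open>Complex square roots solve for \<rho> and \<mu>, so every pair \<open>c\<close>,
  \<open>h\<close> is realised in some Fock space.\<close>

lemma vac_fun_vev: "vac_fun c h (vev c h)"
proof -
  define \<rho> where "\<rho> = csqrt ((1 - c) / 12)"
  define \<mu> where "\<mu> = csqrt (2 * h + \<rho>\<^sup>2)"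
  have "c = 1 - 12 * \<rho>\<^sup>2" "h = (\<mu>\<^sup>2 - \<rho>\<^sup>2) / 2"
    by (simp_all add: \<mu>_def \<rho>_def diff_divide_distrib)
  then have "\<exists>\<psi>. vac_fun c h \<psi>" using vac_fun_fock by metis
  then show ?thesis unfolding vev_def by (rule someI_ex)
qed

lemma vev_fock:
  assumes "c = 1 - 12 * \<rho>\<^sup>2" "h = (\<mu>\<^sup>2 - \<rho>\<^sup>2) / 2"
  shows "vev c h w = fockW \<rho> \<mu> w (fock_delta {#}) {#}"
  unfolding assms by (rule vac_fun_unique[OF vac_fun_vev vac_fun_fock])

text \<open>A singular vector of level \<open>l\<close> generates a highest weight representation of weight \<open>h + l\<close>.\<close>

lemma fockW_singular:
  assumes u: "fock_lev (int l) u" "\<And>k. k > 0 \<Longrightarrow> fockL \<rho> \<mu> k u = (\<lambda>M. 0)"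
    and c: "c = 1 - 12 * \<rho>\<^sup>2" and h: "h = (\<mu>\<^sup>2 - \<rho>\<^sup>2) / 2 + of_nat l"
  shows "sum_list w \<ge> 0 \<Longrightarrow> fockW \<rho> \<mu> w u = (\<lambda>M. vev c h w * u M)"
proof (induction w rule: word_induct)
  case Nil
  show ?case by (simp add: vac_fun_Nil[OF vac_fun_vev])
next
  case (pos n w)
  then show ?case by (simp add: vac_fun_pos[OF vac_fun_vev] u fockW_zero)
next
  case (zero w)
  have e: "fockL \<rho> \<mu> 0 u = (\<lambda>M. h * u M)"
    by (simp add: fockL_zero_lev[OF u(1)] h)
  have "fockW \<rho> \<mu> w u = (\<lambda>M. vev c h w * u M)"
    using zero by simp
  then show ?case
    unfolding fockW_append fockW_Cons fockW_Nil e fockW_scale vac_fun_zero[OF vac_fun_vev]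
    by (simp add: mult.assoc)
next
  case (neg n w)
  then have "sum_list w > 0" by simp
  then have "fockW \<rho> \<mu> w u = (\<lambda>M. 0)"
    using neg vac_fun_total[OF vac_fun_vev] by simp
  then show ?case
    using fockW_zero[of \<rho> \<mu> "[n]"] by (simp add: vac_fun_neg[OF vac_fun_vev] neg)
next
  case (swap u' m n v)
  \<comment> \<open>The word without both letters has nonnegative total for certain only if
    \<open>m + n = 0\<close>, which is exactly when the central term needs it.\<close>
  have "m + n = 0 \<Longrightarrow> sum_list (u' @ v) \<ge> 0" "sum_list (u' @ n # m # v) \<ge> 0" "sum_list (u' @ (m + n) # v) \<ge> 0"
    using swap.prems by simp_all
  then have IH: "fockW \<rho> \<mu> (u' @ n # m # v) u = (\<lambda>M. vev c h (u' @ n # m # v) * u M)"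
      "fockW \<rho> \<mu> (u' @ (m + n) # v) u = (\<lambda>M. vev c h (u' @ (m + n) # v) * u M)"
      "m + n = 0 \<Longrightarrow> fockW \<rho> \<mu> (u' @ v) u = (\<lambda>M. vev c h (u' @ v) * u M)"
    using swap.IH by blast+
  show ?case
  proof
    fix M
    show "fockW \<rho> \<mu> (u' @ m # n # v) u M = vev c h (u' @ m # n # v) * u M"
      unfolding fockW_swap[of \<rho> \<mu> u' m n v u M] vac_fun_swap[OF vac_fun_vev, of c h u' m n v] IH(1,2)
      using IH(3) by (cases "m + n = 0") (simp_all add: c central_term_def algebra_simps)
  qed
qed

subsection \<open>The contravariant form\<close>

definition dag :: "int list \<Rightarrow> int list" where
  "dag w = map uminus (rev w)"

lemma dag_simps [simp]: "dag [] = []" "dag (n # w) = dag w @ [- n]" "dag (u @ w) = dag w @ dag u" "dag (dag w) = w"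
  by (simp_all add: dag_def rev_map comp_def)

text \<open>A vacuum functional prescribes the effect of 0 only at the right end. At the left end it
  is read off in Fock space, where \<open>L_0\<close> is diagonal and the empty multiset has weight
  0.\<close>

lemma vev_zero_head: "vev c h (0 # w) = h * vev c h w"
proof -
  define \<rho> where "\<rho> = csqrt ((1 - c) / 12)"
  define \<mu> where "\<mu> = csqrt (2 * h + \<rho>\<^sup>2)"
  have *: "c = 1 - 12 * \<rho>\<^sup>2" "h = (\<mu>\<^sup>2 - \<rho>\<^sup>2) / 2"
    by (simp_all add: \<mu>_def \<rho>_def diff_divide_distrib)
  show ?thesis
    unfolding vev_fock[OF *] by (simp add: fockL_zero *(2)[symmetric])
qed

text \<open>For real \<open>c\<close> and \<open>h\<close>, reversing a word with changed signs
  respects the relations, so the conjugated functional is again a vacuum functional; uniqueness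
  applies.\<close>

lemma vev_dag:
  assumes "cnj c = c" "cnj h = h"
  shows "vev c h (dag w) = cnj (vev c h w)"
proof -
  have "vac_fun c h (\<lambda>w. cnj (vev c h (dag w)))"
    unfolding vac_fun_def
  proof (intro conjI allI impI)
    fix u v and m n :: int
    have ct: "cnj (central_term c (- n) (- m)) = central_term c m n"
    proof (cases "m + n = 0")
      case True
      then have "n = - m" by simp
      then show ?thesis using assms by (simp add: central_term_def)
    qed (auto simp: central_term_def)
    show "cnj (vev c h (dag (u @ m # n # v))) = cnj (vev c h (dag (u @ n # m # v)))
        + of_int (m - n) * cnj (vev c h (dag (u @ (m + n) # v))) + central_term c m n * cnj (vev c h (dag (u @ v)))"
      using vac_fun_swap[OF vac_fun_vev, of c h "dag v" "- n" "- m" "dag u"]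
      by (simp add: ct add_ac)
  qed (simp_all add: vac_fun_Nil[OF vac_fun_vev] vac_fun_neg[OF vac_fun_vev] vac_fun_pos[OF vac_fun_vev]
      vev_zero_head assms)
  from vac_fun_unique[OF this vac_fun_vev, of w] show ?thesis
    by (metis complex_cnj_cnj)
qed

section \<open>The hermitian form on words and its descent to the quotient\<close>

definition lf :: "(int list \<Rightarrow> complex) \<Rightarrow> words \<Rightarrow> complex" where
  "lf g x = (\<Sum>w\<in>Poly_Mapping.keys x. Poly_Mapping.lookup x w * g w)"

lemma lf_superset:
  assumes "finite A" "Poly_Mapping.keys x \<subseteq> A"
  shows "lf g x = (\<Sum>w\<in>A. Poly_Mapping.lookup x w * g w)"
  unfolding lf_def by (rule sum.mono_neutral_left[OF assms]) (auto simp: in_keys_iff)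

lemma lf_0 [simp]: "lf g 0 = 0"
  by (simp add: lf_def)

lemma lf_add: "lf g (x + y) = lf g x + lf g y"
  unfolding lf_def by (rule setsum_keys_plus_distrib) (simp_all add: algebra_simps)

lemma lf_diff: "lf g (x - y) = lf g x - lf g y"
  by (metis add_diff_cancel diff_add_cancel lf_add)

lemma lf_sum: "lf g (sum x A) = (\<Sum>i\<in>A. lf g (x i))"
  by (induction A rule: infinite_finite_induct) (simp_all add: lf_add)

lemma lf_scale: "lf g (words_scale a x) = a * lf g x"
proof -
  have "Poly_Mapping.keys (words_scale a x) \<subseteq> Poly_Mapping.keys x"
    by (auto simp: in_keys_iff)
  then show ?thesis
    by (simp add: lf_superset[of "Poly_Mapping.keys x"] lf_def[of _ x] sum_distrib_left mult_ac)
qed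

lemma lf_single [simp]: "lf g (Poly_Mapping.single w a) = a * g w"
  by (simp add: lf_def)

lemma lf_L: "lf g (words_L n x) = lf (\<lambda>w. g (n # w)) x"
  by (simp add: words_L_def lf_sum) (simp add: lf_def)

lemma lf_fun_add: "lf (\<lambda>w. g w + k w) x = lf g x + lf k x"
  by (simp add: lf_def sum.distrib algebra_simps)

lemma lf_fun_scale: "lf (\<lambda>w. a * g w) x = a * lf g x"
  by (simp add: lf_def sum_distrib_left algebra_simps)

text \<open>The two conjugations make the expression conjugate-linear in \<open>y\<close>, while
  \<open>vev\<close> itself enters unconjugated.\<close>

definition word_form :: "complex \<Rightarrow> complex \<Rightarrow> words \<Rightarrow> words \<Rightarrow> complex" where
  "word_form c h x y = lf (\<lambda>w. cnj (lf (\<lambda>w'. cnj (vev c h (dag w' @ w))) y)) x"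

lemma word_form_add: "word_form c h (x + x') y = word_form c h x y + word_form c h x' y"
  by (simp add: word_form_def lf_add)

lemma word_form_diff: "word_form c h (x - x') y = word_form c h x y - word_form c h x' y"
  by (simp add: word_form_def lf_diff)

lemma word_form_scale: "word_form c h (words_scale a x) y = a * word_form c h x y"
  by (simp add: word_form_def lf_scale)

lemma word_form_L: "word_form c h (words_L n x) y = word_form c h x (words_L (- n) y)"
  by (simp add: word_form_def lf_L)

lemma word_form_cnj:
  assumes "cnj c = c" "cnj h = h"
  shows "word_form c h y x = cnj (word_form c h x y)"
proof -
  have *: "cnj (vev c h (dag w' @ w)) = vev c h (dag w @ w')" for w w'
    using vev_dag[OF assms, of "dag w' @ w"] by simp
  show ?thesis
    unfolding word_form_def * by (simp add: lf_def * sum_distrib_left mult_ac sum.swap[of _ "Poly_Mapping.keys y"])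
qed

text \<open>Here \<open>y\<close> stays arbitrary because stability under \<open>L_n\<close> is
  proved by moving the operator onto \<open>y\<close>. The same statement for the second argument
  follows by hermitian symmetry.\<close>

lemma word_form_rel: "x \<in> verma_rel c h \<Longrightarrow> word_form c h x y = 0"
proof (induction arbitrary: y rule: verma_rel.induct)
  case (bracket m n x)
  have "word_form c h (words_L m (words_L n x)) y = word_form c h (words_L n (words_L m x)) y
      + (of_int (m - n) * word_form c h (words_L (m + n) x) y + central_term c m n * word_form c h x y)"
  proof -
    have *: "cnj (vev c h (dag w' @ m # n # w)) = cnj (vev c h (dag w' @ n # m # w))
       + (of_int (m - n) * cnj (vev c h (dag w' @ (m + n) # w))
       + cnj (central_term c m n) * cnj (vev c h (dag w' @ w)))" for w w'
      unfolding vac_fun_swap[OF vac_fun_vev, of c h "dag w'" m n w] by simp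
    show ?thesis
      by (simp add: word_form_def lf_L * lf_fun_add lf_fun_scale del: of_int_diff)
  qed
  then show ?case
    by (simp add: word_form_diff word_form_add word_form_scale)
next
  case (annihilation n)
  then show ?case
    by (simp add: word_form_def lf_L words_vac_def vac_fun_pos[OF vac_fun_vev]) (simp add: lf_def)
next
  case weight
  then show ?case
    by (simp add: word_form_diff word_form_scale)
      (simp add: word_form_def lf_L words_vac_def vac_fun_zero[OF vac_fun_vev] lf_fun_scale)
qed (simp_all add: word_form_def[of _ _ 0] word_form_add word_form_scale word_form_L)

lemma verma_spaceE:
  assumes "\<xi> \<in> verma_space c h"
  obtains x where "\<xi> = verma_class c h x"
  using assms by (auto simp: verma_space_def)

lemma verma_class_in_space [simp]: "verma_class c h x \<in> verma_space c h"
  by (auto simp: verma_space_def)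

lemma contravariant_form_exists:
  assumes real: "cnj c = c" "cnj h = h"
  obtains B where "contravariant_form c h B"
proof -
  define rep where "rep \<xi> = (SOME x. \<xi> = verma_class c h x)" for \<xi>
  define B where "B \<xi> \<eta> = (if \<xi> \<in> verma_space c h \<and> \<eta> \<in> verma_space c h
    then word_form c h (rep \<xi>) (rep \<eta>) else 0)" for \<xi> \<eta>
  have cong1: "word_form c h x y = word_form c h x' y" if "verma_class c h x = verma_class c h x'" for x x' y
    using that word_form_rel[of "x - x'" c h y] by (simp add: verma_class_eq_iff word_form_diff)
  have cong2: "word_form c h y x = word_form c h y x'" if "verma_class c h x = verma_class c h x'" for x x' y
    using cong1[OF that, of y] by (metis word_form_cnj[OF real])
  have rep: "verma_class c h (rep (verma_class c h x)) = verma_class c h x" for x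
    unfolding rep_def by (rule someI[where P = "\<lambda>y. verma_class c h x = verma_class c h y", symmetric]) simp
  have B: "B (verma_class c h x) (verma_class c h y) = word_form c h x y" for x y
    unfolding B_def using cong1[OF rep] cong2[OF rep] by simp
  have "contravariant_form c h B"
    unfolding contravariant_form_def
  proof (intro conjI ballI allI impI)
    fix \<xi> \<eta> assume "\<xi> \<in> verma_space c h" "\<eta> \<in> verma_space c h"
    then show "B \<eta> \<xi> = cnj (B \<xi> \<eta>)"
      by (elim verma_spaceE) (simp add: B, rule word_form_cnj[OF real])
  next
    show "B (verma_vac c h) (verma_vac c h) = 1"
      by (simp add: verma_vac_def B word_form_def words_vac_def vac_fun_Nil[OF vac_fun_vev])
  next
    fix \<xi> \<eta> assume "\<xi> \<notin> verma_space c h \<or> \<eta> \<notin> verma_space c h"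
    then show "B \<xi> \<eta> = 0" by (auto simp: B_def)
  qed (auto elim!: verma_spaceE simp: B verma_add_class verma_scale_class verma_L_class
      word_form_add word_form_scale word_form_L)
  then show thesis by (rule that)
qed

text \<open>The pairings of words with the vacuum form a vacuum functional, hence equal
  \<open>vev\<close>; contravariance then moves the letters of the second argument to the first.
  This is the uniqueness of the form.\<close>

lemma contravariant_form_class:
  assumes "contravariant_form c h B"
  shows "B (verma_class c h x) (verma_class c h y) = word_form c h x y"
proof -
  from assms have
        add: "\<And>x y z. B (verma_class c h (x + y)) (verma_class c h z)
          = B (verma_class c h x) (verma_class c h z) + B (verma_class c h y) (verma_class c h z)"
    and scale: "\<And>a x y. B (verma_class c h (words_scale a x)) (verma_class c h y)
          = a * B (verma_class c h x) (verma_class c h y)"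
    and cnj: "\<And>x y. B (verma_class c h y) (verma_class c h x) = cnj (B (verma_class c h x) (verma_class c h y))"
    and vac: "B (verma_class c h words_vac) (verma_class c h words_vac) = 1"
    and L: "\<And>n x y. B (verma_class c h (words_L n x)) (verma_class c h y)
          = B (verma_class c h x) (verma_class c h (words_L (- n) y))"
    unfolding contravariant_form_def verma_vac_def
    by (metis verma_class_in_space verma_add_class, metis verma_class_in_space verma_scale_class,
        metis verma_class_in_space, metis, metis verma_class_in_space verma_L_class)
  let ?B = "\<lambda>x y. B (verma_class c h x) (verma_class c h y)"
  have zero: "?B 0 y = 0" for y
    using add[of 0 0 y] by simp
  have zero2: "?B y 0 = 0" for y
    using cnj[of 0 y] zero by simp
  have rel: "?B x y = 0" if "x \<in> verma_rel c h" for x y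
  proof -
    have "verma_class c h x = verma_class c h 0" using that by (simp add: verma_class_eq_iff)
    then show ?thesis using zero by simp
  qed
  have lin: "?B x y = lf (\<lambda>w. ?B (Poly_Mapping.single w 1) y) x" for x y
  proof -
    have *: "?B (\<Sum>w\<in>A. words_scale (a w) (x w)) y = (\<Sum>w\<in>A. a w * ?B (x w) y)"
      for A and a :: "int list \<Rightarrow> complex" and x
      by (induction A rule: infinite_finite_induct) (simp_all add: zero add scale)
    have "x = (\<Sum>w\<in>Poly_Mapping.keys x. words_scale (Poly_Mapping.lookup x w) (Poly_Mapping.single w 1))"
      by (rule poly_mapping_eqI) (auto simp: lookup_sum lookup_single in_keys_iff "when_def" if_distrib cong: if_cong)
    then show ?thesis unfolding lf_def using * by metis
  qed
  have single: "words_L n (Poly_Mapping.single w 1) = Poly_Mapping.single (n # w) 1" for n w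
    by (simp add: words_L_def)
  define \<psi> where "\<psi> w = ?B (Poly_Mapping.single w 1) words_vac" for w
  have "vac_fun c h \<psi>"
    unfolding vac_fun_def
  proof (intro conjI allI impI)
    show "\<psi> [] = 1" using vac by (simp add: \<psi>_def words_vac_def)
  next
    fix n :: int and w assume n: "n < 0"
    have "\<psi> (n # w) = ?B (Poly_Mapping.single w 1) (words_L (- n) words_vac)"
      unfolding \<psi>_def single[symmetric] L by simp
    also have "\<dots> = cnj (?B (words_L (- n) words_vac) (Poly_Mapping.single w 1))"
      by (rule cnj)
    also have "\<dots> = 0"
      using n by (simp add: rel verma_rel.annihilation)
    finally show "\<psi> (n # w) = 0" .
  next
    fix n :: int and w assume n: "n > 0"
    have "Poly_Mapping.single (w @ [n]) 1 \<in> verma_rel c h"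
    proof (induction w)
      case Nil
      show ?case using verma_rel.annihilation[OF n] by (simp add: words_vac_def single)
    next
      case (Cons m w)
      then show ?case using verma_rel.L[OF Cons, of m] by (simp add: single)
    qed
    then show "\<psi> (w @ [n]) = 0" by (simp add: \<psi>_def rel)
  next
    fix w
    have "Poly_Mapping.single (w @ [0]) 1 - words_scale h (Poly_Mapping.single w 1) \<in> verma_rel c h"
    proof (induction w)
      case Nil
      show ?case using verma_rel.weight[of h c] by (simp add: words_vac_def single)
    next
      case (Cons m w)
      then show ?case using verma_rel.L[OF Cons, of m] by (simp add: single words_L_diff words_L_scale)
    qed
    then have "verma_class c h (Poly_Mapping.single (w @ [0]) 1) = verma_class c h (words_scale h (Poly_Mapping.single w 1))"
      by (simp add: verma_class_eq_iff)
    then show "\<psi> (w @ [0]) = h * \<psi> w"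
      by (simp add: \<psi>_def scale)
  next
    fix u v and m n :: int
    let ?s = "\<lambda>w. Poly_Mapping.single w 1 :: words"
    have "?s (u @ m # n # v) - ?s (u @ n # m # v) - (words_scale (of_int (m - n)) (?s (u @ (m + n) # v))
        + words_scale (central_term c m n) (?s (u @ v))) \<in> verma_rel c h"
    proof (induction u)
      case Nil
      show ?case using verma_rel.bracket[of m n "?s v" c h] by (simp add: single)
    next
      case (Cons k u)
      then show ?case using verma_rel.L[OF Cons, of k] by (simp add: single words_L_add words_L_diff words_L_scale)
    qed
    then have "verma_class c h (?s (u @ m # n # v)) = verma_class c h (?s (u @ n # m # v)
        + (words_scale (of_int (m - n)) (?s (u @ (m + n) # v)) + words_scale (central_term c m n) (?s (u @ v))))"
      by (simp add: verma_class_eq_iff algebra_simps)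
    then show "\<psi> (u @ m # n # v) = \<psi> (u @ n # m # v) + of_int (m - n) * \<psi> (u @ (m + n) # v)
        + central_term c m n * \<psi> (u @ v)"
      by (simp add: \<psi>_def scale add)
  qed
  then have \<psi>: "\<psi> w = vev c h w" for w
    by (rule vac_fun_unique[OF _ vac_fun_vev])
  have "?B (Poly_Mapping.single w 1) (Poly_Mapping.single w' 1) = vev c h (dag w' @ w)" for w w'
  proof (induction w' arbitrary: w)
    case Nil
    then show ?case using \<psi>[of w] by (simp add: \<psi>_def words_vac_def)
  next
    case (Cons n w')
    then show ?case
      using L[of "- n" "Poly_Mapping.single w 1" "Poly_Mapping.single w' 1"] by (simp add: single)
  qed
  then have single_single: "?B (Poly_Mapping.single w' 1) (Poly_Mapping.single w 1) = cnj (vev c h (dag w' @ w))" for w w'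
    by (subst cnj) simp
  have "?B (Poly_Mapping.single w 1) y = cnj (lf (\<lambda>w'. cnj (vev c h (dag w' @ w))) y)" for w
    by (subst cnj, subst lin) (simp only: single_single)
  then show ?thesis
    unfolding word_form_def by (subst lin) (simp only:)
qed

lemma verma_form_class:
  assumes "cnj c = c" "cnj h = h"
  shows "verma_form c h (verma_class c h x) (verma_class c h y) = word_form c h x y"
proof -
  obtain B where B: "contravariant_form c h B"
    using contravariant_form_exists[OF assms] by blast
  have "B' = B" if B': "contravariant_form c h B'" for B'
  proof (intro ext)
    fix \<xi> \<eta>
    show "B' \<xi> \<eta> = B \<xi> \<eta>"
    proof (cases "\<xi> \<in> verma_space c h \<and> \<eta> \<in> verma_space c h")
      case True
      then show ?thesis
        using contravariant_form_class[OF B] contravariant_form_class[OF B'] by (metis verma_spaceE)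
    next
      case False
      have "B'' \<xi> \<eta> = 0" if "contravariant_form c h B''" for B''
        using that False unfolding contravariant_form_def by blast
      from this[OF B] this[OF B'] show ?thesis by simp
    qed
  qed
  then have "verma_form c h = B"
    unfolding verma_form_def by (intro the_equality[where P = "contravariant_form c h"] B)
  then show ?thesis using contravariant_form_class[OF B] by simp
qed

section \<open>Gram entries as vacuum expectation values\<close>

definition down_word :: "nat list \<Rightarrow> int list" where
  "down_word p = map (\<lambda>i. - int i) (rev p)"

lemma verma_monomial_class: "verma_monomial c h p = verma_class c h (Poly_Mapping.single (down_word p) 1)"
proof -
  have "fold (\<lambda>i. verma_L c h (- int i)) p (verma_class c h (Poly_Mapping.single w 1))
      = verma_class c h (Poly_Mapping.single (down_word p @ w) 1)" for w
    by (induction p arbitrary: w) (simp_all add: verma_L_class words_L_def down_word_def)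
  from this[of "[]"] show ?thesis
    by (simp add: verma_monomial_def verma_vac_def words_vac_def)
qed

definition gram :: "nat \<Rightarrow> complex \<Rightarrow> complex \<Rightarrow> complex mat" where
  "gram N c h = mat (num_partitions N) (num_partitions N)
     (\<lambda>(i, j). vev c h (map int (partition_list N ! j) @ down_word (partition_list N ! i)))"

lemma kac_det_eq: "kac_det N c h = Determinant.det (gram N (of_real c) (of_real h))"
proof -
  have "dag (down_word p) = map int p" for p
    by (simp add: dag_def down_word_def rev_map comp_def)
  then have "gram_matrix N (of_real c) (of_real h) = gram N (of_real c) (of_real h)"
    unfolding gram_matrix_def gram_def
    by (simp add: verma_monomial_class verma_form_class word_form_def)
  then show ?thesis by (simp add: kac_det_def)
qed

subsection \<open>Laurent polynomials and constant terms\<close>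

type_synonym laurent = "(nat \<Rightarrow>\<^sub>0 int) \<Rightarrow>\<^sub>0 complex"

lemma poly_mapping_add_induct:
  assumes "\<And>m a. P (Poly_Mapping.single m a)" "\<And>f g. P f \<Longrightarrow> P g \<Longrightarrow> P (f + g)"
  shows "P (f :: 'a \<Rightarrow>\<^sub>0 'b::comm_monoid_add)"
proof (induction f rule: update_induct)
  case const
  show ?case using assms(1)[of undefined 0] by simp
next
  case (update f a b)
  have "Poly_Mapping.update a b f = f + Poly_Mapping.single a b"
    by (rule poly_mapping_eqI) (use update in \<open>auto simp: lookup_update lookup_add lookup_single in_keys_iff\<close>)
  then show ?case using update assms by simp
qed

text \<open>The Euler derivation \<open>z_i d/dz_i\<close>. It multiplies each monomial by its
  exponent in \<open>z_i\<close>, so its values have no constant term.\<close>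

definition pd :: "nat \<Rightarrow> laurent \<Rightarrow> laurent" where
  "pd i f = Poly_Mapping.mapp (\<lambda>m a. of_int (Poly_Mapping.lookup m i) * a) f"

definition CT :: "laurent \<Rightarrow> complex" where
  "CT f = Poly_Mapping.lookup f 0"

definition lvar :: "nat \<Rightarrow> laurent" where
  "lvar i = Poly_Mapping.single (Poly_Mapping.single i 1) 1"

definition lvar_inv :: "nat \<Rightarrow> laurent" where
  "lvar_inv i = Poly_Mapping.single (Poly_Mapping.single i (- 1)) 1"

text \<open>Complex conjugation of functions on the torus |z_i| = 1.\<close>

definition star :: "laurent \<Rightarrow> laurent" where
  "star f = Poly_Mapping.map_key uminus (Poly_Mapping.map cnj f)"

lemma lookup_pd: "Poly_Mapping.lookup (pd i f) m = of_int (Poly_Mapping.lookup m i) * Poly_Mapping.lookup f m"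
  by (simp add: pd_def lookup_mapp "when_def" in_keys_iff)

lemma pd_add: "pd i (f + g) = pd i f + pd i g"
  by (rule poly_mapping_eqI) (simp add: lookup_pd lookup_add algebra_simps)

lemma pd_diff: "pd i (f - g) = pd i f - pd i g"
  by (rule poly_mapping_eqI) (simp add: lookup_pd lookup_minus algebra_simps)

lemma pd_single: "pd i (Poly_Mapping.single m a) = Poly_Mapping.single m (of_int (Poly_Mapping.lookup m i) * a)"
  by (rule poly_mapping_eqI) (simp add: lookup_pd lookup_single "when_def")

lemma pd_mult: "pd i (f * g) = pd i f * g + f * pd i g"
proof (induction f rule: poly_mapping_add_induct)
  case (1 m a)
  show ?case
  proof (induction g rule: poly_mapping_add_induct)
    case (1 m' b)
    show ?case
      by (simp add: pd_single mult_single lookup_add single_add[symmetric] algebra_simps)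
  qed (simp add: pd_add algebra_simps)
qed (simp add: pd_add algebra_simps)

lemma CT_add: "CT (f + g) = CT f + CT g"
  by (simp add: CT_def lookup_add)

lemma CT_sum: "CT (sum f A) = (\<Sum>i\<in>A. CT (f i))"
  by (simp add: CT_def lookup_sum)

lemma CT_pd: "CT (pd i f) = 0"
  by (simp add: CT_def lookup_pd)

lemma lookup_single_mult:
  "Poly_Mapping.lookup (Poly_Mapping.single m a * g) k = a * Poly_Mapping.lookup (g :: laurent) (k - m)"
proof (induction g rule: poly_mapping_add_induct)
  case (1 m' b)
  have "m + m' = k \<longleftrightarrow> m' = k - m" by (auto simp: algebra_simps)
  then show ?case by (simp add: mult_single lookup_single "when_def")
qed (simp add: lookup_add algebra_simps)

lemma CT_of_int: "CT (of_int n * f) = of_int n * CT f"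
  by (simp add: CT_def single_of_int[symmetric] lookup_single_mult del: single_of_int)

lemma CT_of_nat: "CT (of_nat n * f) = of_nat n * CT f"
  using CT_of_int[of "int n" f] by simp

lemma lvar_mult_inv: "lvar i * lvar_inv i = 1"
  by (simp add: lvar_def lvar_inv_def mult_single single_add[symmetric])

lemma pd_lvar: "pd i (lvar j) = (if i = j then lvar j else 0)"
  by (auto simp: lvar_def pd_single lookup_single)

lemma pd_lvar_inv: "pd i (lvar_inv j) = (if i = j then - lvar_inv j else 0)"
  by (auto simp: lvar_inv_def pd_single lookup_single single_uminus)

lemma pd_one: "pd i 1 = 0"
  using pd_mult[of i 1 1] by simp

lemma pd_lvar_power: "pd i (lvar i ^ k) = of_nat k * lvar i ^ k"
  by (induction k) (simp_all add: pd_one pd_mult pd_lvar algebra_simps)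

lemma lookup_star: "Poly_Mapping.lookup (star f) m = cnj (Poly_Mapping.lookup f (- m))"
  unfolding star_def by (subst map_key.rep_eq) (auto simp: map.rep_eq inj_on_def "when_def")

lemma star_add: "star (f + g) = star f + star g"
  by (rule poly_mapping_eqI) (simp add: lookup_star lookup_add)

lemma star_single: "star (Poly_Mapping.single m a) = Poly_Mapping.single (- m) (cnj a)"
proof (rule poly_mapping_eqI)
  fix k :: "nat \<Rightarrow>\<^sub>0 int"
  have "m = - k \<longleftrightarrow> - m = k" by auto
  then show "Poly_Mapping.lookup (star (Poly_Mapping.single m a)) k
      = Poly_Mapping.lookup (Poly_Mapping.single (- m) (cnj a)) k"
    by (simp add: lookup_star lookup_single "when_def")
qed

lemma star_mult: "star (f * g) = star f * star g"
proof (induction f rule: poly_mapping_add_induct)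
  case (1 m a)
  show ?case
  proof (induction g rule: poly_mapping_add_induct)
    case (1 m' b)
    show ?case by (simp add: star_single mult_single)
  qed (simp add: star_add algebra_simps)
qed (simp add: star_add algebra_simps)

lemma star_one: "star 1 = 1"
  using star_single[of 0 1] by simp

lemma star_diff: "star (f - g) = star f - star g"
  by (rule poly_mapping_eqI) (simp add: lookup_star lookup_minus)

lemma star_prod: "star (prod f A) = (\<Prod>i\<in>A. star (f i))"
  by (induction A rule: infinite_finite_induct) (simp_all add: star_one star_mult)

lemma star_power: "star (f ^ n) = star f ^ n"
  by (induction n) (simp_all add: star_one star_mult)

lemma star_lvar: "star (lvar i) = lvar_inv i" "star (lvar_inv i) = lvar i"
  by (simp_all add: lvar_def lvar_inv_def star_single single_uminus[symmetric])

text \<open>Parseval: the constant term is the sum of the squared absolute values of the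
  coefficients.\<close>

lemma CT_mult_star:
  assumes "f \<noteq> 0"
  shows "CT (f * star f) \<noteq> 0"
proof -
  have f: "f = (\<Sum>m\<in>Poly_Mapping.keys f. Poly_Mapping.single m (Poly_Mapping.lookup f m))"
    by (rule poly_mapping_eqI) (auto simp: lookup_sum lookup_single in_keys_iff "when_def" if_distrib cong: if_cong)
  have "CT (f * star f) = (\<Sum>m\<in>Poly_Mapping.keys f. CT (Poly_Mapping.single m (Poly_Mapping.lookup f m) * star f))"
    by (subst f) (simp only: sum_distrib_right CT_sum)
  also have "\<dots> = (\<Sum>m\<in>Poly_Mapping.keys f. of_real ((cmod (Poly_Mapping.lookup f m))\<^sup>2))"
    by (simp add: CT_def lookup_single_mult lookup_star complex_norm_square del: of_real_power)
  also have "\<dots> = of_real (\<Sum>m\<in>Poly_Mapping.keys f. (cmod (Poly_Mapping.lookup f m))\<^sup>2)"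
    by simp
  finally have "CT (f * star f) = of_real (\<Sum>m\<in>Poly_Mapping.keys f. (cmod (Poly_Mapping.lookup f m))\<^sup>2)" .
  moreover have "(\<Sum>m\<in>Poly_Mapping.keys f. (cmod (Poly_Mapping.lookup f m))\<^sup>2) > 0"
    by (rule sum_pos) (use assms in \<open>auto simp: in_keys_iff\<close>)
  ultimately show ?thesis by (metis of_real_eq_0_iff less_irrefl)
qed

subsection \<open>The integrand\<close>

context
  fixes r :: nat
begin

definition powsum :: "nat \<Rightarrow> laurent" where
  "powsum n = (\<Sum>i<r. lvar i ^ n)"

text \<open>The value at 0 is 0 instead of \<open>r\<close>, so that the singular vector vanishes on
  multisets containing 0; \<open>witt_qsum\<close> holds there as well.\<close>

definition qsum :: "nat \<Rightarrow> laurent" where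
  "qsum n = (if n = 0 then 0 else powsum n)"

definition qprod :: "nat multiset \<Rightarrow> laurent" where
  "qprod M = (\<Prod>n\<in>#M. qsum n)"

text \<open>The vector field with components \<open>z_i ^ (k + 1)\<close>, a Witt algebra
  generator.\<close>

definition witt :: "nat \<Rightarrow> laurent \<Rightarrow> laurent" where
  "witt k f = (\<Sum>i<r. lvar i ^ k * pd i f)"

definition prs :: "(nat \<times> nat) set" where
  "prs = {(i, j). i < r \<and> j < r \<and> i \<noteq> j}"

text \<open>Up to sign, \<open>\<Prod>\<^sub>i z\<^sub>i\<^bsup>-s\<^esup> \<Prod>\<^bsub>i \<noteq> j\<^esub> (1 - z\<^sub>i / z\<^sub>j)\<^sup>t\<close>.\<close>

definition integrand :: "nat \<Rightarrow> nat \<Rightarrow> laurent" where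
  "integrand s t = (\<Prod>i<r. lvar_inv i) ^ (s + t * (r - 1)) * (\<Prod>(i, j)\<in>prs. lvar i - lvar j) ^ t"

lemma powsum_0: "powsum 0 = of_nat r"
  by (simp add: powsum_def)

lemma witt_add: "witt k (f + g) = witt k f + witt k g"
  by (simp add: witt_def pd_add sum.distrib algebra_simps)

lemma witt_diff: "witt k (f - g) = witt k f - witt k g"
  by (simp add: witt_def pd_diff sum_subtractf algebra_simps)

lemma witt_mult: "witt k (f * g) = witt k f * g + f * witt k g"
  by (simp add: witt_def pd_mult sum.distrib sum_distrib_left sum_distrib_right algebra_simps)

lemma witt_one: "witt k 1 = 0"
  by (simp add: witt_def pd_one)

lemma witt_0: "witt k 0 = 0"
  using witt_add[of k 0 0] by simp

lemma witt_sum: "witt k (sum f A) = (\<Sum>i\<in>A. witt k (f i))"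
  by (induction A rule: infinite_finite_induct) (simp_all add: witt_0 witt_add)

lemma witt_prod:
  assumes "finite A" "\<And>i. i \<in> A \<Longrightarrow> witt k (f i) = e i * f i"
  shows "witt k (prod f A) = sum e A * prod f A"
  using assms by (induction A rule: finite_induct) (simp_all add: witt_one witt_mult algebra_simps)

lemma witt_power:
  assumes "witt k f = e * f"
  shows "witt k (f ^ n) = of_nat n * e * f ^ n"
  by (induction n) (simp_all add: assms witt_one witt_mult algebra_simps)

lemma witt_lvar: "i < r \<Longrightarrow> witt k (lvar i) = lvar i ^ k * lvar i"
  by (simp add: witt_def pd_lvar if_distrib cong: if_cong)

lemma witt_lvar_inv: "i < r \<Longrightarrow> witt k (lvar_inv i) = - (lvar i ^ k) * lvar_inv i"
  by (simp add: witt_def pd_lvar_inv if_distrib cong: if_cong)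

lemma finite_prs: "finite prs"
  by (rule finite_subset[of _ "{..<r} \<times> {..<r}"]) (auto simp: prs_def)

lemma sum_prs: "(\<Sum>(i, j)\<in>prs. f i j) = (\<Sum>i<r. \<Sum>j<r. f i j) - (\<Sum>i<r. f i i :: 'b::ab_group_add)"
proof -
  have "(\<Sum>i<r. \<Sum>j<r. f i j) = (\<Sum>(i, j)\<in>{..<r} \<times> {..<r}. f i j)"
    by (rule sum.cartesian_product)
  also have "{..<r} \<times> {..<r} = prs \<union> (\<lambda>i. (i, i)) ` {..<r}"
    by (auto simp: prs_def)
  also have "(\<Sum>(i, j)\<in>\<dots>. f i j) = (\<Sum>(i, j)\<in>prs. f i j) + (\<Sum>(i, j)\<in>(\<lambda>i. (i, i)) ` {..<r}. f i j)"
    by (rule sum.union_disjoint) (auto simp: finite_prs, auto simp: prs_def)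
  also have "(\<Sum>(i, j)\<in>(\<lambda>i. (i, i)) ` {..<r}. f i j) = (\<Sum>i<r. f i i)"
    by (subst sum.reindex) (auto simp: inj_on_def)
  finally show ?thesis by simp
qed

text \<open>A logarithmic derivative. On \<open>z_i - z_j\<close> the field gives
  \<open>z_i ^ (k + 1) - z_j ^ (k + 1)\<close>, a multiple of \<open>z_i - z_j\<close>; summing the
  quotients over ordered pairs gives products of power sums minus the diagonal.\<close>

lemma witt_integrand:
  "witt k (integrand s t) = (of_nat t * ((\<Sum>l\<le>k. powsum l * powsum (k - l)) - of_nat (k + 1) * powsum k)
      - of_nat (s + t * (r - 1)) * powsum k) * integrand s t"
proof -
  have 1: "witt k (\<Prod>i<r. lvar_inv i) = - powsum k * (\<Prod>i<r. lvar_inv i)"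
    by (subst witt_prod[where e = "\<lambda>i. - (lvar i ^ k)"]) (auto simp: witt_lvar_inv powsum_def sum_negf)
  have "witt k (\<Prod>(i, j)\<in>prs. lvar i - lvar j)
     = (\<Sum>(i, j)\<in>prs. \<Sum>l\<le>k. lvar i ^ l * lvar j ^ (k - l)) * (\<Prod>(i, j)\<in>prs. lvar i - lvar j)"
  proof (rule witt_prod[OF finite_prs])
    fix p assume p: "p \<in> prs"
    obtain i j where ij: "p = (i, j)" by force
    have "witt k (lvar i - lvar j) = lvar i ^ Suc k - lvar j ^ Suc k"
      using p ij by (simp add: prs_def witt_diff witt_lvar mult.commute)
    also have "\<dots> = (\<Sum>l\<le>k. lvar i ^ l * lvar j ^ (k - l)) * (lvar i - lvar j)"
      unfolding power_diff_sumr2 by (simp add: lessThan_Suc_atMost mult.commute)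
    finally show "witt k (case p of (i, j) \<Rightarrow> lvar i - lvar j)
        = (case p of (i, j) \<Rightarrow> \<Sum>l\<le>k. lvar i ^ l * lvar j ^ (k - l)) * (case p of (i, j) \<Rightarrow> lvar i - lvar j)"
      by (simp add: ij)
  qed
  also have "(\<Sum>(i, j)\<in>prs. \<Sum>l\<le>k. lvar i ^ l * lvar j ^ (k - l))
      = (\<Sum>i<r. \<Sum>j<r. \<Sum>l\<le>k. lvar i ^ l * lvar j ^ (k - l)) - (\<Sum>i<r. \<Sum>l\<le>k. lvar i ^ l * lvar i ^ (k - l))"
    by (rule sum_prs)
  also have "(\<Sum>i<r. \<Sum>j<r. \<Sum>l\<le>k. lvar i ^ l * lvar j ^ (k - l)) = (\<Sum>l\<le>k. powsum l * powsum (k - l))"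
    unfolding powsum_def sum_product by (subst sum.swap, subst (2) sum.swap) (rule sum.swap[THEN trans], simp add: sum.swap[of _ "{..k}"])
  also have "(\<Sum>i<r. \<Sum>l\<le>k. lvar i ^ l * lvar i ^ (k - l)) = of_nat (k + 1) * powsum k"
    by (simp add: power_add[symmetric] powsum_def sum_distrib_left)
  finally have 2: "witt k (\<Prod>(i, j)\<in>prs. lvar i - lvar j)
     = ((\<Sum>l\<le>k. powsum l * powsum (k - l)) - of_nat (k + 1) * powsum k) * (\<Prod>(i, j)\<in>prs. lvar i - lvar j)" .
  show ?thesis
    unfolding integrand_def witt_mult witt_power[OF 1] witt_power[OF 2] by (simp add: algebra_simps)
qed

lemma witt_qsum: "witt k (qsum n) = of_nat n * qsum (n + k)"
proof (cases "n = 0")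
  case False
  have "witt k (lvar i ^ n) = of_nat n * lvar i ^ (n + k)" if "i < r" for i
    using witt_power[OF witt_lvar[OF that]] by (simp add: power_add mult_ac)
  then show ?thesis
    using False by (simp add: qsum_def powsum_def witt_sum sum_distrib_left)
qed (simp add: qsum_def witt_0)

lemma qprod_add: "qprod (add_mset n M) = qsum n * qprod M"
  by (simp add: qprod_def)

text \<open>Stated in the shape of the creation part of \<open>L_k\<close>: the term for
  \<open>m\<close> removes a part \<open>m\<close> and inserts \<open>m + k\<close>. The free bound
  \<open>K\<close> is matched to that sum later.\<close>

lemma witt_qprod:
  "wt M \<le> K \<Longrightarrow> witt k (qprod M) = (\<Sum>m = 1..K. of_nat (m * count M m) * (qsum (m + k) * qprod (M - {#m#})))"
proof (induction M)
  case empty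
  then show ?case by (simp add: qprod_def witt_one)
next
  case (add x M)
  have "(\<Sum>m = 1..K. of_nat (m * count (add_mset x M) m) * (qsum (m + k) * qprod (add_mset x M - {#m#})))
      = (\<Sum>m = 1..K. qsum x * (of_nat (m * count M m) * (qsum (m + k) * qprod (M - {#m#})))
          + (if m = x then of_nat x * (qsum (x + k) * qprod M) else 0))"
  proof (rule sum.cong)
    fix m
    show "of_nat (m * count (add_mset x M) m) * (qsum (m + k) * qprod (add_mset x M - {#m#}))
      = qsum x * (of_nat (m * count M m) * (qsum (m + k) * qprod (M - {#m#})))
          + (if m = x then of_nat x * (qsum (x + k) * qprod M) else 0)"
    proof (cases "m = x")
      case False
      then show ?thesis
        by (cases "m \<in># M") (auto simp: qprod_add algebra_simps not_in_iff)
    next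
      case True
      show ?thesis
      proof (cases "x \<in># M")
        case True
        then have "qprod M = qsum x * qprod (M - {#x#})"
          by (metis insert_DiffM qprod_add)
        then show ?thesis using \<open>m = x\<close> by (simp add: algebra_simps)
      qed (use \<open>m = x\<close> in \<open>simp add: not_in_iff\<close>)
    qed
  qed simp
  also have "\<dots> = qsum x * witt k (qprod M) + of_nat x * (qsum (x + k) * qprod M)"
    unfolding sum.distrib sum_distrib_left[symmetric] using add by (cases "x = 0") auto
  finally show ?case
    by (simp add: qprod_add witt_mult witt_qsum algebra_simps)
qed

text \<open>The constant term of \<open>\<Sum>\<^sub>i z\<^sub>i \<partial>\<^sub>i (z\<^sub>i\<^sup>k f)\<close> is zero.\<close>

lemma CT_witt: "CT (witt k f) = - of_nat k * CT (powsum k * f)"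
proof -
  have "CT (\<Sum>i<r. pd i (lvar i ^ k * f)) = 0"
    by (simp add: CT_sum CT_pd)
  moreover have "(\<Sum>i<r. pd i (lvar i ^ k * f)) = of_nat k * (powsum k * f) + witt k f"
    by (simp add: pd_mult pd_lvar_power witt_def powsum_def sum.distrib sum_distrib_left sum_distrib_right algebra_simps)
  ultimately show ?thesis
    by (simp add: CT_add CT_of_nat) (simp add: add_eq_0_iff)
qed

end

section \<open>The singular vector from screening currents\<close>

text \<open>
  The constant term of the integrand times \<open>exp (\<alpha> \<Sum>\<^bsub>n>0\<^esub> a\<^bsub>-n\<^esub> p\<^sub>n(z) / n)\<close>, with power sums \<open>p\<^sub>n\<close>.
\<close>

definition fock_sing :: "nat \<Rightarrow> nat \<Rightarrow> nat \<Rightarrow> complex \<Rightarrow> fock" where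
  "fock_sing r s t \<alpha> M = \<alpha> ^ size M * CT (integrand r s t * qprod r M)"

text \<open>Homogeneity: \<open>witt r 0\<close> measures the total degree, which is
  \<open>- r * s\<close> for the integrand and \<open>wt M\<close> for \<open>qprod\<close>; a
  constant term survives only in degree 0.\<close>

lemma fock_sing_lev:
  assumes "r \<ge> 1"
  shows "fock_lev (int (r * s)) (fock_sing r s t \<alpha>)"
  unfolding fock_lev_def
proof (intro allI impI conjI)
  fix M assume nz: "fock_sing r s t \<alpha> M \<noteq> 0"
  show "0 \<notin># M"
  proof
    assume "0 \<in># M"
    then have "qprod r M = qsum r 0 * qprod r (M - {#0#})" by (metis insert_DiffM qprod_add)
    then show False using nz by (simp add: fock_sing_def qsum_def CT_def)
  qed
  have "witt r 0 (qprod r M) = (\<Sum>m = 1..wt M. of_nat (m * count M m) * qprod r M)"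
  proof (subst witt_qprod[of M "wt M"], simp, rule sum.cong)
    fix m
    show "of_nat (m * count M m) * (qsum r (m + 0) * qprod r (M - {#m#})) = of_nat (m * count M m) * qprod r M"
      by (cases "m \<in># M") (auto simp: not_in_iff qprod_add[symmetric])
  qed simp
  also have "\<dots> = of_nat (wt M) * qprod r M"
    unfolding sum_distrib_right[symmetric] of_nat_sum[symmetric] by (simp only: sum_count[OF order_refl])
  finally have 1: "witt r 0 (qprod r M) = of_nat (wt M) * qprod r M" .
  obtain r' where r': "r = Suc r'" using assms by (cases r) auto
  have "witt r 0 (integrand r s t) = - of_nat (r * s) * integrand r s t"
    unfolding witt_integrand by (simp add: powsum_0 r' algebra_simps)
  then have "witt r 0 (integrand r s t * qprod r M)
      = of_int (int (wt M) - int (r * s)) * (integrand r s t * qprod r M)"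
    by (simp add: witt_mult 1 algebra_simps)
  then have "of_int (int (wt M) - int (r * s)) * CT (integrand r s t * qprod r M) = 0"
    using CT_witt[of r 0 "integrand r s t * qprod r M"] by (simp only: CT_of_int of_nat_0 minus_zero mult_zero_left)
  then have "(of_int (int (wt M) - int (r * s)) :: complex) = 0"
    using nz by (auto simp: fock_sing_def)
  then show "int (wt M) = int (r * s)"
    by (simp only: of_int_eq_0_iff right_minus_eq)
qed

text \<open>With these \<alpha>, \<rho>, \<mu>, applying \<open>L_k\<close> amounts to taking the
  constant term of a total derivative of the integrand times \<open>qprod r M\<close>. Each
  unordered pair of currents carries the exponent \<open>\<alpha>\<^sup>2 = 2 * t\<close>, that is
  \<open>t\<close> for each ordered pair.\<close>

lemma fock_sing_singular:
  assumes r: "r \<ge> 1" and k: "k > 0"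
    and \<alpha>: "\<alpha>\<^sup>2 = 2 * of_nat t" and \<rho>: "\<rho> * \<alpha> = of_nat t - 1" and \<mu>: "\<mu> * \<alpha> = of_nat t * of_nat r - of_nat s"
  shows "fockL \<rho> \<mu> k (fock_sing r s t \<alpha>) = (\<lambda>M. 0)"
proof
  fix M :: "nat multiset"
  obtain n where n: "k = int n" "n > 0" using k by (metis zero_less_imp_eq_int)
  let ?u = "fock_sing r s t \<alpha>" and ?F = "integrand r s t" and ?q = "qsum r"
  define a where "a = \<alpha> ^ size M"
  \<comment> \<open>\<open>A\<close> collects two proper annihilators, \<open>B\<close> one
    annihilator with the zero mode or the background charge, and \<open>C\<close> the creation
    part.\<close>
  define A where "A = (\<Sum>i = 1..n - 1. CT (?F * ?q i * ?q (n - i) * qprod r M))"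
  define B where "B = CT (?F * ?q n * qprod r M)"
  define C where "C = CT (?F * witt r n (qprod r M))"
  have 1: "(\<Sum>i = 0..k. heis \<mu> i (heis \<mu> (k - i) ?u) M) = a * (\<alpha>\<^sup>2 * A + 2 * (\<mu> * \<alpha>) * B)"
  proof -
    have "(\<Sum>i = 0..k. heis \<mu> i (heis \<mu> (k - i) ?u) M)
        = (\<Sum>i = 0..n. heis \<mu> (int i) (heis \<mu> (int (n - i)) ?u) M)"
      by (rule sum.reindex_bij_witness[of _ int nat]) (auto simp: n of_nat_diff)
    also have "{0..n} = insert 0 (insert n {1..n - 1})"
      using n by auto
    also have "(\<Sum>i \<in> \<dots>. heis \<mu> (int i) (heis \<mu> (int (n - i)) ?u) M)
        = 2 * \<mu> * ?u (add_mset n M) + (\<Sum>i = 1..n - 1. heis \<mu> (int i) (heis \<mu> (int (n - i)) ?u) M)"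
      using n by (simp add: heis_zero heis_pos)
    also have "(\<Sum>i = 1..n - 1. heis \<mu> (int i) (heis \<mu> (int (n - i)) ?u) M) = a * \<alpha>\<^sup>2 * A"
      unfolding A_def sum_distrib_left
    proof (rule sum.cong)
      fix i assume i: "i \<in> {1..n - 1}"
      show "heis \<mu> (int i) (heis \<mu> (int (n - i)) ?u) M = a * \<alpha>\<^sup>2 * CT (?F * ?q i * ?q (n - i) * qprod r M)"
      proof -
        have "i > 0" "n - i > 0" using i n by auto
        then show ?thesis
          by (simp add: heis_pos fock_sing_def qprod_add a_def power2_eq_square mult_ac del: of_nat_diff)
      qed
    qed simp
    also have "?u (add_mset n M) = a * \<alpha> * B"
      by (simp add: fock_sing_def qprod_add a_def B_def mult_ac)
    finally show ?thesis by (simp add: algebra_simps)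
  qed
  have 2: "(\<Sum>m = 1..k + int (wt M). heis \<mu> (- m) (heis \<mu> (k + m) ?u) M) = a * C"
  proof -
    have "(\<Sum>m = 1..k + int (wt M). heis \<mu> (- m) (heis \<mu> (k + m) ?u) M)
        = (\<Sum>m = 1..n + wt M. heis \<mu> (- int m) (heis \<mu> (int (m + n)) ?u) M)"
      by (rule sum.reindex_bij_witness[of _ int nat]) (auto simp: n add_ac)
    also have "\<dots> = (\<Sum>m = 1..n + wt M. a * CT (?F * (of_nat (m * count M m) * (?q (m + n) * qprod r (M - {#m#})))))"
    proof (rule sum.cong)
      fix m assume m: "m \<in> {1..n + wt M}"
      have "?F * (of_nat (m * count M m) * (?q (m + n) * qprod r (M - {#m#})))
          = of_nat (m * count M m) * (?F * (?q (m + n) * qprod r (M - {#m#})))"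
        by (simp add: mult_ac)
      then have e: "CT (?F * (of_nat (m * count M m) * (?q (m + n) * qprod r (M - {#m#}))))
          = of_nat (m * count M m) * CT (?F * (?q (m + n) * qprod r (M - {#m#})))"
        by (simp only: CT_of_nat)
      show "heis \<mu> (- int m) (heis \<mu> (int (m + n)) ?u) M
          = a * CT (?F * (of_nat (m * count M m) * (?q (m + n) * qprod r (M - {#m#}))))"
      proof (cases "m \<in># M")
        case True
        then have "size M = Suc (size (M - {#m#}))" by (metis insert_DiffM size_add_mset)
        moreover have "heis \<mu> (int (m + n)) ?u (M - {#m#}) = ?u (add_mset (m + n) (M - {#m#}))"
          using n by (subst heis_pos) (simp, simp only: nat_int)
        moreover have "m > 0" using m by simp
        ultimately show ?thesis
          unfolding e by (simp add: heis_neg fock_sing_def qprod_add a_def del: of_nat_add)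
      next
        case False
        then show ?thesis using m unfolding e by (simp add: heis_neg not_in_iff)
      qed
    qed simp
    also have "\<dots> = a * C"
      unfolding C_def witt_qprod[of M "n + wt M", simplified] by (simp add: sum_distrib_left CT_sum)
    finally show ?thesis .
  qed
  \<comment> \<open>This is \<open>CT_witt\<close> expanded by the product rule. The end terms
    \<open>l = 0\<close> and \<open>l = n\<close> each contribute \<open>powsum r 0 = r\<close>
    times the power sum of degree \<open>n\<close>.\<close>
  have 3: "C = - of_nat t * A - (of_nat t * of_nat r - of_nat t * of_nat n - of_nat s + of_nat n) * B"
  proof -
    obtain r' where r': "r = Suc r'" using r by (cases r) auto
    obtain n' where n': "n = Suc n'" using n by (cases n) auto
    have "(\<Sum>l\<le>n. powsum r l * powsum r (n - l)) = 2 * of_nat r * powsum r n + (\<Sum>l = 1..n - 1. ?q l * ?q (n - l))"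
    proof -
      have "{..n} = insert 0 (insert n {1..n - 1})" using n by auto
      moreover have "(\<Sum>l = 1..n - 1. powsum r l * powsum r (n - l)) = (\<Sum>l = 1..n - 1. ?q l * ?q (n - l))"
        by (rule sum.cong) (auto simp: qsum_def)
      ultimately show ?thesis using n by (simp add: powsum_0 algebra_simps)
    qed
    then have w: "witt r n ?F = of_nat t * (?F * (\<Sum>l = 1..n - 1. ?q l * ?q (n - l)))
        + of_int (int t * int r - int t * int n - int s) * (?F * ?q n)"
      unfolding witt_integrand using n by (simp add: r' qsum_def algebra_simps)
    have "CT (witt r n (?F * qprod r M)) = CT (of_nat t * (\<Sum>l = 1..n - 1. ?F * ?q l * ?q (n - l) * qprod r M)
        + of_int (int t * int r - int t * int n - int s) * (?F * ?q n * qprod r M) + ?F * witt r n (qprod r M))"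
      unfolding witt_mult w by (simp add: sum_distrib_left sum_distrib_right algebra_simps)
    also have "\<dots> = of_nat t * A + of_int (int t * int r - int t * int n - int s) * B + C"
      unfolding CT_add CT_of_nat CT_of_int CT_sum A_def B_def C_def by simp
    finally have "CT (witt r n (?F * qprod r M)) = \<dots>" .
    moreover have "CT (witt r n (?F * qprod r M)) = - of_nat n * B"
      unfolding CT_witt B_def using n by (simp add: qsum_def mult_ac)
    ultimately show ?thesis by (simp add: algebra_simps)
  qed
  have "fockL \<rho> \<mu> k ?u M = 1 / 2 * (a * (\<alpha>\<^sup>2 * A + 2 * (\<mu> * \<alpha>) * B)) + a * C - \<rho> * of_int k * heis \<mu> k ?u M"
    using k by (subst fockL_nonneg[where K = "k + int (wt M)"]) (simp_all add: 1 2)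
  also have "heis \<mu> k ?u M = a * \<alpha> * B"
    using n by (simp add: heis_pos fock_sing_def qprod_add a_def B_def mult_ac)
  also have "\<rho> * of_int k * (a * \<alpha> * B) = of_nat n * a * B * (\<rho> * \<alpha>)"
    using n by simp
  finally show "fockL \<rho> \<mu> k ?u M = 0"
    unfolding \<alpha> \<rho> \<mu> 3 by (simp add: algebra_simps)
qed

subsection \<open>The singular vector does not vanish\<close>

definition elem_fps :: "nat \<Rightarrow> laurent fps" where
  "elem_fps r = (\<Prod>i<r. 1 + fps_const (lvar i) * fps_X)"

definition powsum_fps :: "nat \<Rightarrow> laurent fps" where
  "powsum_fps r = Abs_fps (\<lambda>n. (- 1) ^ n * powsum r (Suc n))"

text \<open>Logarithmic derivative of the generating function of elementary symmetric polynomials;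
  each factor contributes the geometric series \<open>?g\<close>.\<close>

lemma elem_fps_deriv: "fps_deriv (elem_fps r) = elem_fps r * powsum_fps r"
proof (induction r)
  case 0
  have "powsum_fps 0 = 0" by (simp add: powsum_fps_def powsum_def fps_eq_iff)
  then show ?case by (simp add: elem_fps_def)
next
  case (Suc r)
  let ?z = "lvar r"
  let ?g = "Abs_fps (\<lambda>n. (- 1) ^ n * ?z ^ Suc n)"
  have g: "(1 + fps_const ?z * fps_X) * ?g = fps_const ?z"
  proof (rule fps_ext)
    fix n
    show "fps_nth ((1 + fps_const ?z * fps_X) * ?g) n = fps_nth (fps_const ?z) n"
      by (cases n) (simp_all add: distrib_right mult.assoc)
  qed
  have p: "powsum_fps (Suc r) = powsum_fps r + ?g"
    by (rule fps_ext) (simp add: powsum_fps_def powsum_def distrib_left)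
  have e: "elem_fps (Suc r) = elem_fps r * (1 + fps_const ?z * fps_X)"
    by (simp add: elem_fps_def)
  have "fps_deriv (elem_fps (Suc r)) = elem_fps r * powsum_fps r * (1 + fps_const ?z * fps_X) + elem_fps r * fps_const ?z"
    unfolding e fps_deriv_mult Suc.IH by simp
  also have "\<dots> = elem_fps (Suc r) * powsum_fps (Suc r)"
    unfolding p e by (subst (2) g[symmetric]) (simp add: algebra_simps)
  finally show ?case .
qed

text \<open>The vanishing above \<open>r\<close> is carried along because the next top coefficient
  is the old coefficient \<open>r + 1\<close> plus \<open>lvar r\<close> times the old top
  one.\<close>

lemma elem_fps_nth: "fps_nth (elem_fps r) r = (\<Prod>i<r. lvar i) \<and> (\<forall>n>r. fps_nth (elem_fps r) n = 0)"
proof (induction r)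
  case 0
  then show ?case by (simp add: elem_fps_def)
next
  case (Suc r)
  have e: "elem_fps (Suc r) = elem_fps r + fps_const (lvar r) * (elem_fps r * fps_X)"
    by (simp add: elem_fps_def algebra_simps)
  show ?case
    using Suc unfolding e by (auto simp: mult.commute)
qed

lemma newton: "of_nat (Suc k) * fps_nth (elem_fps r) (Suc k)
    = (\<Sum>i = 0..k. fps_nth (elem_fps r) i * ((- 1) ^ (k - i) * powsum r (Suc (k - i))))"
  using arg_cong[OF elem_fps_deriv, of "\<lambda>f. fps_nth f k" r]
  by (simp add: fps_mult_nth powsum_fps_def)

text \<open>If the vector vanished, the integrand would have zero constant term against all products
  of power sums, hence by Newton's identities against the \<open>s\<close>-th power of the product
  of the variables. That constant term is a positive sum of squares.\<close>

lemma fock_sing_nonzero: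
  assumes r: "r \<ge> 1" and \<alpha>: "\<alpha> \<noteq> 0"
  shows "\<exists>M. fock_sing r s t \<alpha> M \<noteq> 0"
proof (rule ccontr)
  assume "\<not> ?thesis"
  then have z1: "CT (integrand r s t * qprod r M) = 0" for M
    using \<alpha> by (auto simp: fock_sing_def)
  \<comment> \<open>Keeping an arbitrary \<open>qprod\<close> factor makes \<open>Z\<close> stable
    under multiplication by power sums.\<close>
  define Z where "Z g \<longleftrightarrow> (\<forall>M. CT (integrand r s t * g * qprod r M) = 0)" for g
  have Z1: "Z 1" using z1 by (simp add: Z_def)
  have Zp: "Z (g * powsum r (Suc n))" if "Z g" for g n
    unfolding Z_def
  proof
    fix M
    have "CT (integrand r s t * g * qprod r (add_mset (Suc n) M)) = 0"
      using that by (simp add: Z_def)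
    then show "CT (integrand r s t * (g * powsum r (Suc n)) * qprod r M) = 0"
      by (simp add: qprod_add qsum_def mult_ac)
  qed
  have Zs: "Z (\<Sum>i\<in>A. f i)" if "\<And>i. i \<in> A \<Longrightarrow> Z (f i)" for A and f :: "nat \<Rightarrow> laurent"
    using that by (simp add: Z_def sum_distrib_left sum_distrib_right CT_sum)
  have Zi: "Z (of_int n * g) \<longleftrightarrow> n = 0 \<or> Z g" for n g
  proof -
    have "integrand r s t * (of_int n * g) * qprod r M = of_int n * (integrand r s t * g * qprod r M)" for M
      by (simp add: mult_ac)
    then show ?thesis by (simp only: Z_def CT_of_int) auto
  qed
  have Ze: "Z (fps_nth (elem_fps r) k * y)" if "Z y" for k y
  proof (induction k rule: less_induct)
    case (less k)
    show ?case
    proof (cases k)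
      case 0
      have "fps_nth (elem_fps r) 0 = 1"
        unfolding elem_fps_def by (induction r) simp_all
      then show ?thesis using 0 that by simp
    next
      case (Suc n)
      have "Z (\<Sum>i = 0..n. of_int ((- 1) ^ (n - i)) * ((fps_nth (elem_fps r) i * y) * powsum r (Suc (n - i))))"
        by (rule Zs, subst Zi) (use less Suc Zp in auto)
      also have "(\<Sum>i = 0..n. of_int ((- 1) ^ (n - i)) * ((fps_nth (elem_fps r) i * y) * powsum r (Suc (n - i))))
          = of_int (int (Suc n)) * (fps_nth (elem_fps r) (Suc n) * y)"
        using arg_cong[OF newton, of "\<lambda>x. x * y" n r] by (simp add: sum_distrib_left sum_distrib_right mult_ac)
      finally show ?thesis unfolding Zi using Suc by simp
    qed
  qed
  have "Z ((\<Prod>i<r. lvar i) ^ n)" for n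
  proof (induction n)
    case (Suc n)
    show ?case using Ze[OF Suc, of r] elem_fps_nth[of r] by simp
  qed (simp add: Z1)
  from this[of s] have 0: "CT (integrand r s t * (\<Prod>i<r. lvar i) ^ s) = 0"
    unfolding Z_def by (metis mult.right_neutral qprod_def image_mset_empty prod_mset_empty)
  define S where "S = {(i, j). i < j \<and> j < r}"
  have finS: "finite S"
    by (rule finite_subset[of _ "{..<r} \<times> {..<r}"]) (auto simp: S_def)
  \<comment> \<open>One factor per unordered pair; \<open>star\<close> produces the factor with the
    indices exchanged.\<close>
  define G where "G = (\<Prod>(i, j)\<in>S. lvar i * lvar_inv j - 1)"
  let ?P = "\<Prod>i<r. lvar i" and ?Q = "\<Prod>i<r. lvar_inv i"
  have PQ: "?Q * ?P = 1"
    by (simp add: prod.distrib[symmetric] lvar_mult_inv mult.commute)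
  have "integrand r s t * ?P ^ s = (?Q * ?P) ^ s * (?Q ^ (r - 1) * (\<Prod>(i, j)\<in>prs r. lvar i - lvar j)) ^ t"
    by (simp add: integrand_def power_add power_mult_distrib power_mult[symmetric] mult_ac)
  \<comment> \<open>Each variable is an entry of \<open>r - 1\<close> ordered pairs, so its inverse
    powers can be distributed over the second indices.\<close>
  also have "?Q ^ (r - 1) = (\<Prod>(i, j)\<in>prs r. lvar_inv j)"
  proof -
    have "prs r = (SIGMA i:{..<r}. {..<r} - {i})" by (auto simp: prs_def)
    then have "(\<Prod>(i, j)\<in>prs r. lvar_inv i) = (\<Prod>i<r. \<Prod>j\<in>{..<r} - {i}. lvar_inv i)"
      by (simp only:, subst prod.Sigma) auto
    also have "\<dots> = ?Q ^ (r - 1)"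
      by (simp add: prod_power_distrib)
    finally have "?Q ^ (r - 1) = (\<Prod>(i, j)\<in>prs r. lvar_inv i)" ..
    also have "\<dots> = (\<Prod>(i, j)\<in>prs r. lvar_inv j)"
      by (rule prod.reindex_bij_witness[of _ prod.swap prod.swap]) (auto simp: prs_def)
    finally show ?thesis .
  qed
  also have "(\<Prod>(i, j)\<in>prs r. lvar_inv j) * (\<Prod>(i, j)\<in>prs r. lvar i - lvar j) = (\<Prod>(i, j)\<in>prs r. lvar i * lvar_inv j - 1)"
    unfolding prod.distrib[symmetric] by (rule prod.cong) (auto simp: algebra_simps lvar_mult_inv)
  also have "\<dots> = G * star G"
  proof -
    define U where "U = {(i, j). j < i \<and> i < r}"
    have "prs r = S \<union> U" by (auto simp: prs_def S_def U_def)
    moreover have "finite U"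
      by (rule finite_subset[of _ "{..<r} \<times> {..<r}"]) (auto simp: U_def)
    moreover have "S \<inter> U = {}" by (auto simp: S_def U_def)
    ultimately have "(\<Prod>(i, j)\<in>prs r. lvar i * lvar_inv j - 1) = G * (\<Prod>(i, j)\<in>U. lvar i * lvar_inv j - 1)"
      unfolding G_def using finS by (simp add: prod.union_disjoint)
    also have "(\<Prod>(i, j)\<in>U. lvar i * lvar_inv j - 1) = star G"
      unfolding G_def star_prod
      by (rule prod.reindex_bij_witness[of _ prod.swap prod.swap])
        (auto simp: S_def U_def star_diff star_mult star_lvar star_one mult.commute)
    finally show ?thesis .
  qed
  finally have F: "integrand r s t * ?P ^ s = G ^ t * star (G ^ t)"
    by (simp only: PQ star_power power_mult_distrib power_one mult_1)
  have "lvar i * lvar_inv j \<noteq> 1" if "i < j" for i j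
  proof
    assume "lvar i * lvar_inv j = 1"
    then have "lvar i * (lvar j * lvar_inv j) = lvar j" by (metis mult.left_commute mult.right_neutral)
    then have "lvar i = lvar j" by (simp add: lvar_mult_inv)
    then have "Poly_Mapping.lookup (lvar i) (Poly_Mapping.single j 1) = Poly_Mapping.lookup (lvar j) (Poly_Mapping.single j 1)"
      by simp
    then have "Poly_Mapping.single i (1::int) = Poly_Mapping.single j 1"
      by (simp add: lvar_def lookup_single "when_def" split: if_splits)
    then have "Poly_Mapping.lookup (Poly_Mapping.single i (1::int)) j = 1" by simp
    then show False using that by (simp add: lookup_single)
  qed
  then have "G ^ t \<noteq> 0"
    unfolding G_def using finS by (auto simp: S_def)
  from CT_mult_star[OF this] show False using 0 unfolding F by simp
qed

subsection \<open>Determinants\<close>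

text \<open>Entries given by a function make it easy to let them be polynomials or vary along a
  sequence.\<close>

definition dt :: "nat \<Rightarrow> (nat \<Rightarrow> nat \<Rightarrow> 'a::comm_ring_1) \<Rightarrow> 'a" where
  "dt n A = Determinant.det (mat n n (\<lambda>(i, j). A i j))"

lemma dt_expand: "dt n A = (\<Sum>p | p permutes {0..<n}. signof p * (\<Prod>i = 0..<n. A i (p i)))"
  unfolding dt_def Determinant.det_def by (auto intro!: sum.cong prod.cong dest: permutes_in_image)

lemma dt_cong: "(\<And>i j. i < n \<Longrightarrow> j < n \<Longrightarrow> A i j = B i j) \<Longrightarrow> dt n A = dt n B"
  unfolding dt_def by (intro arg_cong[where f = Determinant.det] eq_matI) auto

lemma dt_mult: "dt n (\<lambda>i j. \<Sum>k<n. A i k * B k j) = dt n A * dt n B"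
proof -
  have "mat n n (\<lambda>(i, j). \<Sum>k<n. A i k * B k j) = mat n n (\<lambda>(i, j). A i j) * mat n n (\<lambda>(i, j). B i j)"
    by (rule eq_matI) (auto simp: scalar_prod_def lessThan_atLeast0)
  then show ?thesis unfolding dt_def by (simp add: det_mult[of _ n])
qed

lemma dt_row_scale: "dt n (\<lambda>i j. c i * A i j) = (\<Prod>i<n. c i) * dt n A"
  unfolding dt_expand by (simp add: prod.distrib sum_distrib_left lessThan_atLeast0 mult_ac)

lemma dt_col_scale: "dt n (\<lambda>i j. c j * A i j) = (\<Prod>i<n. c i) * dt n A"
proof -
  have "(\<Prod>i = 0..<n. c (p i)) = (\<Prod>i = 0..<n. c i)" if "p permutes {0..<n}" for p
    using prod.permute[OF that, of c] by (simp add: comp_def)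
  then show ?thesis
    unfolding dt_expand by (simp add: prod.distrib sum_distrib_left lessThan_atLeast0 mult_ac)
qed

lemma dt_lower_triangular:
  assumes "\<And>i j. i < j \<Longrightarrow> j < n \<Longrightarrow> A i j = 0"
  shows "dt n A = (\<Prod>i<n. A i i)"
proof -
  have "dt n A = prod_list (diag_mat (mat n n (\<lambda>(i, j). A i j)))"
    unfolding dt_def by (rule det_lower_triangular[of n]) (use assms in auto)
  then show ?thesis by (simp add: prod_list_diag_prod lessThan_atLeast0)
qed

text \<open>Left multiplication by the identity with row \<open>l\<close> replaced by
  \<open>y\<close>, which is lower triangular because \<open>y\<close> vanishes beyond
  \<open>l\<close>.\<close>

lemma dt_replace_row:
  assumes "l < n" "\<And>i. l < i \<Longrightarrow> i < n \<Longrightarrow> y i = 0"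
  shows "dt n (\<lambda>i j. if i = l then \<Sum>k<n. y k * A k j else A i j) = y l * dt n A"
proof -
  define E where "E i k = (if i = l then y k else if i = k then 1 else 0)" for i k
  have "dt n (\<lambda>i j. if i = l then \<Sum>k<n. y k * A k j else A i j) = dt n (\<lambda>i j. \<Sum>k<n. E i k * A k j)"
    by (rule dt_cong) (auto simp: E_def if_distrib[of "\<lambda>x. x * _"] cong: if_cong)
  also have "\<dots> = dt n E * dt n A" by (rule dt_mult)
  also have "dt n E = (\<Prod>i<n. E i i)"
    by (rule dt_lower_triangular) (use assms in \<open>auto simp: E_def\<close>)
  also have "\<dots> = (\<Prod>i<n. if i = l then y l else 1)"
    by (rule prod.cong) (auto simp: E_def)
  also have "\<dots> = y l" using assms by simp
  finally show ?thesis .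
qed

lemma dt_poly: "poly (dt n A) x = dt n (\<lambda>i j. poly (A i j) x)"
proof -
  have "poly (signof p) x = signof p" for p :: "nat \<Rightarrow> nat"
    by (simp add: sign_def)
  then show ?thesis by (simp add: dt_expand poly_sum poly_prod)
qed

lemma dt_kernel:
  fixes A :: "nat \<Rightarrow> nat \<Rightarrow> complex"
  assumes "\<And>j. j < n \<Longrightarrow> (\<Sum>i<n. a i * A i j) = 0" and "dt n A \<noteq> 0" and "i < n"
  shows "a i = 0"
proof (rule ccontr)
  assume ai: "a i \<noteq> 0"
  let ?M = "mat n n (\<lambda>(i, j). A i j)"
  have "Determinant.det (transpose_mat ?M) = 0"
  proof (subst det_0_iff_vec_prod_zero[of _ n], simp, intro exI conjI)
    show "vec n a \<in> carrier_vec n" by simp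
    show "vec n a \<noteq> 0\<^sub>v n"
      using ai assms(3) by (metis index_vec index_zero_vec(1))
    show "transpose_mat ?M *\<^sub>v vec n a = 0\<^sub>v n"
      by (rule eq_vecI) (use assms(1) in \<open>auto simp: scalar_prod_def lessThan_atLeast0 mult.commute\<close>)
  qed
  then show False
    using assms(2) by (simp add: dt_def det_transpose[of _ n])
qed

text \<open>Linearly independent left kernel vectors at \<open>x\<close> raise the order of the
  zero. One vector replaces a row by a combination divisible by the linear factor. The others,
  corrected to vanish at that row, remain independent and do not see the new row.\<close>

lemma power_dvd_dt:
  fixes A :: "nat \<Rightarrow> nat \<Rightarrow> complex poly" and y :: "nat \<Rightarrow> nat \<Rightarrow> complex"
  assumes "\<And>a. (\<And>l. l < n \<Longrightarrow> (\<Sum>i<k. a i * y i l) = 0) \<Longrightarrow> (\<forall>i<k. a i = 0)"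
    and "\<And>i j. i < k \<Longrightarrow> j < n \<Longrightarrow> (\<Sum>l<n. y i l * poly (A l j) x) = 0"
  shows "[:- x, 1:] ^ k dvd dt n A"
  using assms
proof (induction k arbitrary: A y)
  case (Suc k)
  have "\<exists>l<n. y k l \<noteq> 0"
  proof (rule ccontr)
    assume *: "\<not> ?thesis"
    have "\<forall>i<Suc k. (if i = k then 1 else 0 :: complex) = 0"
      by (rule Suc.prems(1)) (use * in \<open>simp add: if_distrib[of "\<lambda>x. x * _"] cong: if_cong\<close>)
    then show False by auto
  qed
  then have ne: "{l. l < n \<and> y k l \<noteq> 0} \<noteq> {}" by auto
  \<comment> \<open>Taking the last pivot makes the row operation lower triangular.\<close>
  define L where "L = Max {l. l < n \<and> y k l \<noteq> 0}"
  have L: "L < n" "y k L \<noteq> 0"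
    using Max_in[OF _ ne] by (auto simp: L_def)
  have L_max: "y k i = 0" if "L < i" "i < n" for i
  proof (rule ccontr)
    assume "y k i \<noteq> 0"
    then have "i \<le> L" unfolding L_def using that by (intro Max_ge) auto
    then show False using that by simp
  qed
  define b where "b j = (\<Sum>m<n. [:y k m:] * A m j)" for j
  have "poly (b j) x = 0" if "j < n" for j
    using Suc.prems(2)[of k j] that by (simp add: b_def poly_sum)
  then have "[:- x, 1:] dvd b j" if "j < n" for j
    using that by (simp add: poly_eq_0_iff_dvd)
  then obtain q where q: "\<And>j. j < n \<Longrightarrow> b j = [:- x, 1:] * q j"
    unfolding dvd_def by metis
  define B where "B i j = (if i = L then q j else A i j)" for i j
  define y' where "y' i l = y i l - y i L / y k L * y k l" for i l
  have 1: "smult (y k L) (dt n A) = [:- x, 1:] * dt n B"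
  proof -
    have "[:y k L:] * dt n A = dt n (\<lambda>i j. if i = L then b j else A i j)"
      unfolding b_def by (rule dt_replace_row[symmetric]) (use L L_max in auto)
    also have "\<dots> = dt n (\<lambda>i j. (if i = L then [:- x, 1:] else 1) * B i j)"
      by (rule dt_cong) (auto simp: B_def q)
    also have "\<dots> = [:- x, 1:] * dt n B"
      unfolding dt_row_scale using L by simp
    finally show ?thesis by simp
  qed
  have "[:- x, 1:] ^ k dvd dt n B"
  proof (rule Suc.IH[of y'])
    fix a assume a: "\<And>l. l < n \<Longrightarrow> (\<Sum>i<k. a i * y' i l) = 0"
    define c where "c = (\<Sum>i<k. a i * (y i L / y k L))"
    have "\<forall>i<Suc k. (if i = k then - c else a i) = 0"
    proof (rule Suc.prems(1))
      fix l assume l: "l < n"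
      have "(\<Sum>i<Suc k. (if i = k then - c else a i) * y i l) = (\<Sum>i<k. a i * y i l) - c * y k l"
        by simp
      also have "\<dots> = (\<Sum>i<k. a i * y' i l)"
        by (simp add: y'_def c_def sum_distrib_left sum_distrib_right sum_subtractf algebra_simps)
      finally show "(\<Sum>i<Suc k. (if i = k then - c else a i) * y i l) = 0"
        using a[OF l] by simp
    qed
    then show "\<forall>i<k. a i = 0"
      by (metis less_Suc_eq less_irrefl)
  next
    fix i j assume ij: "i < k" "j < n"
    have "y' i L = 0" using L by (simp add: y'_def)
    then have "(\<Sum>l<n. y' i l * poly (B l j) x) = (\<Sum>l<n. y' i l * poly (A l j) x)"
      by (intro sum.cong) (auto simp: B_def)
    also have "\<dots> = (\<Sum>l<n. y i l * poly (A l j) x) - y i L / y k L * (\<Sum>l<n. y k l * poly (A l j) x)"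
      by (simp add: y'_def sum_distrib_left sum_subtractf algebra_simps)
    also have "\<dots> = 0"
      using Suc.prems(2) ij by simp
    finally show "(\<Sum>l<n. y' i l * poly (B l j) x) = 0" .
  qed
  then have "[:- x, 1:] * [:- x, 1:] ^ k dvd [:- x, 1:] * dt n B"
    by (rule mult_dvd_mono[OF dvd_refl])
  then have "[:- x, 1:] ^ Suc k dvd smult (y k L) (dt n A)"
    by (simp only: 1 power_Suc)
  then show ?case
    using L(2) by (rule dvd_smult_cancel)
qed simp

subsection \<open>The Gram matrix in Fock space\<close>

definition npart :: "nat \<Rightarrow> nat \<Rightarrow> nat list" where
  "npart N i = partition_list N ! i"

definition pmul :: "nat \<Rightarrow> nat \<Rightarrow> nat multiset" where
  "pmul N i = mset (npart N i)"

lemma finite_partitions: "finite (partitions N)"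
proof (rule finite_subset)
  show "finite {xs. set xs \<subseteq> {..N} \<and> length xs \<le> N}"
    by (rule finite_lists_length_le) simp
  have "length xs \<le> sum_list xs" if "\<forall>i\<in>set xs. 1 \<le> i" for xs :: "nat list"
    using that by (induction xs) auto
  then show "partitions N \<subseteq> {xs. set xs \<subseteq> {..N} \<and> length xs \<le> N}"
    using member_le_sum_list by (fastforce simp: partitions_def)
qed

lemma partition_list: "distinct (partition_list N)" "set (partition_list N) = partitions N"
proof -
  obtain ps where "distinct ps \<and> set ps = partitions N"
    using finite_distinct_list[OF finite_partitions] by blast
  then have "distinct (partition_list N) \<and> set (partition_list N) = partitions N"
    unfolding partition_list_def by (rule someI)
  then show "distinct (partition_list N)" "set (partition_list N) = partitions N" by auto
qed

lemma length_partition_list: "length (partition_list N) = num_partitions N"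
  by (metis partition_list distinct_card num_partitions_def)

lemma npart_partitions: "i < num_partitions N \<Longrightarrow> npart N i \<in> partitions N"
  using partition_list(2)[of N] length_partition_list[of N] by (metis npart_def nth_mem)

lemma npart_pos: "i < num_partitions N \<Longrightarrow> k \<in> set (npart N i) \<Longrightarrow> k > 0"
  using npart_partitions[of i N] by (force simp: partitions_def)

definition parts :: "nat \<Rightarrow> nat multiset set" where
  "parts N = {M. wt M = N \<and> 0 \<notin># M}"

lemma bij_mset_partitions: "bij_betw mset (partitions N) (parts N)"
proof (rule bij_betwI[of _ _ _ sorted_list_of_multiset])
  show "mset \<in> partitions N \<rightarrow> parts N"
    by (force simp: partitions_def parts_def wt_def sum_mset_sum_list)
  show "sorted_list_of_multiset \<in> parts N \<rightarrow> partitions N"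
    by (auto simp: partitions_def parts_def wt_def sum_mset_sum_list[symmetric] Suc_le_eq
        intro: gr0I)
  show "sorted_list_of_multiset (mset x) = x" if "x \<in> partitions N" for x
    using that by (simp add: partitions_def sorted_sort_id)
qed simp

lemma bij_pmul: "bij_betw (pmul N) {..<num_partitions N} (parts N)"
proof -
  have "bij_betw (npart N) {..<num_partitions N} (partitions N)"
    using bij_betw_nth[OF partition_list(1) refl refl, of N] unfolding partition_list(2) length_partition_list
    by (simp add: npart_def[abs_def])
  from bij_betw_trans[OF this bij_mset_partitions] show ?thesis
    by (simp add: pmul_def comp_def cong: bij_betw_cong)
qed

lemma pmul_eq_iff: "i < num_partitions N \<Longrightarrow> j < num_partitions N \<Longrightarrow> pmul N i = pmul N j \<longleftrightarrow> i = j"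
  using bij_pmul[of N] by (auto simp: bij_betw_def inj_on_def)

lemma finite_parts: "finite (parts N)"
  using bij_betw_finite[OF bij_pmul] by simp

lemma card_parts: "card (parts N) = num_partitions N"
  using bij_betw_same_card[OF bij_pmul] by simp

lemma fock_lev_expand:
  assumes "fock_lev (int N) f"
  shows "f = (\<lambda>M. \<Sum>k<num_partitions N. f (pmul N k) * fock_delta (pmul N k) M)"
proof
  fix M
  have "(\<Sum>k<num_partitions N. f (pmul N k) * fock_delta (pmul N k) M) = (\<Sum>M'\<in>parts N. f M' * fock_delta M' M)"
    by (rule sum.reindex_bij_betw[OF bij_pmul])
  also have "\<dots> = (if M \<in> parts N then f M else 0)"
    by (simp add: fock_delta_def finite_parts if_distrib cong: if_cong)
  also have "\<dots> = f M"
    using assms by (auto simp: fock_lev_def parts_def)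
  finally show "f M = (\<Sum>k<num_partitions N. f (pmul N k) * fock_delta (pmul N k) M)" ..
qed

lemma fock_lev_eq_0:
  assumes "fock_lev (int N) f" "\<And>k. k < num_partitions N \<Longrightarrow> f (pmul N k) = 0"
  shows "f = (\<lambda>M. 0)"
  using fock_lev_expand[OF assms(1)] assms(2) by simp

lemma sum_list_down_word: "sum_list (down_word p) = - int (sum_list p)"
  by (induction p) (simp_all add: down_word_def)

lemma sum_list_npart: "i < num_partitions N \<Longrightarrow> sum_list (npart N i) = N"
  using npart_partitions by (auto simp: partitions_def)

lemma sum_list_map_int: "sum_list (map int p) = int (sum_list p)"
  by (induction p) simp_all

definition fockA :: "complex \<Rightarrow> complex \<Rightarrow> nat \<Rightarrow> nat \<Rightarrow> nat \<Rightarrow> complex" where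
  "fockA \<rho> \<mu> N i k = fockW \<rho> \<mu> (down_word (npart N i)) (fock_delta {#}) (pmul N k)"

definition fockB :: "complex \<Rightarrow> complex \<Rightarrow> nat \<Rightarrow> nat \<Rightarrow> nat \<Rightarrow> complex" where
  "fockB \<rho> \<mu> N k j = fockW \<rho> \<mu> (map int (npart N j)) (fock_delta (pmul N k)) {#}"

definition gram_det :: "nat \<Rightarrow> complex \<Rightarrow> complex \<Rightarrow> complex" where
  "gram_det N c h = dt (num_partitions N) (\<lambda>i j. vev c h (map int (npart N j) @ down_word (npart N i)))"

lemma kac_det_gram_det: "kac_det N c h = gram_det N (of_real c) (of_real h)"
  by (simp add: kac_det_eq gram_det_def gram_def dt_def npart_def)

lemma fockB_sum:
  assumes "fock_lev (int N) f"
  shows "(\<Sum>k<num_partitions N. f (pmul N k) * fockB \<rho> \<mu> N k j) = fockW \<rho> \<mu> (map int (npart N j)) f {#}"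
  by (subst (2) fock_lev_expand[OF assms]) (simp add: fockW_sum fockB_def)

text \<open>A raising word reaches level \<open>N\<close>, where the dual basis is complete;
  inserting it before the lowering word factors each Gram entry.\<close>

lemma gram_det_fock:
  assumes "c = 1 - 12 * \<rho>\<^sup>2" "h = (\<mu>\<^sup>2 - \<rho>\<^sup>2) / 2"
  shows "gram_det N c h = dt (num_partitions N) (fockA \<rho> \<mu> N) * dt (num_partitions N) (fockB \<rho> \<mu> N)"
proof -
  have "gram_det N c h = dt (num_partitions N) (\<lambda>i j. \<Sum>k<num_partitions N. fockA \<rho> \<mu> N i k * fockB \<rho> \<mu> N k j)"
    unfolding gram_det_def
  proof (rule dt_cong)
    fix i j assume i: "i < num_partitions N"
    have "fock_lev (int N) (fockW \<rho> \<mu> (down_word (npart N i)) (fock_delta {#}))"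
      using fockW_lev[OF fock_lev_delta[of "{#}"], where w = "down_word (npart N i)"] i
      by (simp add: sum_list_down_word sum_list_npart)
    from fockB_sum[OF this, of \<rho> \<mu> j]
    show "vev c h (map int (npart N j) @ down_word (npart N i))
      = (\<Sum>k<num_partitions N. fockA \<rho> \<mu> N i k * fockB \<rho> \<mu> N k j)"
      by (simp add: vev_fock[OF assms] fockA_def)
  qed
  then show ?thesis by (simp only: dt_mult)
qed

subsection \<open>Vanishing from a singular vector\<close>

lemma (in function_algebra) fockL:
  assumes r: "F \<rho>" and m: "F \<mu>" and f: "\<And>M. F (\<lambda>x. f x M)"
  shows "F (\<lambda>x. fockL (\<rho> x) (\<mu> x) n (f x) M)"
proof -
  have heis: "F (\<lambda>x. heis (\<mu> x) k (g x) M)" if "\<And>M. F (\<lambda>x. g x M)" for g k M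
  proof -
    consider "k > 0" | "k = 0" | "k < 0" by linarith
    then show ?thesis
    proof cases
      case 3
      let ?m = "nat (- k)"
      have "F (\<lambda>x. of_nat (?m * count M ?m) * g x (M - {#?m#}))"
        by (intro mult const that)
      then show ?thesis using 3 by (simp add: heis_def)
    qed (auto simp: heis_def intro!: mult m that)
  qed
  have "F (\<lambda>x. if n = 0 then (\<rho> x)\<^sup>2 / 2 else 0)"
    using mult[OF const[of "1/2"] power[OF r, of 2]] by (cases "n = 0") (auto simp: const)
  then show ?thesis
    unfolding fockL_def nord_def
    by (intro diff mult sum heis const r f)
qed

lemma (in function_algebra) fockW:
  assumes "F \<rho>" "F \<mu>" "\<And>M. F (\<lambda>x. f x M)"
  shows "F (\<lambda>x. fockW (\<rho> x) (\<mu> x) w (f x) M)"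
  using assms by (induction w arbitrary: M) (simp_all add: fockL)

interpretation poly_fun: function_algebra "\<lambda>f :: complex \<Rightarrow> complex. \<exists>p. \<forall>x. f x = poly p x"
proof
  show "\<exists>p. \<forall>x. a = poly p x" for a :: complex
    by (rule exI[of _ "[:a:]"]) simp
  show "\<exists>p. \<forall>x. f x + g x = poly p x" if "\<exists>p. \<forall>x. f x = poly p x" "\<exists>p. \<forall>x. g x = poly p x"
    for f g :: "complex \<Rightarrow> complex"
    using that by (metis poly_add)
  show "\<exists>p. \<forall>x. f x * g x = poly p x" if "\<exists>p. \<forall>x. f x = poly p x" "\<exists>p. \<forall>x. g x = poly p x"
    for f g :: "complex \<Rightarrow> complex"
    using that by (metis poly_mult)
qed

lemma poly_fun_id: "\<exists>p. \<forall>x. x = poly p (x::complex)"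
  by (rule exI[of _ "[:0, 1:]"]) simp

lemma gram_det_poly: "\<exists>p. \<forall>h. gram_det N c h = poly p h"
  unfolding gram_det_def dt_def
  by (intro poly_fun.det poly_fun.vac_fun[of "\<lambda>h. c" "\<lambda>h. h" "\<lambda>h. vev c h"] vac_fun_vev poly_fun.const poly_fun_id)

text \<open>The rows are the descendants of the singular vector \<open>u\<close>. A word of total
  \<open>N\<close> applied to one has total \<open>l > 0\<close> on \<open>u\<close> and kills it,
  which gives the left kernel of \<open>fockB\<close> at \<open>\<mu>\<^sub>0\<close>;
  \<open>power_dvd_dt\<close> does the rest.\<close>

lemma fockB_dvd:
  assumes u: "fock_lev (int l) u" "\<And>k. k > 0 \<Longrightarrow> fockL \<rho> \<mu>\<^sub>0 k u = (\<lambda>M. 0)" "u M0 \<noteq> 0"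
    and l: "l > 0" "l \<le> N"
    and c: "c = 1 - 12 * \<rho>\<^sup>2" and h: "h = (\<mu>\<^sub>0\<^sup>2 - \<rho>\<^sup>2) / 2 + of_nat l"
    and nz: "gram_det (N - l) c h \<noteq> 0"
    and p: "\<And>\<mu>. dt (num_partitions N) (fockB \<rho> \<mu> N) = poly p \<mu>"
  shows "[:- \<mu>\<^sub>0, 1:] ^ num_partitions (N - l) dvd p"
proof -
  let ?n = "num_partitions N" and ?k = "num_partitions (N - l)"
  have "\<exists>b. \<forall>\<mu>. fockB \<rho> \<mu> N k j = poly b \<mu>" for k j
    unfolding fockB_def by (rule poly_fun.fockW[OF poly_fun.const poly_fun_id poly_fun.const])
  then obtain b where b: "fockB \<rho> \<mu> N k j = poly (b k j) \<mu>" for \<mu> k j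
    by metis
  have "poly p \<mu> = poly (dt ?n b) \<mu>" for \<mu>
    unfolding p[symmetric] dt_poly b by (rule refl)
  then have pb: "p = dt ?n b" by (intro poly_ext)
  define Y where "Y i = fockW \<rho> \<mu>\<^sub>0 (down_word (npart (N - l) i)) u" for i
  have Y_lev: "fock_lev (int N) (Y i)" if "i < ?k" for i
    using fockW_lev[OF u(1), where w = "down_word (npart (N - l) i)"] that l
    by (simp add: Y_def sum_list_down_word sum_list_npart of_nat_diff)
  show ?thesis
    unfolding pb
  proof (rule power_dvd_dt)
    fix i j assume ij: "i < ?k" "j < ?n"
    have s: "sum_list (map int (npart N j) @ down_word (npart (N - l) i)) = int l"
      using ij l by (simp add: sum_list_map_int sum_list_down_word sum_list_npart of_nat_diff)
    have "fockW \<rho> \<mu>\<^sub>0 (map int (npart N j)) (Y i) {#} = vev c h (map int (npart N j) @ down_word (npart (N - l) i)) * u {#}"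
      using fockW_singular[OF u(1,2) c h, of "map int (npart N j) @ down_word (npart (N - l) i)"] s
      by (simp add: Y_def)
    also have "vev c h (map int (npart N j) @ down_word (npart (N - l) i)) = 0"
      by (rule vac_fun_total[OF vac_fun_vev]) (use s l in simp)
    finally show "(\<Sum>m<?n. Y i (pmul N m) * poly (b m j) \<mu>\<^sub>0) = 0"
      using fockB_sum[OF Y_lev[OF ij(1)], of \<rho> \<mu>\<^sub>0 j] by (simp add: b)
  next
    fix a assume a: "\<And>m. m < ?n \<Longrightarrow> (\<Sum>i<?k. a i * Y i (pmul N m)) = 0"
    have "fock_lev (int N) (\<lambda>M. \<Sum>i<?k. a i * Y i M)"
      unfolding fock_lev_def
    proof (intro allI impI)
      fix M assume "(\<Sum>i<?k. a i * Y i M) \<noteq> 0"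
      then obtain i where "i < ?k" "Y i M \<noteq> 0"
        by (metis (no_types, lifting) lessThan_iff mult_zero_right sum.neutral)
      then show "int (wt M) = int N \<and> 0 \<notin># M"
        using Y_lev[of i] by (auto simp: fock_lev_def)
    qed
    then have 0: "(\<lambda>M. \<Sum>i<?k. a i * Y i M) = (\<lambda>M. 0)"
      by (rule fock_lev_eq_0) (rule a)
    \<comment> \<open>Independence: words of total \<open>N - l\<close> bring the descendants back
      to multiples of \<open>u\<close>, and the multiples are the Gram entries of level
      \<open>N - l\<close>.\<close>
    have "(\<Sum>i<?k. a i * vev c h (map int (npart (N - l) j) @ down_word (npart (N - l) i))) = 0"
      if j: "j < ?k" for j
    proof -
      let ?w = "map int (npart (N - l) j)"
      have "(\<Sum>i<?k. a i * vev c h (?w @ down_word (npart (N - l) i))) * u M0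
          = (\<Sum>i<?k. a i * fockW \<rho> \<mu>\<^sub>0 ?w (Y i) M0)"
        unfolding sum_distrib_right
      proof (rule sum.cong)
        fix i assume i: "i \<in> {..<?k}"
        have "sum_list (?w @ down_word (npart (N - l) i)) = 0"
          using i j by (simp add: sum_list_map_int sum_list_down_word sum_list_npart)
        then show "a i * vev c h (?w @ down_word (npart (N - l) i)) * u M0 = a i * fockW \<rho> \<mu>\<^sub>0 ?w (Y i) M0"
          using fockW_singular[OF u(1,2) c h, of "?w @ down_word (npart (N - l) i)"]
          by (simp add: Y_def)
      qed simp
      also have "\<dots> = fockW \<rho> \<mu>\<^sub>0 ?w (\<lambda>M. \<Sum>i<?k. a i * Y i M) M0"
        by (simp add: fockW_sum)
      also have "\<dots> = 0" unfolding 0 by (simp add: fockW_zero)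
      finally show ?thesis using u(3) by simp
    qed
    then show "\<forall>i<?k. a i = 0"
      using dt_kernel[OF _ nz[unfolded gram_det_def]] by blast
  qed
qed

subsection \<open>The leading coefficient\<close>

lemma dt_tendsto:
  fixes L :: "nat \<Rightarrow> nat \<Rightarrow> complex"
  assumes "\<And>i k. i < n \<Longrightarrow> k < n \<Longrightarrow> (\<lambda>j. A j i k) \<longlonglongrightarrow> L i k"
  shows "(\<lambda>j. dt n (A j)) \<longlonglongrightarrow> dt n L"
  unfolding dt_expand
  by (intro tendsto_sum tendsto_mult tendsto_const tendsto_prod assms) (auto dest: permutes_in_image)

text \<open>The momenta along which \<mu> tends to infinity, starting at 1 so that division is
  safe.\<close>

definition seqc :: "nat \<Rightarrow> complex" where
  "seqc j = of_nat (Suc j)"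

lemma seqc_nz [simp]: "seqc j \<noteq> 0"
  by (simp add: seqc_def del: of_nat_Suc)

lemma seqc_inverse: "(\<lambda>j. 1 / seqc j) \<longlonglongrightarrow> 0"
  unfolding seqc_def using LIMSEQ_Suc[OF lim_1_over_n] .

lemma heis_lim:
  assumes "\<And>M. (\<lambda>j. f j M / seqc j ^ d) \<longlonglongrightarrow> g M" and "n \<noteq> 0"
  shows "(\<lambda>j. heis (seqc j) n (f j) M / seqc j ^ d) \<longlonglongrightarrow> heis 0 n g M"
proof (cases "n > 0")
  case True
  then show ?thesis using assms by (simp add: heis_def)
next
  case False
  then show ?thesis
    using assms(2) tendsto_mult_left[OF assms(1)[of "M - {#nat (- n)#}"], of "of_nat (nat (- n) * count M (nat (- n)))"]
    by (simp add: heis_def)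
qed

text \<open>For large \<mu> the operator \<open>L_n\<close> behaves like \<mu> times
  \<open>a_n\<close>: the two terms containing the zero mode, \<open>k = 0\<close> and
  \<open>k = n\<close>, each supply half of it.\<close>

lemma fockL_lim:
  assumes f: "\<And>M. (\<lambda>j. f j M / seqc j ^ d) \<longlonglongrightarrow> g M" and n: "n \<noteq> 0"
  shows "(\<lambda>j. fockL \<rho> (seqc j) n (f j) M / seqc j ^ Suc d) \<longlonglongrightarrow> heis 0 n g M"
proof -
  define A where "A = {- (\<bar>n\<bar> + int (wt M)) .. \<bar>n\<bar> + int (wt M)}"
  have A: "0 \<in> A" "n \<in> A" "finite A" by (auto simp: A_def)
  have small: "(\<lambda>j. x j / seqc j ^ Suc d) \<longlonglongrightarrow> 0" if "(\<lambda>j. x j / seqc j ^ d) \<longlonglongrightarrow> y" for x y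
    using tendsto_mult[OF that seqc_inverse] by (simp add: mult.commute)
  have "nord (seqc j) k (n - k) (f j) M = seqc j * heis (seqc j) n (f j) M" if "k = 0 \<or> k = n" for k j
    using that by (auto simp: nord_def min_def max_def heis_def)
  then have 1: "(\<lambda>j. nord (seqc j) k (n - k) (f j) M / seqc j ^ Suc d) \<longlonglongrightarrow> heis 0 n g M" if "k = 0 \<or> k = n" for k
    using that heis_lim[OF f n, where M = M] by simp
  have 2: "(\<lambda>j. nord (seqc j) k (n - k) (f j) M / seqc j ^ Suc d) \<longlonglongrightarrow> 0" if "k \<noteq> 0" "k \<noteq> n" for k
    unfolding nord_def
    by (rule small, rule heis_lim, rule heis_lim, rule f) (use that in \<open>auto simp: min_def max_def\<close>)
  have "(\<lambda>j. \<Sum>k\<in>A. nord (seqc j) k (n - k) (f j) M / seqc j ^ Suc d)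
      \<longlonglongrightarrow> (\<Sum>k\<in>A. (if k = 0 then heis 0 n g M else 0) + (if k = n then heis 0 n g M else 0))"
  proof (rule tendsto_sum)
    fix k
    have "(if k = 0 then heis 0 n g M else 0) + (if k = n then heis 0 n g M else 0)
        = (if k = 0 \<or> k = n then heis 0 n g M else 0)"
      using n by auto
    then show "(\<lambda>j. nord (seqc j) k (n - k) (f j) M / seqc j ^ Suc d)
        \<longlonglongrightarrow> (if k = 0 then heis 0 n g M else 0) + (if k = n then heis 0 n g M else 0)"
      using 1[of k] 2[of k] by (cases "k = 0 \<or> k = n") (simp_all only: if_True if_False, blast)
  qed
  then have 3: "(\<lambda>j. (\<Sum>k\<in>A. nord (seqc j) k (n - k) (f j) M) / seqc j ^ Suc d) \<longlonglongrightarrow> 2 * heis 0 n g M"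
    using A by (simp add: sum.distrib sum_divide_distrib)
  have 4: "(\<lambda>j. heis (seqc j) n (f j) M / seqc j ^ Suc d) \<longlonglongrightarrow> 0"
    by (rule small, rule heis_lim[OF f n])
  have "fockL \<rho> (seqc j) n (f j) M / seqc j ^ Suc d
      = 1 / 2 * ((\<Sum>k\<in>A. nord (seqc j) k (n - k) (f j) M) / seqc j ^ Suc d)
        - \<rho> * of_int n * (heis (seqc j) n (f j) M / seqc j ^ Suc d)" for j
    using n by (simp add: fockL_def A_def diff_divide_distrib)
  moreover have "(\<lambda>j. 1 / 2 * ((\<Sum>k\<in>A. nord (seqc j) k (n - k) (f j) M) / seqc j ^ Suc d)
        - \<rho> * of_int n * (heis (seqc j) n (f j) M / seqc j ^ Suc d))
      \<longlonglongrightarrow> 1 / 2 * (2 * heis 0 n g M) - \<rho> * of_int n * 0"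
    by (intro tendsto_diff tendsto_mult tendsto_const 3 4)
  ultimately show ?thesis by simp
qed

lemma fockW_lim:
  "0 \<notin> set w \<Longrightarrow> (\<lambda>j. fockW \<rho> (seqc j) w f M / seqc j ^ length w) \<longlonglongrightarrow> foldr (heis 0) w f M"
proof (induction w arbitrary: M)
  case (Cons n w)
  then show ?case
    using fockL_lim[of "\<lambda>j. fockW \<rho> (seqc j) w f" "length w" "foldr (heis 0) w f" n \<rho> M] by simp
qed simp

lemma heis_annihilate:
  "(\<And>i. i \<in> set p \<Longrightarrow> i > 0) \<Longrightarrow> foldr (heis 0) (map int p) f M = f (mset p + M)"
  by (induction p arbitrary: M) (simp_all add: heis_pos)

text \<open>The factor is the norm of the monomial, the product of \<open>i ^ m_i * m_i!\<close>
  over the multiplicities \<open>m_i\<close>. Its positivity becomes that of the final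
  constant.\<close>

lemma heis_create:
  assumes "\<And>i. i \<in> set p \<Longrightarrow> i > 0"
  shows "\<exists>z::real. z > 0 \<and> (\<forall>M. foldr (heis 0) (down_word p) (fock_delta {#}) M = (if M = mset p then of_real z else 0))"
  using assms
proof (induction p rule: rev_induct)
  case Nil
  then show ?case by (intro exI[of _ 1]) (auto simp: down_word_def fock_delta_def)
next
  case (snoc i p)
  then obtain z :: real where z: "z > 0"
    "\<And>M. foldr (heis 0) (down_word p) (fock_delta {#}) M = (if M = mset p then of_real z else 0)"
    by auto
  let ?z = "z * real (i * count (mset (p @ [i])) i)"
  have "foldr (heis 0) (down_word (p @ [i])) (fock_delta {#}) M = (if M = mset (p @ [i]) then of_real ?z else 0)" for M
  proof -
    have "foldr (heis 0) (down_word (p @ [i])) (fock_delta {#}) M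
        = of_nat (i * count M i) * (if M - {#i#} = mset p then of_real z else 0)"
      using snoc.prems by (simp add: down_word_def heis_neg z(2)[unfolded down_word_def])
    moreover have "M - {#i#} = mset p \<longleftrightarrow> M = mset (p @ [i])" if "i \<in># M"
      using insert_DiffM[OF that] by auto
    ultimately show ?thesis
      by (cases "i \<in># M") (auto simp: not_in_iff algebra_simps)
  qed
  moreover have "i > 0" using snoc.prems by simp
  then have "?z > 0" using z(1) by (intro mult_pos_pos) (simp_all add: add_pos_nonneg)
  ultimately show ?case by blast
qed

lemma length_down_word: "length (down_word p) = length p"
  by (simp add: down_word_def)

definition lens :: "nat \<Rightarrow> nat" where
  "lens N = (\<Sum>i<num_partitions N. length (npart N i))"

text \<open>The limit of \<open>fockA\<close> is diagonal with the monomial norms and that of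
  \<open>fockB\<close> is the identity. The quantifier order matters: \<open>z\<close> is chosen
  before \<rho>, which makes the constant independent of the central charge.\<close>

lemma gram_det_lim:
  "\<exists>z::real. z > 0 \<and> (\<forall>\<rho>. (\<lambda>j. gram_det N (1 - 12 * \<rho>\<^sup>2) (((seqc j)\<^sup>2 - \<rho>\<^sup>2) / 2) / seqc j ^ (2 * lens N)) \<longlonglongrightarrow> of_real z)"
proof -
  let ?n = "num_partitions N"
  have "\<forall>i. \<exists>z::real. i < ?n \<longrightarrow> z > 0 \<and>
      (\<forall>M. foldr (heis 0) (down_word (npart N i)) (fock_delta {#}) M = (if M = pmul N i then of_real z else 0))"
    using heis_create npart_pos unfolding pmul_def by blast
  then obtain z :: "nat \<Rightarrow> real" where z: "\<And>i. i < ?n \<Longrightarrow> z i > 0"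
    "\<And>i M. i < ?n \<Longrightarrow> foldr (heis 0) (down_word (npart N i)) (fock_delta {#}) M = (if M = pmul N i then of_real (z i) else 0)"
    by metis
  have len: "(\<Prod>i<?n. 1 / seqc j ^ length (npart N i)) = 1 / seqc j ^ lens N" for j
    by (simp add: lens_def power_sum prod_dividef)
  have A: "(\<lambda>j. dt ?n (fockA \<rho> (seqc j) N) / seqc j ^ lens N) \<longlonglongrightarrow> of_real (\<Prod>i<?n. z i)" for \<rho>
  proof -
    have "(\<lambda>j. dt ?n (\<lambda>i k. 1 / seqc j ^ length (npart N i) * fockA \<rho> (seqc j) N i k))
        \<longlonglongrightarrow> dt ?n (\<lambda>i k. if k = i then of_real (z i) else 0)"
    proof (rule dt_tendsto)
      fix i k assume ik: "i < ?n" "k < ?n"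
      have "0 \<notin> set (down_word (npart N i))"
        using npart_pos[OF ik(1), of 0] by (auto simp: down_word_def)
      from fockW_lim[OF this, of \<rho> "fock_delta {#}" "pmul N k"]
      show "(\<lambda>j. 1 / seqc j ^ length (npart N i) * fockA \<rho> (seqc j) N i k) \<longlonglongrightarrow> (if k = i then of_real (z i) else 0)"
        using ik by (simp add: z(2) fockA_def pmul_eq_iff length_down_word)
    qed
    also have "dt ?n (\<lambda>i k. if k = i then complex_of_real (z i) else 0) = of_real (\<Prod>i<?n. z i)"
      by (subst dt_lower_triangular) auto
    finally show ?thesis unfolding dt_row_scale len by simp
  qed
  have B: "(\<lambda>j. dt ?n (fockB \<rho> (seqc j) N) / seqc j ^ lens N) \<longlonglongrightarrow> 1" for \<rho>
  proof -
    have "(\<lambda>j. dt ?n (\<lambda>k i. 1 / seqc j ^ length (npart N i) * fockB \<rho> (seqc j) N k i))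
        \<longlonglongrightarrow> dt ?n (\<lambda>k i. if k = i then 1 else 0)"
    proof (rule dt_tendsto)
      fix k i assume ik: "k < ?n" "i < ?n"
      have "0 \<notin> set (map int (npart N i))"
        using npart_pos[OF ik(2), of 0] by auto
      from fockW_lim[OF this, of \<rho> "fock_delta (pmul N k)" "{#}"]
      have "(\<lambda>j. 1 / seqc j ^ length (npart N i) * fockB \<rho> (seqc j) N k i) \<longlonglongrightarrow> fock_delta (pmul N k) (pmul N i)"
        using npart_pos[OF ik(2)] by (simp add: heis_annihilate fockB_def pmul_def[of N i])
      then show "(\<lambda>j. 1 / seqc j ^ length (npart N i) * fockB \<rho> (seqc j) N k i) \<longlonglongrightarrow> (if k = i then 1 else 0)"
        using ik by (auto simp: fock_delta_def pmul_eq_iff)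
    qed
    also have "dt ?n (\<lambda>k i. if k = i then 1 else 0 :: complex) = 1"
      by (subst dt_lower_triangular) auto
    finally show ?thesis unfolding dt_col_scale len by simp
  qed
  have "(\<lambda>j. gram_det N (1 - 12 * \<rho>\<^sup>2) (((seqc j)\<^sup>2 - \<rho>\<^sup>2) / 2) / seqc j ^ (2 * lens N)) \<longlonglongrightarrow> of_real (\<Prod>i<?n. z i)" for \<rho>
    using tendsto_mult[OF A[of \<rho>] B[of \<rho>]] by (simp add: gram_det_fock[OF refl refl] mult_2 power_add)
  moreover have "(\<Prod>i<?n. z i) > 0"
    by (rule prod_pos) (use z(1) in auto)
  ultimately show ?thesis by blast
qed

section \<open>The degree in \<open>h\<close>: counting parts of partitions\<close>

definition kac_pairs :: "nat \<Rightarrow> (nat \<times> nat) set" where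
  "kac_pairs N = {(p, q). 1 \<le> p \<and> 1 \<le> q \<and> p * q \<le> N}"

lemma kac_pairs_subset: "kac_pairs N \<subseteq> {1..N} \<times> {1..N}"
proof
  fix x assume "x \<in> kac_pairs N"
  then obtain p q where x: "x = (p, q)" "1 \<le> p" "1 \<le> q" "p * q \<le> N"
    by (auto simp: kac_pairs_def)
  have "p \<le> p * q" "q \<le> p * q" using x by simp_all
  then have "p \<le> N" "q \<le> N" using x(4) by linarith+
  then show "x \<in> {1..N} \<times> {1..N}" using x by simp
qed

lemma finite_kac_pairs: "finite (kac_pairs N)"
  by (rule finite_subset[OF kac_pairs_subset]) simp

lemma wt_replicate: "wt (replicate_mset s k) = s * k"
  by (induction s) simp_all

text \<open>Removing \<open>s\<close> copies of \<open>k\<close> is a bijection onto the partitions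
  of the remainder.\<close>

lemma card_parts_count:
  assumes "k \<ge> 1"
  shows "card {M \<in> parts N. s \<le> count M k} = (if k * s \<le> N then num_partitions (N - k * s) else 0)"
proof -
  have wt: "wt M = s * k + wt (M - replicate_mset s k)" if "s \<le> count M k" for M
  proof -
    have "replicate_mset s k \<subseteq># M" using that by (simp add: count_le_replicate_mset_subset_eq)
    then have "M = replicate_mset s k + (M - replicate_mset s k)" by (simp add: subset_mset.add_diff_inverse)
    then show ?thesis by (metis wt_union wt_replicate)
  qed
  show ?thesis
  proof (cases "k * s \<le> N")
    case True
    have "bij_betw (\<lambda>M. M - replicate_mset s k) {M \<in> parts N. s \<le> count M k} (parts (N - k * s))"
    proof (rule bij_betwI[of _ _ _ "\<lambda>M. M + replicate_mset s k"])
      show "(\<lambda>M. M - replicate_mset s k) \<in> {M \<in> parts N. s \<le> count M k} \<rightarrow> parts (N - k * s)"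
        using wt by (auto simp: parts_def mult.commute dest: in_diffD)
      show "(\<lambda>M. M + replicate_mset s k) \<in> parts (N - k * s) \<rightarrow> {M \<in> parts N. s \<le> count M k}"
        using True assms by (auto simp: parts_def wt_replicate mult.commute)
      show "M - replicate_mset s k + replicate_mset s k = M" if "M \<in> {M \<in> parts N. s \<le> count M k}" for M
        using that by (simp add: count_le_replicate_mset_subset_eq)
    qed simp
    then show ?thesis
      using True by (simp add: bij_betw_same_card card_parts)
  next
    case False
    then have e: "{M \<in> parts N. s \<le> count M k} = {}"
      using wt by (auto simp: parts_def mult.commute)
    show ?thesis unfolding e using False by simp
  qed
qed

text \<open>Both sides count triples \<open>M\<close>, \<open>k\<close>, \<open>s\<close> with
  \<open>s\<close> at most the multiplicity of \<open>k\<close> in \<open>M\<close>: a multiplicity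
  is the number of such positive \<open>s\<close>. So the degree coming from the Fock space is the
  degree of the Kac product.\<close>

lemma lens_eq: "lens N = (\<Sum>(p, q)\<in>kac_pairs N. num_partitions (N - p * q))"
proof -
  have "lens N = (\<Sum>i<num_partitions N. size (pmul N i))"
    by (simp add: lens_def pmul_def)
  also have "\<dots> = (\<Sum>M\<in>parts N. size M)"
    by (rule sum.reindex_bij_betw[OF bij_pmul])
  also have "\<dots> = (\<Sum>M\<in>parts N. \<Sum>k\<in>{1..N}. \<Sum>s\<in>{1..N}. if s \<le> count M k then 1 else 0)"
  proof (rule sum.cong)
    fix M assume M: "M \<in> parts N"
    have "size M = (\<Sum>k\<in>set_mset M. count M k)" by (rule size_multiset_overloaded_eq)
    also have "\<dots> = (\<Sum>k\<in>{1..N}. count M k)"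
    proof (rule sum.mono_neutral_left)
      show "set_mset M \<subseteq> {1..N}"
        using M wt_member[of _ M] by (auto simp: parts_def Suc_le_eq intro: gr0I)
    qed (auto simp: not_in_iff)
    also have "\<dots> = (\<Sum>k\<in>{1..N}. \<Sum>s\<in>{1..N}. if s \<le> count M k then 1 else 0)"
    proof (rule sum.cong)
      fix k assume k: "k \<in> {1..N}"
      have "k * count M k \<le> (\<Sum>m = 1..N. m * count M m)"
        by (rule member_le_sum) (use k in auto)
      also have "\<dots> = N" using M sum_count[of M N] by (simp add: parts_def)
      finally have "k * count M k \<le> N" .
      then have "count M k \<le> N" using k by (metis atLeastAtMost_iff le_trans mult.commute mult_le_mono2 nat_mult_1_right)
      then have "{s \<in> {1..N}. s \<le> count M k} = {1..count M k}" by auto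
      then show "count M k = (\<Sum>s\<in>{1..N}. if s \<le> count M k then 1 else 0)"
        using sum.inter_filter[of "{1..N}" "\<lambda>_. 1 :: nat" "\<lambda>s. s \<le> count M k"] by simp
    qed simp
    finally show "size M = (\<Sum>k\<in>{1..N}. \<Sum>s\<in>{1..N}. if s \<le> count M k then 1 else 0)" .
  qed simp
  also have "\<dots> = (\<Sum>k\<in>{1..N}. \<Sum>s\<in>{1..N}. \<Sum>M\<in>parts N. if s \<le> count M k then 1 else 0)"
    by (subst sum.swap, intro sum.cong refl, rule sum.swap)
  also have "\<dots> = (\<Sum>k\<in>{1..N}. \<Sum>s\<in>{1..N}. if k * s \<le> N then num_partitions (N - k * s) else 0)"
  proof (intro sum.cong refl)
    fix k s assume "k \<in> {1..N}"
    then have "card {M \<in> parts N. s \<le> count M k} = (if k * s \<le> N then num_partitions (N - k * s) else 0)"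
      by (intro card_parts_count) simp
    then show "(\<Sum>M\<in>parts N. if s \<le> count M k then 1 else 0) = (if k * s \<le> N then num_partitions (N - k * s) else 0)"
      using sum.inter_filter[OF finite_parts, of "\<lambda>_. 1 :: nat" N "\<lambda>M. s \<le> count M k"] by simp
  qed
  also have "\<dots> = (\<Sum>(k, s)\<in>{1..N} \<times> {1..N}. if k * s \<le> N then num_partitions (N - k * s) else 0)"
    by (rule sum.cartesian_product)
  also have "\<dots> = (\<Sum>(p, q)\<in>kac_pairs N. num_partitions (N - p * q))"
    by (rule sum.mono_neutral_cong_right) (use kac_pairs_subset in \<open>auto simp: kac_pairs_def split: if_splits\<close>)
  finally show ?thesis .
qed

subsection \<open>The determinant formula for large integers\<close>

definition kac_c :: "complex \<Rightarrow> complex" where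
  "kac_c t = 13 - 6 * t - 6 / t"

definition kac_h :: "complex \<Rightarrow> nat \<Rightarrow> nat \<Rightarrow> complex" where
  "kac_h t r s = t * of_nat (r ^ 2) / 4 + of_nat (s ^ 2) / (4 * t) - of_nat (r * s) / 2 + 1 / 2 - t / 4 - 1 / (4 * t)"

lemma kac_h_mult:
  assumes "t \<noteq> 0"
  shows "4 * t * kac_h t r s = t\<^sup>2 * of_nat (r ^ 2) + of_nat (s ^ 2) - 2 * t * of_nat (r * s) + 2 * t - t\<^sup>2 - 1"
  using assms by (simp add: kac_h_def field_simps power2_eq_square)

text \<open>Used with \<open>n = 0\<close> for distinctness of the roots and with
  \<open>n = r * s\<close> for the nonvanishing of the smaller determinant.\<close>

lemma kac_h_diff_generic:
  assumes "1 \<le> r" "1 \<le> s" "r * s \<le> N" "1 \<le> r'" "1 \<le> s'" "r' * s' \<le> N" "n \<le> N"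
    and t: "8 * (N + 1)\<^sup>2 \<le> t"
    and eq: "kac_h (of_nat t) r s + of_nat n = kac_h (of_nat t) r' s'"
  shows "n = 0 \<and> r = r' \<and> s = s'"
proof -
  have le: "r \<le> N" "s \<le> N" "r' \<le> N" "s' \<le> N"
  proof -
    have "(r, s) \<in> kac_pairs N" "(r', s') \<in> kac_pairs N"
      using assms(1-6) by (simp_all add: kac_pairs_def)
    then show "r \<le> N" "s \<le> N" "r' \<le> N" "s' \<le> N"
      using kac_pairs_subset[of N] by auto
  qed
  have t0: "t > 0" using t by (simp add: power2_eq_square)
  \<comment> \<open>After multiplication by \<open>4 * t\<close> the equation reads
    \<open>t\<^sup>2 * a + b - 2 * t * e = 0\<close> with \<bar>b\<bar> at most
    \<open>N\<^sup>2\<close> and \<bar>e\<bar> at most \<open>3 * N\<close>. The bound on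
    \<open>t\<close> exceeds both \<open>6 * N\<close> and \<open>N\<^sup>2\<close>, which forces
    \<open>a\<close>, then \<open>e\<close>, then \<open>b\<close> to vanish.\<close>
  define a b e where "a = (int r)\<^sup>2 - (int r')\<^sup>2" and "b = (int s)\<^sup>2 - (int s')\<^sup>2"
    and "e = int (r * s) - int (r' * s') - 2 * int n"
  have "of_int ((int t)\<^sup>2 * a + b - 2 * int t * e) = (4 * of_nat t * (kac_h (of_nat t) r s + of_nat n - kac_h (of_nat t) r' s') :: complex)"
    using t0 by (simp only: distrib_left right_diff_distrib kac_h_mult of_nat_eq_0_iff) (simp add: a_def b_def e_def algebra_simps)
  also have "\<dots> = 0" using eq by simp
  finally have z: "(int t)\<^sup>2 * a + b - 2 * int t * e = 0"
    by (simp only: of_int_eq_0_iff)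
  define T K where "T = int t" and "K = int N"
  have K: "K \<ge> 0" "K \<ge> 1"
    using le assms by (simp_all add: K_def)
  have "int (8 * (N + 1)\<^sup>2) \<le> int t"
    using t by (simp only: of_nat_le_iff)
  then have T: "8 * (K + 1)\<^sup>2 \<le> T"
    by (simp add: K_def T_def add.commute)
  have sq: "(int x)\<^sup>2 \<le> K\<^sup>2" if "x \<le> N" for x
    using that by (simp add: K_def power_mono)
  have b: "\<bar>b\<bar> \<le> K\<^sup>2"
    using sq[of s] sq[of s'] le by (simp add: b_def abs_le_iff) (smt (verit) zero_le_power2)
  have "int (r * s) \<le> K" "int (r' * s') \<le> K" "int (r * s) \<ge> 0" "int (r' * s') \<ge> 0"
    using assms(3,6) by (simp_all only: K_def of_nat_le_iff of_nat_0_le_iff)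
  then have e: "\<bar>e\<bar> \<le> 3 * K"
    using assms(7) by (simp only: e_def K_def)
  have KT: "K * 8 \<le> T" "K\<^sup>2 * 8 + 8 \<le> T" "1 \<le> T"
    using T K by (auto simp: power2_eq_square algebra_simps) (smt (verit) mult_nonneg_nonneg)+
  have "a = 0"
  proof (rule ccontr)
    assume "a \<noteq> 0"
    then have "T\<^sup>2 * 1 \<le> T\<^sup>2 * \<bar>a\<bar>" by (intro mult_left_mono) auto
    also have "\<dots> = \<bar>T\<^sup>2 * a\<bar>" by (simp add: abs_mult)
    also have "T\<^sup>2 * a = 2 * T * e - b" using z by (simp add: T_def)
    also have "\<bar>2 * T * e - b\<bar> \<le> \<bar>2 * T * e\<bar> + \<bar>b\<bar>" by (rule abs_triangle_ineq4)
    also have "\<dots> \<le> 2 * T * (3 * K) + K\<^sup>2"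
      using e b KT by (intro add_mono) (auto simp: abs_mult)
    also have "\<dots> < T * (K * 6) + T"
      using KT by (simp add: algebra_simps)
    also have "\<dots> \<le> T * T"
    proof -
      have "K * 6 + 1 \<le> T" using KT K by linarith
      then have "T * (K * 6 + 1) \<le> T * T" using KT by (intro mult_left_mono) auto
      then show ?thesis by (simp add: algebra_simps)
    qed
    finally show False by (simp add: power2_eq_square)
  qed
  then have r: "r = r'" by (simp add: a_def)
  have be: "b = 2 * T * e" using z \<open>a = 0\<close> by (simp add: T_def)
  have "e = 0"
  proof (rule ccontr)
    assume "e \<noteq> 0"
    then have "T * 1 \<le> T * \<bar>e\<bar>" using KT by (intro mult_left_mono) auto
    also have "\<dots> \<le> \<bar>b\<bar>" using KT unfolding be by (simp add: abs_mult)
    finally show False using b KT by (smt (verit) zero_le_power2)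
  qed
  then have "b = 0" using be by simp
  then have "s = s'" by (simp add: b_def)
  with \<open>e = 0\<close> r show ?thesis by (simp add: e_def)
qed

section \<open>Multiplicities of polynomial roots\<close>

lemma poly_dvd_cancel:
  fixes a b c :: "'a::idom poly"
  assumes "a * b dvd a * c" "a \<noteq> 0"
  shows "b dvd c"
  using assms dvd_mult_cancel_left[of a b c] by blast

text \<open>The substitution factors the linear polynomial at the root as \<open>x - \<mu>\<close>
  times \<open>(x + \<mu>) / 2\<close>. The second factor is nonzero at \<mu>, so orders are
  preserved.\<close>

lemma power_dvd_pcompose:
  fixes p :: "complex poly"
  assumes "p \<noteq> 0" "[:- \<mu>, 1:] ^ k dvd pcompose p [:- (\<rho>\<^sup>2) / 2, 0, 1 / 2:]" "\<mu> \<noteq> 0"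
  shows "[:- ((\<mu>\<^sup>2 - \<rho>\<^sup>2) / 2), 1:] ^ k dvd p"
proof -
  define h where "h = (\<mu>\<^sup>2 - \<rho>\<^sup>2) / 2"
  let ?g = "[:- (\<rho>\<^sup>2) / 2, 0, 1 / 2:]"
  obtain q where q: "p = [:- h, 1:] ^ order h p * q" "\<not> [:- h, 1:] dvd q"
    using order_decomp[OF assms(1)] by blast
  define m where "m = order h p"
  define R where "R = [:\<mu> / 2, 1 / 2:] ^ m * pcompose q ?g"
  have pw: "pcompose (f ^ m) ?g = pcompose f ?g ^ m" for f m
    by (induction m) (simp_all add: pcompose_1 pcompose_mult)
  have "pcompose [:- h, 1:] ?g = [:- \<mu>, 1:] * [:\<mu> / 2, 1 / 2:]"
    by (simp add: pcompose_pCons h_def field_simps power2_eq_square)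
  then have "pcompose ([:- h, 1:] ^ m * q) ?g = [:- \<mu>, 1:] ^ m * R"
    by (simp only: pcompose_mult pw power_mult_distrib R_def mult.assoc)
  then have R: "pcompose p ?g = [:- \<mu>, 1:] ^ m * R"
    using q(1) unfolding m_def by simp
  have "poly ?g \<mu> = h" by (simp add: h_def power2_eq_square field_simps)
  then have "poly R \<mu> = \<mu> ^ m * poly q h"
    by (simp add: R_def poly_pcompose field_simps)
  then have Rn: "poly R \<mu> \<noteq> 0"
    using assms(3) q(2) by (simp add: poly_eq_0_iff_dvd)
  have "k \<le> m"
  proof (rule ccontr)
    assume "\<not> k \<le> m"
    then have "[:- \<mu>, 1:] ^ Suc m dvd [:- \<mu>, 1:] ^ k" by (intro le_imp_power_dvd) simp
    from dvd_trans[OF this assms(2)] have "[:- \<mu>, 1:] ^ m * [:- \<mu>, 1:] dvd [:- \<mu>, 1:] ^ m * R"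
      by (simp only: R power_Suc2)
    moreover have "[:- \<mu>, 1:] ^ m \<noteq> 0" by simp
    ultimately have "[:- \<mu>, 1:] dvd R" by (rule poly_dvd_cancel)
    then show False using Rn by (simp add: poly_eq_0_iff_dvd)
  qed
  then have "[:- h, 1:] ^ k dvd [:- h, 1:] ^ m" by (rule le_imp_power_dvd)
  also have "\<dots> dvd p" by (subst q(1)) (simp add: m_def)
  finally show ?thesis by (simp add: h_def)
qed

lemma power_dvd_cancel:
  fixes q Q :: "complex poly"
  assumes "[:- a, 1:] ^ k dvd Q * q" "poly Q a \<noteq> 0"
  shows "[:- a, 1:] ^ k dvd q"
  using assms(1)
proof (induction k)
  case (Suc k)
  then have "[:- a, 1:] ^ k dvd q"
    using dvd_trans[OF le_imp_power_dvd[of k "Suc k"] Suc.prems] by simp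
  then obtain q' where q': "q = [:- a, 1:] ^ k * q'" by (auto simp: dvd_def)
  have "[:- a, 1:] ^ k * [:- a, 1:] dvd [:- a, 1:] ^ k * (Q * q')"
    using Suc.prems by (simp only: q' power_Suc2 mult_ac)
  moreover have "[:- a, 1:] ^ k \<noteq> 0" by simp
  ultimately have "[:- a, 1:] dvd Q * q'" by (rule poly_dvd_cancel)
  then have "poly (Q * q') a = 0" by (simp only: poly_eq_0_iff_dvd)
  then have "[:- a, 1:] dvd q'" using assms(2) by (simp add: poly_eq_0_iff_dvd)
  then show ?case unfolding q' power_Suc2 by (rule mult_dvd_mono[OF dvd_refl])
qed simp

lemma prod_power_dvd:
  fixes p :: "complex poly"
  assumes "finite I" "inj_on a I" "\<And>i. i \<in> I \<Longrightarrow> [:- a i, 1:] ^ k i dvd p"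
  shows "(\<Prod>i\<in>I. [:- a i, 1:] ^ k i) dvd p"
  using assms
proof (induction I rule: finite_induct)
  case (insert x I)
  then have "(\<Prod>i\<in>I. [:- a i, 1:] ^ k i) dvd p" by simp
  then obtain q where q: "p = (\<Prod>i\<in>I. [:- a i, 1:] ^ k i) * q" by (auto simp: dvd_def)
  have "poly (\<Prod>i\<in>I. [:- a i, 1:] ^ k i) (a x) \<noteq> 0"
    using insert by (auto simp: poly_prod)
  moreover have "[:- a x, 1:] ^ k x dvd (\<Prod>i\<in>I. [:- a i, 1:] ^ k i) * q"
    using insert.prems(2)[of x] q by simp
  ultimately have "[:- a x, 1:] ^ k x dvd q" by (rule power_dvd_cancel[rotated])
  then have "(\<Prod>i\<in>I. [:- a i, 1:] ^ k i) * [:- a x, 1:] ^ k x dvd p"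
    unfolding q by (rule mult_dvd_mono[OF dvd_refl])
  then show ?case using insert by (simp add: mult.commute)
qed simp

lemma poly_const_of_tendsto:
  fixes q :: "complex poly"
  assumes "(\<lambda>j. poly q (x j)) \<longlonglongrightarrow> L" "filterlim x at_infinity sequentially"
  shows "q = [:L:]"
proof -
  obtain a q' where q: "q = pCons a q'" by (cases q)
  have "q' = 0"
  proof (rule ccontr)
    assume "q' \<noteq> 0"
    from poly_infinity[OF this, of "norm L + 1" a] obtain R
      where R: "\<And>z. R \<le> norm z \<Longrightarrow> norm L + 1 \<le> norm (poly q z)"
      unfolding q by blast
    have "eventually (\<lambda>j. R \<le> norm (x j)) sequentially"
      using assms(2) unfolding filterlim_at_infinity_conv_norm_at_top filterlim_at_top by blast
    then have "eventually (\<lambda>j. norm L + 1 \<le> norm (poly q (x j))) sequentially"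
      by (rule eventually_mono) (rule R)
    then have "norm L + 1 \<le> norm L"
      by (intro tendsto_le[OF _ tendsto_norm[OF assms(1)] tendsto_const]) auto
    then show False by simp
  qed
  then have q: "q = [:a:]" using q by simp
  then have "L = a" using assms(1) LIMSEQ_unique[OF _ tendsto_const[of a]] by simp
  then show ?thesis using q by simp
qed

section \<open>The formula at a large integer \<open>t\<close>\<close>

definition kac_formula :: "nat \<Rightarrow> complex \<Rightarrow> complex \<Rightarrow> complex \<Rightarrow> bool" where
  "kac_formula N C t h \<longleftrightarrow> gram_det N (kac_c t) h
     = C * (\<Prod>(r, s)\<in>kac_pairs N. (h - kac_h t r s) ^ num_partitions (N - r * s))"

lemma kac_root_dvd:
  assumes rs: "1 \<le> r" "1 \<le> s" "r * s \<le> N" and t: "8 * (N + 1)\<^sup>2 \<le> t"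
    and IH: "\<And>h. kac_formula (N - r * s) C (of_nat t) h" and C: "C \<noteq> 0"
    and p: "\<And>h. gram_det N (kac_c (of_nat t)) h = poly p h" and p0: "p \<noteq> 0"
  shows "[:- kac_h (of_nat t) r s, 1:] ^ num_partitions (N - r * s) dvd p"
proof -
  have t0: "t > 0" using t by (simp add: power2_eq_square)
  define \<alpha> where "\<alpha> = complex_of_real (sqrt (2 * real t))"
  define \<rho> where "\<rho> = (of_nat t - 1) / \<alpha>"
  define \<mu> where "\<mu> = (of_nat t * of_nat r - of_nat s) / \<alpha>"
  have \<alpha>: "\<alpha> \<noteq> 0" using t0 by (simp add: \<alpha>_def)
  have \<alpha>2: "\<alpha>\<^sup>2 = 2 * of_nat t"
    unfolding \<alpha>_def of_real_power[symmetric] by simp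
  have \<rho>2: "\<rho>\<^sup>2 = (of_nat t - 1)\<^sup>2 / (2 * of_nat t)" and \<mu>2: "\<mu>\<^sup>2 = (of_nat t * of_nat r - of_nat s)\<^sup>2 / (2 * of_nat t)"
    by (simp_all add: \<rho>_def \<mu>_def power_divide \<alpha>2)
  have c: "kac_c (of_nat t) = 1 - 12 * \<rho>\<^sup>2"
    unfolding \<rho>2 using t0 by (simp add: kac_c_def field_simps power2_eq_square)
  have h: "kac_h (of_nat t) r s = (\<mu>\<^sup>2 - \<rho>\<^sup>2) / 2"
    unfolding \<rho>2 \<mu>2 using t0 by (simp add: kac_h_def field_simps power2_eq_square)
  \<comment> \<open>Needed for \<mu> to be nonzero, so that the order in the momentum is the order
    in \<open>h\<close>.\<close>
  have "s < t * r"
  proof -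
    have "s \<le> r * s" using rs by simp
    also have "\<dots> \<le> N" by (rule rs)
    also have "N < t" using t by (simp add: power2_eq_square)
    also have "t \<le> t * r" using rs by simp
    finally show ?thesis .
  qed
  then have "of_nat (t * r) \<noteq> (of_nat s :: complex)"
    by (simp only: of_nat_eq_iff)
  then have \<mu>: "\<mu> \<noteq> 0" using \<alpha> by (simp add: \<mu>_def)
  obtain M0 where M0: "fock_sing r s t \<alpha> M0 \<noteq> 0"
    using fock_sing_nonzero[OF rs(1) \<alpha>] by blast
  have "\<exists>a. \<forall>\<mu>. dt (num_partitions N) (fockA \<rho> \<mu> N) = poly a \<mu>"
    unfolding dt_def fockA_def
    by (intro poly_fun.det poly_fun.fockW poly_fun.const poly_fun_id)
  then obtain a where a: "\<And>\<mu>. dt (num_partitions N) (fockA \<rho> \<mu> N) = poly a \<mu>" by blast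
  have "\<exists>b. \<forall>\<mu>. dt (num_partitions N) (fockB \<rho> \<mu> N) = poly b \<mu>"
    unfolding dt_def fockB_def
    by (intro poly_fun.det poly_fun.fockW poly_fun.const poly_fun_id)
  then obtain b where b: "\<And>\<mu>. dt (num_partitions N) (fockB \<rho> \<mu> N) = poly b \<mu>" by blast
  \<comment> \<open>The weight of the singular vector is not a root at level
    \<open>N - r * s\<close>, so the induction hypothesis makes the smaller determinant
    nonzero.\<close>
  have nz: "gram_det (N - r * s) (kac_c (of_nat t)) (kac_h (of_nat t) r s + of_nat (r * s)) \<noteq> 0"
  proof -
    have "kac_h (of_nat t) r s + of_nat (r * s) - kac_h (of_nat t) r' s' \<noteq> 0"
      if "(r', s') \<in> kac_pairs (N - r * s)" for r' s'
    proof
      assume "kac_h (of_nat t) r s + of_nat (r * s) - kac_h (of_nat t) r' s' = 0"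
      then have "r * s = 0 \<and> r = r' \<and> s = s'"
        by (intro kac_h_diff_generic[OF rs _ _ _ rs(3) t]) (use that in \<open>auto simp: kac_pairs_def\<close>)
      then show False using rs by simp
    qed
    then show ?thesis
      using IH[of "kac_h (of_nat t) r s + of_nat (r * s)"] C unfolding kac_formula_def
      by (auto simp: finite_kac_pairs)
  qed
  have "[:- \<mu>, 1:] ^ num_partitions (N - r * s) dvd b"
  proof (rule fockB_dvd[OF fock_sing_lev[OF rs(1)] fock_sing_singular[OF rs(1)] M0])
    show "\<alpha>\<^sup>2 = 2 * of_nat t" by (rule \<alpha>2)
    show "\<rho> * \<alpha> = of_nat t - 1" "\<mu> * \<alpha> = of_nat t * of_nat r - of_nat s"
      using \<alpha> by (simp_all add: \<rho>_def \<mu>_def)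
    show "gram_det (N - r * s) (kac_c (of_nat t)) (kac_h (of_nat t) r s + of_nat (r * s)) \<noteq> 0" by (rule nz)
    show "kac_h (of_nat t) r s + of_nat (r * s) = (\<mu>\<^sup>2 - \<rho>\<^sup>2) / 2 + of_nat (r * s)" by (simp add: h)
  qed (use rs c b in auto)
  \<comment> \<open>In the momentum variable \<open>p\<close> is the product of both Fock
    determinants, so it inherits the divisor found for \<open>b\<close>.\<close>
  moreover have "pcompose p [:- (\<rho>\<^sup>2) / 2, 0, 1 / 2:] = a * b"
  proof (rule poly_ext)
    fix x
    have "poly [:- (\<rho>\<^sup>2) / 2, 0, 1 / 2:] x = (x\<^sup>2 - \<rho>\<^sup>2) / 2"
      by (simp add: power2_eq_square field_simps)
    then show "poly (pcompose p [:- (\<rho>\<^sup>2) / 2, 0, 1 / 2:]) x = poly (a * b) x"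
      by (simp only: poly_pcompose p[symmetric] gram_det_fock[OF c refl] a b poly_mult)
  qed
  ultimately have "[:- \<mu>, 1:] ^ num_partitions (N - r * s) dvd pcompose p [:- (\<rho>\<^sup>2) / 2, 0, 1 / 2:]"
    by (simp add: dvd_mult)
  from power_dvd_pcompose[OF p0 this \<mu>] show ?thesis by (simp add: h)
qed

lemma seqc_shift_lim: "(\<lambda>j. ((seqc j)\<^sup>2 / 2 - k) / (seqc j)\<^sup>2) \<longlonglongrightarrow> 1 / 2"
proof -
  have "(\<lambda>j. 1 / 2 - k * (1 / seqc j) ^ 2) \<longlonglongrightarrow> 1 / 2 - k * 0 ^ 2"
    by (intro tendsto_intros seqc_inverse)
  moreover have "((seqc j)\<^sup>2 / 2 - k) / (seqc j)\<^sup>2 = 1 / 2 - k * (1 / seqc j) ^ 2" for j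
    by (simp add: field_simps)
  ultimately show ?thesis by simp
qed

lemma seqc_shift_infinity: "filterlim (\<lambda>j. ((seqc j)\<^sup>2 - k) / 2) at_infinity sequentially"
  unfolding filterlim_at_infinity_conv_norm_at_top
proof (rule filterlim_at_top_mono)
  show "filterlim (\<lambda>j. - (norm k / 2) + 1 / 2 * real j) at_top sequentially"
    by (intro filterlim_tendsto_add_at_top[OF tendsto_const]
        filterlim_tendsto_pos_mult_at_top[OF tendsto_const _ filterlim_real_sequentially]) simp
  show "eventually (\<lambda>j. - (norm k / 2) + 1 / 2 * real j \<le> norm (((seqc j)\<^sup>2 - k) / 2)) sequentially"
  proof (rule always_eventually, rule allI)
    fix j
    have "real j \<le> (real (Suc j))\<^sup>2" by (simp add: power2_eq_square algebra_simps)
    also have "\<dots> = norm ((seqc j)\<^sup>2)" by (simp only: seqc_def norm_power norm_of_nat)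
    also have "\<dots> \<le> norm ((seqc j)\<^sup>2 - k) + norm k"
      using norm_triangle_ineq[of "(seqc j)\<^sup>2 - k" k] by simp
    finally show "- (norm k / 2) + 1 / 2 * real j \<le> norm (((seqc j)\<^sup>2 - k) / 2)"
      by (simp add: norm_divide field_simps)
  qed
qed

lemma kac_formula_integer:
  assumes IH: "\<And>N'. N' < N \<Longrightarrow> \<exists>C. C \<noteq> 0 \<and> (\<forall>t h. t \<noteq> 0 \<longrightarrow> kac_formula N' C t h)"
    and z: "z > 0" "\<And>\<rho>. (\<lambda>j. gram_det N (1 - 12 * \<rho>\<^sup>2) (((seqc j)\<^sup>2 - \<rho>\<^sup>2) / 2) / seqc j ^ (2 * lens N)) \<longlonglongrightarrow> of_real (z :: real)"
    and t: "8 * (N + 1)\<^sup>2 \<le> t"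
  shows "kac_formula N (of_real (z * 2 ^ lens N)) (of_nat t) h"
proof -
  have t0: "t > 0" using t by (simp add: power2_eq_square)
  let ?K = "kac_pairs N" and ?P = "\<lambda>(r, s). num_partitions (N - r * s)" and ?h = "\<lambda>(r, s). kac_h (of_nat t) r s"
  define \<rho> where "\<rho> = csqrt ((1 - kac_c (of_nat t)) / 12)"
  have c: "kac_c (of_nat t) = 1 - 12 * \<rho>\<^sup>2"
    by (simp add: \<rho>_def diff_divide_distrib)
  define x where "x j = ((seqc j)\<^sup>2 - \<rho>\<^sup>2) / 2" for j
  obtain p where p: "\<And>h. gram_det N (kac_c (of_nat t)) h = poly p h"
    using gram_det_poly by blast
  have pl: "(\<lambda>j. poly p (x j) / seqc j ^ (2 * lens N)) \<longlonglongrightarrow> of_real z"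
    using z(2)[of \<rho>] unfolding c[symmetric] p x_def .
  have p0: "p \<noteq> 0"
  proof
    assume "p = 0"
    then have "(\<lambda>j. 0) \<longlonglongrightarrow> complex_of_real z" using pl by simp
    then have "complex_of_real z = 0" by (rule LIMSEQ_unique) (rule tendsto_const)
    then show False using z(1) by simp
  qed
  define Q where "Q = (\<Prod>i\<in>?K. [:- ?h i, 1:] ^ ?P i)"
  have "Q dvd p"
    unfolding Q_def
  proof (rule prod_power_dvd[OF finite_kac_pairs])
    show "inj_on ?h ?K"
    proof (rule inj_onI, clarify)
      fix r s r' s' assume *: "(r, s) \<in> ?K" "(r', s') \<in> ?K" "kac_h (of_nat t) r s = kac_h (of_nat t) r' s'"
      have "(0::nat) = 0 \<and> r = r' \<and> s = s'"
        by (rule kac_h_diff_generic[where N = N and t = t]) (use * t in \<open>auto simp: kac_pairs_def\<close>)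
      then show "r = r' \<and> s = s'" by simp
    qed
    fix i assume i: "i \<in> ?K"
    obtain r s where rs: "i = (r, s)" by force
    have "0 < r * s" "r * s \<le> N" using i rs by (auto simp: kac_pairs_def)
    then have "N - r * s < N" by linarith
    from IH[OF this] obtain C where C: "C \<noteq> 0" "\<And>t h. t \<noteq> 0 \<Longrightarrow> kac_formula (N - r * s) C t h" by blast
    have "[:- kac_h (of_nat t) r s, 1:] ^ num_partitions (N - r * s) dvd p"
      by (rule kac_root_dvd[OF _ _ _ t _ C(1) p p0]) (use i rs C(2) t0 in \<open>auto simp: kac_pairs_def\<close>)
    then show "[:- ?h i, 1:] ^ ?P i dvd p" by (simp add: rs)
  qed
  then obtain q where q: "p = Q * q" by (auto simp: dvd_def)
  have lens: "lens N = (\<Sum>i\<in>?K. ?P i)"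
    by (simp add: lens_eq case_prod_beta)
  \<comment> \<open>\<open>Q\<close> is monic of degree \<open>lens N\<close> and \<open>h\<close>
    grows like half the squared momentum. Comparison with \<open>pl\<close> shows that
    \<open>q\<close> has a finite limit, so it is constant; this produces the factor
    \<open>2 ^ lens N\<close>.\<close>
  have Ql: "(\<lambda>j. poly Q (x j) / seqc j ^ (2 * lens N)) \<longlonglongrightarrow> (1 / 2) ^ lens N"
  proof -
    have "(\<lambda>j. (x j - k) / (seqc j)\<^sup>2) \<longlonglongrightarrow> 1 / 2" for k
      using seqc_shift_lim[of "\<rho>\<^sup>2 / 2 + k"] by (simp add: x_def diff_divide_distrib diff_diff_eq)
    then have "(\<lambda>j. \<Prod>i\<in>?K. ((x j - ?h i) / (seqc j)\<^sup>2) ^ ?P i) \<longlonglongrightarrow> (\<Prod>i\<in>?K. (1 / 2) ^ ?P i)"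
      by (intro tendsto_prod tendsto_power)
    moreover have "(\<Prod>i\<in>?K. ((x j - ?h i) / (seqc j)\<^sup>2) ^ ?P i) = poly Q (x j) / seqc j ^ (2 * lens N)" for j
      by (simp add: Q_def poly_prod power_divide prod_dividef power_mult lens power_sum)
    ultimately show ?thesis by (simp add: lens power_sum)
  qed
  have "(\<lambda>j. (poly p (x j) / seqc j ^ (2 * lens N)) / (poly Q (x j) / seqc j ^ (2 * lens N)))
      \<longlonglongrightarrow> of_real z / (1 / 2) ^ lens N"
    by (rule tendsto_divide[OF pl Ql]) simp
  moreover have "eventually (\<lambda>j. (poly p (x j) / seqc j ^ (2 * lens N)) / (poly Q (x j) / seqc j ^ (2 * lens N)) = poly q (x j)) sequentially"
  proof -
    have "eventually (\<lambda>j. poly Q (x j) / seqc j ^ (2 * lens N) \<noteq> 0) sequentially"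
      by (rule tendsto_imp_eventually_ne[OF Ql]) simp
    then show ?thesis by (rule eventually_mono) (simp add: q)
  qed
  ultimately have "(\<lambda>j. poly q (x j)) \<longlonglongrightarrow> of_real z / (1 / 2) ^ lens N"
    by (rule Lim_transform_eventually)
  then have "q = [:of_real z / (1 / 2) ^ lens N:]"
    unfolding x_def by (rule poly_const_of_tendsto[OF _ seqc_shift_infinity])
  then have "p = smult (of_real (z * 2 ^ lens N)) Q"
    using q by (simp add: power_divide mult.commute)
  then show ?thesis
    unfolding kac_formula_def p by (simp add: Q_def poly_prod case_prod_beta)
qed

subsection \<open>All central charges\<close>

interpretation laurent_fun: function_algebra "\<lambda>f :: complex \<Rightarrow> complex. \<exists>K q. \<forall>t. t \<noteq> 0 \<longrightarrow> f t * t ^ K = poly q t"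
proof
  show "\<exists>K q. \<forall>t. t \<noteq> 0 \<longrightarrow> a * t ^ K = poly q t" for a :: complex
    by (intro exI[of _ 0] exI[of _ "[:a:]"]) simp
next
  fix f g :: "complex \<Rightarrow> complex"
  assume "\<exists>K q. \<forall>t. t \<noteq> 0 \<longrightarrow> f t * t ^ K = poly q t" "\<exists>K q. \<forall>t. t \<noteq> 0 \<longrightarrow> g t * t ^ K = poly q t"
  then obtain K q K' q' where *: "\<And>t. t \<noteq> 0 \<Longrightarrow> f t * t ^ K = poly q t" "\<And>t. t \<noteq> 0 \<Longrightarrow> g t * t ^ K' = poly q' t"
    by blast
  have "(f t + g t) * t ^ (K + K') = poly (q * monom 1 K' + q' * monom 1 K) t"
       "(f t * g t) * t ^ (K + K') = poly (q * q') t" if "t \<noteq> 0" for t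
    by (simp_all add: *[OF that, symmetric] poly_monom power_add algebra_simps)
  then show "\<exists>K q. \<forall>t. t \<noteq> 0 \<longrightarrow> (f t + g t) * t ^ K = poly q t" "\<exists>K q. \<forall>t. t \<noteq> 0 \<longrightarrow> (f t * g t) * t ^ K = poly q t"
    by blast+
qed

lemma laurent_fun_id: "\<exists>K q. \<forall>t. t \<noteq> 0 \<longrightarrow> t * t ^ K = poly q (t :: complex)"
  by (intro exI[of _ 0] exI[of _ "[:0, 1:]"]) simp

lemma laurent_fun_inverse: "\<exists>K q. \<forall>t. t \<noteq> 0 \<longrightarrow> 1 / t * t ^ K = poly q (t :: complex)"
  by (intro exI[of _ 1] exI[of _ 1]) simp

text \<open>Clearing the pole leaves a polynomial with infinitely many roots.\<close>

lemma laurent_fun_zero: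
  fixes f :: "complex \<Rightarrow> complex"
  assumes "\<exists>K q. \<forall>t. t \<noteq> 0 \<longrightarrow> f t * t ^ K = poly q t" "\<And>n. n \<ge> T \<Longrightarrow> f (of_nat n) = 0" "t \<noteq> 0"
  shows "f t = 0"
proof -
  obtain K q where q: "\<And>t. t \<noteq> 0 \<Longrightarrow> f t * t ^ K = poly q t" using assms(1) by blast
  have "q = 0"
  proof (rule ccontr)
    assume "q \<noteq> 0"
    then have "finite {x. poly q x = 0}" by (rule poly_roots_finite)
    \<comment> \<open>The maximum with 1 excludes \<open>t = 0\<close>, where the polynomial is not
      tied to \<open>f\<close>.\<close>
    moreover have "of_nat ` {max 1 T..} \<subseteq> {x. poly q x = 0}"
      using q assms(2) by (auto simp flip: q)
    ultimately have "finite (of_nat ` {max 1 T..} :: complex set)" by (rule rev_finite_subset)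
    then show False
      by (subst (asm) finite_image_iff) (auto simp: inj_on_def infinite_Ici)
  qed
  then show ?thesis using q[OF assms(3)] assms(3) by simp
qed

lemma laurent_fun_kac_h: "\<exists>K q. \<forall>t. t \<noteq> 0 \<longrightarrow> kac_h t r s * t ^ K = poly q t"
proof -
  have "kac_h t r s = of_nat (r ^ 2) / 4 * t + of_nat (s ^ 2) / 4 * (1 / t) + (1 / 2 - of_nat (r * s) / 2)
      + (- 1 / 4) * t + (- 1 / 4) * (1 / t)" for t
    by (simp add: kac_h_def)
  then show ?thesis
    by (simp only:) (intro laurent_fun.add laurent_fun.mult laurent_fun.const laurent_fun_id laurent_fun_inverse)
qed

lemma laurent_fun_gram_det: "\<exists>K q. \<forall>t. t \<noteq> 0 \<longrightarrow> gram_det N (kac_c t) h * t ^ K = poly q t"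
proof -
  have "kac_c t = 13 + (- 6) * t + (- 6) * (1 / t)" for t
    by (simp add: kac_c_def)
  then have "\<exists>K q. \<forall>t. t \<noteq> 0 \<longrightarrow> kac_c t * t ^ K = poly q t"
    by (simp only:) (intro laurent_fun.add laurent_fun.mult laurent_fun.const laurent_fun_id laurent_fun_inverse)
  then show ?thesis
    unfolding gram_det_def dt_def
    by (intro laurent_fun.det laurent_fun.vac_fun[of kac_c "\<lambda>_. h" "\<lambda>t. vev (kac_c t) h"] vac_fun_vev laurent_fun.const)
qed

theorem kac_formula_exists: "\<exists>C::real. C > 0 \<and> (\<forall>t h. t \<noteq> 0 \<longrightarrow> kac_formula N (of_real C) t h)"
proof (induction N rule: less_induct)
  case (less N)
  have IH: "\<exists>C. C \<noteq> 0 \<and> (\<forall>t h. t \<noteq> 0 \<longrightarrow> kac_formula N' C t h)" if N': "N' < N" for N'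
  proof -
    obtain C :: real where "C > 0" "\<forall>t h. t \<noteq> 0 \<longrightarrow> kac_formula N' (of_real C) t h"
      using less[OF N'] by blast
    then show ?thesis by (intro exI[of _ "of_real C"]) auto
  qed
  obtain z :: real where z: "z > 0"
    "\<And>\<rho>. (\<lambda>j. gram_det N (1 - 12 * \<rho>\<^sup>2) (((seqc j)\<^sup>2 - \<rho>\<^sup>2) / 2) / seqc j ^ (2 * lens N)) \<longlonglongrightarrow> of_real z"
    using gram_det_lim[of N] by blast
  \<comment> \<open>Chosen before \<open>t\<close> and \<open>h\<close>, so for fixed
    \<open>h\<close> the difference \<open>?f\<close> below is a single Laurent polynomial in
    \<open>t\<close> that vanishes at all large integers.\<close>
  define C where "C = z * 2 ^ lens N"
  have "kac_formula N (of_real C) t h" if t: "t \<noteq> 0" for t h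
  proof -
    let ?f = "\<lambda>t. gram_det N (kac_c t) h
      - of_real C * (\<Prod>i\<in>kac_pairs N. (h - kac_h t (fst i) (snd i)) ^ num_partitions (N - fst i * snd i))"
    have "?f t = 0"
    proof (rule laurent_fun_zero[of ?f, OF _ _ t])
      show "\<exists>K q. \<forall>t. t \<noteq> 0 \<longrightarrow> ?f t * t ^ K = poly q t"
        by (intro laurent_fun.diff laurent_fun.mult laurent_fun.const laurent_fun.prod laurent_fun.power
            laurent_fun_gram_det laurent_fun_kac_h)
      fix n assume "8 * (N + 1)\<^sup>2 \<le> n"
      from kac_formula_integer[OF IH z this, of h]
      show "?f (of_nat n) = 0"
        by (simp add: kac_formula_def C_def case_prod_beta)
    qed
    then show ?thesis by (simp add: kac_formula_def case_prod_beta)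
  qed
  moreover have "C > 0" using z(1) by (simp add: C_def)
  ultimately show ?case by blast
qed

theorem mainTheorem5:
  fixes N :: nat
  assumes "N \<ge> 1"
  shows "\<exists>C::real. C > 0 \<and>
    (\<forall>(c::real) (h::real) (s::complex). s ^ 2 = complex_of_real ((c - 1) * (c - 25)) \<longrightarrow>
      kac_det N c h = complex_of_real C *
        (\<Prod>(p, q) \<in> {(p, q). 1 \<le> p \<and> 1 \<le> q \<and> p * q \<le> N}.
          (complex_of_real h - h_pq s c p q) ^ num_partitions (N - p * q)))"
proof -
  obtain C :: real where C: "C > 0" "\<And>t h. t \<noteq> 0 \<Longrightarrow> kac_formula N (of_real C) t h"
    using kac_formula_exists by blast
  have "kac_det N c h = complex_of_real C * (\<Prod>(p, q) \<in> {(p, q). 1 \<le> p \<and> 1 \<le> q \<and> p * q \<le> N}.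
          (complex_of_real h - h_pq s c p q) ^ num_partitions (N - p * q))"
    if s: "s ^ 2 = complex_of_real ((c - 1) * (c - 25))" for c h :: real and s :: complex
  proof -
    \<comment> \<open>Solves \<open>c = 13 - 6 * t - 6 / t\<close>. The other root \<open>t'\<close>
      is the inverse, since \<open>(13 - c)\<^sup>2 - (c - 1) * (c - 25) = 144\<close>; so
      \<open>t\<close> is nonzero, and replacing \<open>s\<close> by \<open>- s\<close> exchanges
      the two.\<close>
    define t where "t = (13 - of_real c + s) / 12"
    define t' where "t' = (13 - of_real c - s) / 12"
    have tt: "t * t' = 1"
    proof -
      have "t * t' = ((13 - of_real c)\<^sup>2 - s\<^sup>2) / 144"
        by (simp add: t_def t'_def power2_eq_square field_simps)
      also have "\<dots> = 1" unfolding s by (simp add: power2_eq_square field_simps)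
      finally show ?thesis .
    qed
    then have t: "t \<noteq> 0" by auto
    have t': "1 / t = t'" using tt t by (simp add: field_simps)
    have "kac_c t = 13 - 6 * t - 6 * (1 / t)" by (simp add: kac_c_def)
    also have "\<dots> = of_real c" unfolding t' by (simp add: t_def t'_def field_simps)
    finally have c: "of_real c = kac_c t" ..
    have "h_pq s c p q = kac_h t p q" for p q
    proof -
      have "kac_h t p q = t * of_nat (p ^ 2) / 4 + of_nat (q ^ 2) / 4 * (1 / t) - of_nat (p * q) / 2 + 1 / 2 - t / 4 - 1 / 4 * (1 / t)"
        by (simp add: kac_h_def)
      also have "\<dots> = h_pq s c p q"
        unfolding t' by (simp add: h_pq_def t_def t'_def field_simps)
      finally show ?thesis ..
    qed
    then show ?thesis
      using C(2)[OF t, of "of_real h"] by (simp add: kac_formula_def kac_det_gram_det c kac_pairs_def)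
  qed
  then show ?thesis using C(1) by blast
qed

end
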